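(* Let $D\ge2$, $x\in\mathbb R^D$, $\tau>0$, $L>0$, $R>0$, $0<f_{\min}<f_{\max}$ and $p\ge1$. Let $d=1$ and $\beta>0$. Then there exists an estimator $\widehat f^{\,1D}(x)$ (a real-valued measurable function of the sample $(X_1,\dots,X_n)$ for each $n$), depending on $\beta$, such that for any $\alpha\ge0$ there exist constants $C>0$ and $n_0$ depending only on $\alpha,\beta,\tau,L,f_{\min},f_{\max},R,p$ ($D$ being fixed) with, for all $n\ge n_0$, $$\sup_{P\in\Sigma^1_{\alpha,\beta}}\mathbb E_{P^{\otimes n}}\big[|\widehat f^{\,1D}(x)-f_P(x)|^p\big]^{1/p}\le C\,n^{-\beta/(2\beta+1)},$$ where $\Sigma^1_{\alpha,\beta}=\Sigma^1_{\alpha,\beta}(\tau,L,f_{\min},f_{\max},R)$ is the class of probability measures defined in the context (with $d=1$).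
   Context: $\|\cdot\|$ is the Euclidean norm of $\mathbb R^D$; for a linear subspace $H$, $B_H(v,r)$ is the open ball of $H$. $\|\cdot\|_{\mathrm{op}}$ is the operator norm of multilinear maps. For a compact smooth submanifold $M\subset\mathbb R^D$ and $z\in M$, $\exp_z:T_zM\to M\subset\mathbb R^D$ is the Riemannian exponential map (for the induced metric) and $\mathrm{inj}_M(z)$ is the injectivity radius at $z$, the supremum of all $\varepsilon$ such that $\exp_z$ is a smooth parametrization of $M$ on $B_{T_zM}(0,\varepsilon)$. $\mu_M$ is the volume measure on $M$ (restriction to $M$ of the $d$-dimensional Hausdorff measure, $d=\dim M$). Reach: $\tau_M=\sup\{r\ge0:\ \forall y\in\mathbb R^D,\ d(y,M)\le r\Rightarrow\exists!\,z\in M,\ d(y,M)=\|y-z\|\}$. Hölder functions: for $\gamma>0$ put $k=\lceil\gamma-1\rceil$, $\delta=\gamma-k>0$. A map $f:M\to\mathbb R^m$ is $\gamma$-Hölder ($f\in\mathcal H^\gamma(M,\mathbb R^m)$) if for all $z\in M$, $f\circ\exp_z$ is $k$ times differentiable on $B_{T_zM}(0,\mathrm{inj}_M(z))$ with $d^k(f\circ\exp_z)$ $\delta$-Hölder there, and $$\|f\|_{\mathcal H^\gamma}=\sup_{z\in M}\ \sup_{v\neq w\in B_{T_zM}(0,\mathrm{inj}_M(z))}\frac{\|d^k(f\circ\exp_z)(v)-d^k(f\circ\exp_z)(w)\|_{\mathrm{op}}}{\|v-w\|^\delta}.$$ Manifold classes: $\mathcal C_d(\tau)$ is the set of compact smooth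 submanifolds $M$ of $\mathbb R^D$, without boundary, of dimension $d$, containing the fixed point $x$, with $\tau_M\ge\tau$. $\mathcal C_{d,\alpha}(\tau,L)$ is the set of $M\in\mathcal C_d(\tau)$ whose inclusion map $\iota_M:M\hookrightarrow\mathbb R^D$ is $(\alpha+1)$-Hölder with $\|\iota_M\|_{\mathcal H^{\alpha+1}}\le L$. Statistical model: $\Sigma^d_{\alpha,\beta}(\tau,L,f_{\min},f_{\max},R)$ is the set of Borel probability measures $P$ on $\mathbb R^D$ such that (i) there is $M_P\in\mathcal C_{d,\alpha}(\tau,L)$ with $\mathrm{supp}\,P=M_P$; (ii) there is a version $f_P$ of $dP/d\mu_{M_P}$ belonging to $\mathcal H^\beta(M_P,\mathbb R)$; (iii) $f_{\min}\le f_P\le f_{\max}$ and $\|f_P\|_{\mathcal H^\beta}\le R$. Under $P^{\otimes n}$, $X_1,\dots,X_n$ are i.i.d. with law $P$. *)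

theory Defs
  imports "HOL-Probability.Probability"
begin

section \<open>Iterated differentials on a linear subspace\<close>

text \<open>Tangent spaces are linear subspaces \<open>H\<close> of the ambient space, not types.
  The value of \<open>d\<^sup>k f (v)\<close> on \<open>(h\<^sub>1, \<dots>, h\<^sub>k)\<close> is \<open>iter_deriv f [h\<^sub>1, \<dots>, h\<^sub>k] v\<close>, obtained by
  successive directional derivatives. It is the \<open>k\<close>-th Frechet differential only where
  \<open>times_differentiable_on\<close> holds: there, each partial evaluation of \<open>d\<^sup>j f\<close> (\<open>j < k\<close>) on fixed
  directions of \<open>H\<close> is Frechet differentiable, which in finite dimension is Frechet
  differentiability of the multilinear-map-valued \<open>d\<^sup>j f\<close>.\<close>

primrec iter_deriv ::
  "('a::real_normed_vector \<Rightarrow> 'b::real_normed_vector) \<Rightarrow> 'a list \<Rightarrow> 'a \<Rightarrow> 'b" where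
  "iter_deriv f [] v = f v"
| "iter_deriv f (h # hs) v = vector_derivative (\<lambda>t::real. iter_deriv f hs (v + t *\<^sub>R h)) (at 0)"

text \<open>Here \<open>U\<close> is meant to be a relatively open subset of the subspace \<open>H\<close>.\<close>

definition times_differentiable_on ::
  "nat \<Rightarrow> 'a::real_normed_vector set \<Rightarrow> 'a set \<Rightarrow> ('a \<Rightarrow> 'b::real_normed_vector) \<Rightarrow> bool" where
  "times_differentiable_on k H U f \<longleftrightarrow>
     (\<forall>hs. set hs \<subseteq> H \<and> length hs < k \<longrightarrow> (iter_deriv f hs) differentiable_on U)"

definition smooth_on ::
  "'a::real_normed_vector set \<Rightarrow> 'a set \<Rightarrow> ('a \<Rightarrow> 'b::real_normed_vector) \<Rightarrow> bool" where
  "smooth_on H U f \<longleftrightarrow> (\<forall>k. times_differentiable_on k H U f)"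

definition multilinear_op_norm ::
  "'a::real_normed_vector set \<Rightarrow> nat \<Rightarrow> ('a list \<Rightarrow> 'b::real_normed_vector) \<Rightarrow> ennreal" where
  "multilinear_op_norm H k A =
     (SUP hs \<in> {hs. length hs = k \<and> set hs \<subseteq> H \<and> (\<forall>h\<in>set hs. norm h \<le> 1)}. ennreal (norm (A hs)))"


section \<open>Submanifolds, geodesics and the exponential map\<close>

text \<open>Embedded \<open>C\<^sup>\<infinity>\<close> submanifolds without boundary, by local straightening diffeomorphisms of the
  ambient space.\<close>

definition smooth_submanifold :: "nat \<Rightarrow> 'a::euclidean_space set \<Rightarrow> bool" where
  "smooth_submanifold d M \<longleftrightarrow>
     (\<forall>z\<in>M. \<exists>U V \<phi> \<psi> H. open U \<and> z \<in> U \<and> open V \<and> subspace H \<and> dim H = d \<and>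
        homeomorphism U V \<phi> \<psi> \<and> smooth_on UNIV U \<phi> \<and> smooth_on UNIV V (\<psi> :: 'a \<Rightarrow> 'a) \<and>
        \<phi> ` (U \<inter> M) = V \<inter> H)"

definition tangent_space :: "'a::euclidean_space set \<Rightarrow> 'a \<Rightarrow> 'a set" where
  "tangent_space M z =
     {v. \<exists>\<epsilon>>0. \<exists>c :: real \<Rightarrow> 'a. smooth_on UNIV {-\<epsilon><..<\<epsilon>} c \<and> c ` {-\<epsilon><..<\<epsilon>} \<subseteq> M \<and>
        c 0 = z \<and> (c has_vector_derivative v) (at 0)}"

text \<open>For the induced metric the covariant derivative is the tangential projection of the ambient
  one, so a curve in \<open>M\<close> is a geodesic iff its acceleration is normal to \<open>M\<close>.\<close>

definition geodesic :: "'a::euclidean_space set \<Rightarrow> (real \<Rightarrow> 'a) \<Rightarrow> bool" where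
  "geodesic M c \<longleftrightarrow> smooth_on UNIV UNIV c \<and> range c \<subseteq> M \<and>
     (\<forall>t. \<forall>u\<in>tangent_space M (c t).
        vector_derivative (\<lambda>s. vector_derivative c (at s)) (at t) \<bullet> u = 0)"

text \<open>Geodesics are required to be defined on all of \<open>\<real>\<close>, which is no restriction on compact
  submanifolds.\<close>

definition riemannian_exp :: "'a::euclidean_space set \<Rightarrow> 'a \<Rightarrow> 'a \<Rightarrow> 'a" where
  "riemannian_exp M z v =
     (THE y. \<exists>c. geodesic M c \<and> c 0 = z \<and> vector_derivative c (at 0) = v \<and> c 1 = y)"

definition subspace_ball :: "'a::real_normed_vector set \<Rightarrow> ennreal \<Rightarrow> 'a set" where
  "subspace_ball H r = {v \<in> H. ennreal (norm v) < r}"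

definition smooth_parametrization ::
  "'a::euclidean_space set \<Rightarrow> 'a set \<Rightarrow> 'a set \<Rightarrow> ('a \<Rightarrow> 'a) \<Rightarrow> bool" where
  "smooth_parametrization M H U \<phi> \<longleftrightarrow>
     smooth_on H U \<phi> \<and> openin (top_of_set M) (\<phi> ` U) \<and> (\<exists>\<psi>. homeomorphism U (\<phi> ` U) \<phi> \<psi>) \<and>
     (\<forall>v\<in>U. \<forall>h\<in>H. h \<noteq> 0 \<longrightarrow> iter_deriv \<phi> [h] v \<noteq> 0)"

definition injectivity_radius :: "'a::euclidean_space set \<Rightarrow> 'a \<Rightarrow> ennreal" where
  "injectivity_radius M z =
     Sup {ennreal \<epsilon> | \<epsilon>. \<epsilon> > 0 \<and>
       smooth_parametrization M (tangent_space M z)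
         (subspace_ball (tangent_space M z) (ennreal \<epsilon>)) (riemannian_exp M z)}"

definition injectivity_ball :: "'a::euclidean_space set \<Rightarrow> 'a \<Rightarrow> 'a set" where
  "injectivity_ball M z = subspace_ball (tangent_space M z) (injectivity_radius M z)"

definition reach :: "'a::euclidean_space set \<Rightarrow> ennreal" where
  "reach M =
     Sup {ennreal r | r. r \<ge> 0 \<and> (\<forall>y. infdist y M \<le> r \<longrightarrow> (\<exists>!z. z \<in> M \<and> infdist y M = dist y z))}"


section \<open>Volume measure\<close>

text \<open>Hausdorff measure normalised so that \<open>\<H>\<^sup>d\<close> of a \<open>d\<close>-dimensional submanifold is its
  Riemannian volume (arc length for \<open>d = 1\<close>). The empty set is treated separately because
  \<open>0 ^ 0 = 1\<close>.\<close>

definition hausdorff_gauge :: "nat \<Rightarrow> 'a::metric_space set \<Rightarrow> ennreal" where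
  "hausdorff_gauge d S =
     (if S = {} then 0 else ennreal (unit_ball_vol (real d) * (diameter S / 2) ^ d))"

definition hausdorff_outer :: "nat \<Rightarrow> 'a::metric_space set \<Rightarrow> ennreal" where
  "hausdorff_outer d A =
     (SUP \<delta> \<in> {0<..}. INF S \<in> {S :: nat \<Rightarrow> 'a set. A \<subseteq> (\<Union>i. S i) \<and>
        (\<forall>i. bounded (S i) \<and> diameter (S i) \<le> \<delta>)}. \<Sum>i. hausdorff_gauge d (S i))"

definition hausdorff_measure :: "nat \<Rightarrow> 'a::metric_space measure" where
  "hausdorff_measure d = measure_of UNIV (sets borel) (hausdorff_outer d)"

text \<open>As a Borel measure on the ambient space, \<open>A \<mapsto> \<H>\<^sup>d (A \<inter> M)\<close>.\<close>

definition volume_measure :: "nat \<Rightarrow> 'a::metric_space set \<Rightarrow> 'a measure" where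
  "volume_measure d M = density (hausdorff_measure d) (indicator M)"


section \<open>Hoelder classes\<close>

definition holder_order :: "real \<Rightarrow> nat" where
  "holder_order \<gamma> = nat \<lceil>\<gamma> - 1\<rceil>"

definition holder_quotient ::
  "'a::euclidean_space set \<Rightarrow> real \<Rightarrow> ('a \<Rightarrow> 'b::real_normed_vector) \<Rightarrow> 'a \<Rightarrow> 'a \<Rightarrow> 'a \<Rightarrow> ennreal" where
  "holder_quotient M \<gamma> f z v w =
     multilinear_op_norm (tangent_space M z) (holder_order \<gamma>)
       (\<lambda>hs. iter_deriv (f \<circ> riemannian_exp M z) hs v - iter_deriv (f \<circ> riemannian_exp M z) hs w)
     / ennreal (norm (v - w) powr (\<gamma> - real (holder_order \<gamma>)))"

definition holder_norm ::
  "'a::euclidean_space set \<Rightarrow> real \<Rightarrow> ('a \<Rightarrow> 'b::real_normed_vector) \<Rightarrow> ennreal" where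
  "holder_norm M \<gamma> f =
     (SUP z\<in>M. SUP (v, w) \<in> {(v, w). v \<in> injectivity_ball M z \<and> w \<in> injectivity_ball M z \<and> v \<noteq> w}.
        holder_quotient M \<gamma> f z v w)"

text \<open>As in the definition of \<open>\<H>\<^sup>\<gamma>\<close>, the Hoelder constant may depend on \<open>z\<close>; uniformity in \<open>z\<close>
  is the separate condition that \<open>holder_norm\<close> is finite.\<close>

definition holder_class ::
  "'a::euclidean_space set \<Rightarrow> real \<Rightarrow> ('a \<Rightarrow> 'b::real_normed_vector) set" where
  "holder_class M \<gamma> = {f. \<forall>z\<in>M.
     times_differentiable_on (holder_order \<gamma>) (tangent_space M z) (injectivity_ball M z)
       (f \<circ> riemannian_exp M z) \<and>
     (\<exists>K::real. \<forall>v\<in>injectivity_ball M z. \<forall>w\<in>injectivity_ball M z.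
        v \<noteq> w \<longrightarrow> holder_quotient M \<gamma> f z v w \<le> ennreal K)}"


section \<open>The statistical model\<close>

definition manifold_class :: "nat \<Rightarrow> 'a::euclidean_space \<Rightarrow> real \<Rightarrow> 'a set set" where
  "manifold_class d x \<tau> =
     {M. compact M \<and> smooth_submanifold d M \<and> x \<in> M \<and> ennreal \<tau> \<le> reach M}"

definition holder_manifold_class ::
  "nat \<Rightarrow> 'a::euclidean_space \<Rightarrow> real \<Rightarrow> real \<Rightarrow> real \<Rightarrow> 'a set set" where
  "holder_manifold_class d x \<alpha> \<tau> L =
     {M \<in> manifold_class d x \<tau>.
        (\<lambda>y::'a. y) \<in> holder_class M (\<alpha> + 1) \<and> holder_norm M (\<alpha> + 1) (\<lambda>y::'a. y) \<le> ennreal L}"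

definition measure_support :: "'a::topological_space measure \<Rightarrow> 'a set" where
  "measure_support P = {y. \<forall>U. open U \<and> y \<in> U \<longrightarrow> emeasure P U > 0}"

text \<open>The admissible versions \<open>f\<^sub>P\<close> of \<open>dP/d\<mu>\<^sub>M\<close>, \<open>M = supp P\<close>. A function on \<open>M\<close> is represented by a
  Borel function on the ambient space whose values off \<open>M\<close> are irrelevant. Two admissible versions
  agree on \<open>M\<close>, since both are continuous there.\<close>

definition model_densities ::
  "nat \<Rightarrow> real \<Rightarrow> real \<Rightarrow> real \<Rightarrow> real \<Rightarrow> 'a::euclidean_space measure \<Rightarrow> ('a \<Rightarrow> real) set" where
  "model_densities d \<beta> fmin fmax R P =
     {f. f \<in> borel_measurable borel \<and>
         P = density (volume_measure d (measure_support P)) (\<lambda>y. ennreal (f y)) \<and>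
         f \<in> holder_class (measure_support P) \<beta> \<and>
         (\<forall>y\<in>measure_support P. fmin \<le> f y \<and> f y \<le> fmax) \<and>
         holder_norm (measure_support P) \<beta> f \<le> ennreal R}"

definition model_class ::
  "nat \<Rightarrow> 'a::euclidean_space \<Rightarrow> real \<Rightarrow> real \<Rightarrow> real \<Rightarrow> real \<Rightarrow> real \<Rightarrow> real \<Rightarrow> real \<Rightarrow> 'a measure set" where
  "model_class d x \<alpha> \<beta> \<tau> L fmin fmax R =
     {P. sets P = sets borel \<and> prob_space P \<and>
         measure_support P \<in> holder_manifold_class d x \<alpha> \<tau> L \<and>
         model_densities d \<beta> fmin fmax R P \<noteq> {}}"

text \<open>\<open>E[|X|\<^sup>p]\<^sup>1\<^sup>/\<^sup>p\<close>, infinite when the moment is.\<close>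

definition Lp_size :: "real \<Rightarrow> 'b measure \<Rightarrow> ('b \<Rightarrow> real) \<Rightarrow> ennreal" where
  "Lp_size p N X =
     (if integrable N (\<lambda>\<omega>. \<bar>X \<omega>\<bar> powr p)
      then ennreal ((\<integral>\<omega>. \<bar>X \<omega>\<bar> powr p \<partial>N) powr (1 / p)) else \<infinity>)"

end

theory Submission
  imports Defs "HOL-Real_Asymp.Real_Asymp"
begin

text \<open>In dimension one only the lower bound on the reach matters. It makes every component of \<open>M\<close> a
  curve with curvature at most \<open>1/\<tau>\<close>, on which a chord of length \<open>s\<close> differs from the arc it spans
  by \<open>O(s\<^sup>3)\<close>, whatever \<open>\<alpha>\<close> is. Hence shortest paths through the sample with hops of length at most
  \<open>\<epsilon>\<close> measure the arc length from \<open>x\<close> up to a relative error \<open>O(\<epsilon>\<^sup>2)\<close>, as soon as the sample is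
  \<open>\<epsilon>/2\<close>-dense near \<open>x\<close>, which fails with exponentially small probability. The estimator is a kernel
  estimator in these path lengths. An even kernel does not see their missing sign; vanishing higher
  moments give the bias \<open>h\<^sup>\<beta>\<close> in the arc-length coordinate, which is the exponential chart. With
  \<open>h = n powr (- 1/(2\<beta>+1))\<close> and \<open>\<epsilon>\<^sup>2 = h powr (\<beta>+2)\<close> all errors are of order \<open>h\<^sup>\<beta>\<close>.\<close>

section \<open>Supporting balls from unique nearest points\<close>

text \<open>The reach is given only through unique nearest points, so curvature has to be extracted
  from metric data: along normals the distance to M grows at unit rate up to \<tau>, hence a ball of
  radius below \<tau> that touches M at z from a normal direction contains no point of M in its
  interior. The geometry rests on the resulting inequality (w - z) \<bullet> \<nu> \<le> |w - z|^2 /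
  (2\<tau>), valid for all w in M, not only near z. The exponential map is defined through geodesics
  on the whole line. It becomes computable once M carries a global unit-speed curve through each
  point and such curves are unique; uniform extension and uniqueness again use that inequality, in
  place of an ODE theorem. The exponent of \<epsilon> has this origin: a path-length error of order
  \<epsilon>^2 is \<epsilon>^2/h in the argument of the kernel; summing over all n observations, not
  just the nh or so near x, and dividing by nh gives \<epsilon>^2/h^2 = h^\<beta>. A dense sample at
  scale \<epsilon> requires n\<epsilon> to grow, that is \<beta>/2 + 1 < 2\<beta> + 1, true for
  every \<beta> > 0.\<close>

lemma dist_add_scaleR_sq:
  fixes a e z :: "'a::real_inner"
  shows "(dist (a + k *\<^sub>R e) z)\<^sup>2 = (dist a z)\<^sup>2 + 2 * k * (e \<bullet> (a - z)) + k\<^sup>2 * (e \<bullet> e)"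
  unfolding dist_norm power2_norm_eq_inner
  by (simp add: inner_simps power2_eq_square inner_commute algebra_simps)

locale unique_projection =
  fixes M :: "'a::euclidean_space set" and \<tau> :: real
  assumes compact_M: "compact M" and M_ne: "M \<noteq> {}" and tau_pos: "0 < \<tau>"
    and unique_nearest: "\<And>y. infdist y M < \<tau> \<Longrightarrow> \<exists>!z. z \<in> M \<and> infdist y M = dist y z"
begin

definition proj :: "'a \<Rightarrow> 'a" where
  "proj y = (THE z. z \<in> M \<and> infdist y M = dist y z)"

lemma proj_in: "infdist y M < \<tau> \<Longrightarrow> proj y \<in> M"
  and infdist_proj: "infdist y M < \<tau> \<Longrightarrow> infdist y M = dist y (proj y)"
  using theI'[OF unique_nearest] unfolding proj_def by blast+

lemma proj_eqI: "infdist y M < \<tau> \<Longrightarrow> z \<in> M \<Longrightarrow> infdist y M = dist y z \<Longrightarrow> proj y = z"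
  using unique_nearest proj_in infdist_proj by blast

text \<open>By compactness the points of M outside a ball about \<open>proj w\<close> are farther
  from w than \<open>infdist w M\<close> by a fixed margin \<eta>. The nearest point of a y close to
  w cannot afford that margin.\<close>

lemma isCont_proj:
  assumes w: "infdist w M < \<tau>"
  shows "isCont proj w"
  unfolding continuous_at_eps_delta
proof (intro allI impI)
  fix e :: real assume e: "e > 0"
  define K where "K = M - ball (proj w) e"
  have cK: "compact K" unfolding K_def using compact_M by (simp add: compact_diff)
  obtain \<eta> where \<eta>: "\<eta> > 0" and K: "\<And>z. z \<in> K \<Longrightarrow> dist w z \<ge> infdist w M + \<eta>"
  proof (cases "K = {}")
    case True
    then show ?thesis using that[of 1] by auto
  next
    case False
    obtain z0 where z0: "z0 \<in> K" "infdist w K = dist w z0"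
      using infdist_attains_inf[OF compact_imp_closed[OF cK] False] by blast
    have "infdist w M \<le> dist w z0" using z0 by (intro infdist_le) (auto simp: K_def)
    moreover have "infdist w M \<noteq> dist w z0"
      using proj_eqI[OF w, of z0] z0(1) e by (auto simp: K_def)
    ultimately have "dist w z0 - infdist w M > 0" by simp
    moreover have "dist w z \<ge> dist w z0" if "z \<in> K" for z
      using infdist_le[OF that, of w] z0(2) by simp
    ultimately show ?thesis using that[of "dist w z0 - infdist w M"] by force
  qed
  define d where "d = min (\<eta>/2) (\<tau> - infdist w M)"
  have "dist (proj y) (proj w) < e" if y: "dist y w < d" for y
  proof -
    have "infdist y M \<le> infdist w M + dist y w" by (rule infdist_triangle)
    then have 1: "infdist y M < \<tau>" and 2: "infdist y M < infdist w M + \<eta>/2"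
      using y unfolding d_def by auto
    have "dist w (proj y) \<le> dist y w + dist y (proj y)" by (metis dist_commute dist_triangle)
    then have "dist w (proj y) < infdist w M + \<eta>"
      using 2 infdist_proj[OF 1] y unfolding d_def by auto
    then have "proj y \<notin> K" using K by force
    then show ?thesis using proj_in[OF 1] by (auto simp: K_def dist_commute)
  qed
  moreover have "d > 0" using \<eta> w by (auto simp: d_def)
  ultimately show "\<exists>d>0. \<forall>x'. dist x' w < d \<longrightarrow> dist (proj x') (proj w) < e" by blast
qed

text \<open>A one-sided estimate takes the place of the gradient. If z is the nearest point of w + t
  e, then w has distance at least \<open>infdist w M\<close> from z, and the quadratic expansion in
  t has linear coefficient 2 e \<bullet> (w - z), positive for small t by continuity of
  \<open>proj\<close>.\<close>

lemma infdist_increases: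
  assumes w: "infdist w M < \<tau>" and e: "e \<bullet> (w - proj w) > 0"
  shows "\<exists>t0>0. \<forall>t. 0 < t \<and> t < t0 \<longrightarrow> infdist w M < infdist (w + t *\<^sub>R e) M"
proof -
  have "((\<lambda>t. infdist (w + t *\<^sub>R e) M) \<longlongrightarrow> infdist (w + 0 *\<^sub>R e) M) (at_right 0)"
    by (intro tendsto_intros)
  then have 1: "\<forall>\<^sub>F t in at_right 0. infdist (w + t *\<^sub>R e) M < \<tau>"
    using w by (intro order_tendstoD(2)) auto
  have "((\<lambda>t. w + t *\<^sub>R e) \<longlongrightarrow> w + 0 *\<^sub>R e) (at_right 0)" by (intro tendsto_intros)
  then have "((\<lambda>t. proj (w + t *\<^sub>R e)) \<longlongrightarrow> proj w) (at_right 0)"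
    by (intro isCont_tendsto_compose[OF isCont_proj[OF w]]) simp
  then have "((\<lambda>t. e \<bullet> (w - proj (w + t *\<^sub>R e))) \<longlongrightarrow> e \<bullet> (w - proj w)) (at_right 0)"
    by (intro tendsto_intros)
  then have 2: "\<forall>\<^sub>F t in at_right 0. e \<bullet> (w - proj (w + t *\<^sub>R e)) > 0"
    using e by (rule order_tendstoD)
  have "\<forall>\<^sub>F t in at_right 0. infdist w M < infdist (w + t *\<^sub>R e) M"
    using 1 2 eventually_at_right_less[of "0::real"]
  proof eventually_elim
    case (elim t)
    define z where "z = proj (w + t *\<^sub>R e)"
    have "infdist w M \<le> dist w z" unfolding z_def using proj_in[OF elim(1)] by (rule infdist_le)
    then have "(infdist w M)\<^sup>2 \<le> (dist w z)\<^sup>2" by (intro power_mono infdist_nonneg)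
    also have "\<dots> < (dist (w + t *\<^sub>R e) z)\<^sup>2"
    proof -
      have "(dist (w + t *\<^sub>R e) z)\<^sup>2 = (dist w z)\<^sup>2 + 2 * t * (e \<bullet> (w - z)) + t\<^sup>2 * (e \<bullet> e)"
        by (rule dist_add_scaleR_sq)
      moreover have "2 * t * (e \<bullet> (w - z)) > 0" using elim unfolding z_def by simp
      moreover have "t\<^sup>2 * (e \<bullet> e) \<ge> 0" by simp
      ultimately show ?thesis by linarith
    qed
    also have "dist (w + t *\<^sub>R e) z = infdist (w + t *\<^sub>R e) M"
      unfolding z_def using infdist_proj[OF elim(1)] by simp
    finally show ?case by (rule power2_less_imp_less) (rule infdist_nonneg)
  qed
  then show ?thesis unfolding eventually_at_right_field by auto
qed

text \<open>Where the distance to \<open>M\<close> is below \<open>\<tau>\<close> its gradient is the unit vector pointing away from the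
  nearest point. So its maximiser over a small ball around \<open>y\<close> lies on the boundary, on the ray from
  \<open>z\<close> through \<open>y\<close>.\<close>

lemma infdist_extend_step:
  assumes y: "infdist y M = \<rho>" "0 < \<rho>" and z: "z \<in> M" "dist y z = \<rho>"
    and s: "0 \<le> s" "s \<le> \<rho>" "\<rho> + s < \<tau>"
  shows "infdist (y + (s / \<rho>) *\<^sub>R (y - z)) M = \<rho> + s"
proof (cases "s = 0")
  case True then show ?thesis using y by simp
next
  case False
  then have s0: "s > 0" using s by simp
  have "continuous_on (cball y s) (\<lambda>w. infdist w M)" by (intro continuous_intros)
  then obtain w where w: "w \<in> cball y s" and wmax: "\<And>w'. w' \<in> cball y s \<Longrightarrow> infdist w' M \<le> infdist w M"
    using continuous_attains_sup[of "cball y s" "\<lambda>w. infdist w M"] s0 by auto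
  have wy: "infdist y M \<le> infdist w M" using wmax[of y] s0 by simp
  have "infdist w M \<le> infdist y M + dist w y" by (rule infdist_triangle)
  then have wt: "infdist w M < \<tau>" using w s y by (simp add: dist_commute)
  define \<nu> where "\<nu> = w - proj w"
  have nw: "norm \<nu> = infdist w M" unfolding \<nu>_def using infdist_proj[OF wt] by (simp add: dist_norm)
  \<comment> \<open>At the maximiser w no direction e may both increase the distance to M and keep w
    + t e in the ball for small t > 0.\<close>
  have noe: False if e: "e \<bullet> \<nu> > 0" "e \<bullet> (w - y) < 0 \<or> dist y w < s" for e
  proof -
    obtain t0 where t0: "t0 > 0" and t: "\<And>t. 0 < t \<Longrightarrow> t < t0 \<Longrightarrow> infdist w M < infdist (w + t *\<^sub>R e) M"
      using infdist_increases[OF wt] e(1) unfolding \<nu>_def by blast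
    have "\<forall>\<^sub>F t in at_right (0::real). w + t *\<^sub>R e \<in> cball y s"
    proof (cases "dist y w < s")
      case True
      have "((\<lambda>t. dist y (w + t *\<^sub>R e)) \<longlongrightarrow> dist y (w + 0 *\<^sub>R e)) (at_right 0)" by (intro tendsto_intros)
      then have "\<forall>\<^sub>F t in at_right 0. dist y (w + t *\<^sub>R e) < s"
        using True by (intro order_tendstoD(2)) auto
      then show ?thesis by eventually_elim simp
    next
      case False
      have "((\<lambda>t. 2 * (e \<bullet> (w - y)) + t * (e \<bullet> e)) \<longlongrightarrow> 2 * (e \<bullet> (w - y)) + 0 * (e \<bullet> e)) (at_right 0)"
        by (intro tendsto_intros)
      then have "\<forall>\<^sub>F t in at_right 0. 2 * (e \<bullet> (w - y)) + t * (e \<bullet> e) < 0"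
        using e(2) False order_tendstoD(2)[of _ "2 * (e \<bullet> (w - y)) + 0 * (e \<bullet> e)" _ 0] by auto
      then show ?thesis using eventually_at_right_less[of "0::real"]
      proof eventually_elim
        case (elim t)
        have "(dist y (w + t *\<^sub>R e))\<^sup>2 = (dist y w)\<^sup>2 + t * (2 * (e \<bullet> (w - y)) + t * (e \<bullet> e))"
          unfolding dist_commute[of y] dist_add_scaleR_sq by (simp add: power2_eq_square algebra_simps)
        also have "\<dots> \<le> (dist y w)\<^sup>2" using elim by (simp add: mult_pos_neg less_imp_le)
        finally have "dist y (w + t *\<^sub>R e) \<le> dist y w" by (rule power2_le_imp_le) simp
        then show ?case using w by simp
      qed
    qed
    then obtain t1 where t1: "t1 > 0" "\<And>t. 0 < t \<Longrightarrow> t < t1 \<Longrightarrow> w + t *\<^sub>R e \<in> cball y s"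
      unfolding eventually_at_right_field by auto
    define t where "t = min t0 t1 / 2"
    have "0 < t" "t < t0" "t < t1" using t0 t1(1) by (auto simp: t_def)
    then show False using t[of t] wmax[OF t1(2)[of t]] by simp
  qed
  have n0: "\<nu> \<noteq> 0" using nw wy y by auto
  have dyw: "dist y w = s" using noe[of \<nu>] n0 w by force
  define d where "d = w - y"
  have nd: "norm d = s" using dyw by (simp add: d_def dist_norm norm_minus_commute)
  have d0: "d \<noteq> 0" using nd s0 by auto
  have "\<nu> \<bullet> d \<ge> norm \<nu> * norm d"
  proof (rule ccontr)
    assume lt: "\<not> ?thesis"
    \<comment> \<open>The difference of two vectors of equal length. If Cauchy-Schwarz is strict, it
      is positive on \<nu> and negative on d, so it points into the ball and increases the
      distance.\<close>
    define e where "e = norm d *\<^sub>R \<nu> - norm \<nu> *\<^sub>R d"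
    have "e \<bullet> \<nu> = norm \<nu> * (norm \<nu> * norm d - \<nu> \<bullet> d)"
      by (simp add: e_def inner_diff_left inner_commute[of d] algebra_simps)
        (simp add: power2_norm_eq_inner[symmetric] power2_eq_square)
    moreover have "e \<bullet> d = norm d * (\<nu> \<bullet> d - norm \<nu> * norm d)"
      by (simp add: e_def inner_simps algebra_simps)
        (simp add: power2_norm_eq_inner[symmetric] power2_eq_square)
    moreover have "norm \<nu> > 0" "norm d > 0" using n0 d0 by auto
    ultimately have "e \<bullet> \<nu> > 0" "e \<bullet> d < 0" using lt by (auto simp: mult_pos_neg)
    then show False using noe[of e] by (simp add: d_def)
  qed
  then have "\<nu> \<bullet> d = norm \<nu> * norm d" using norm_cauchy_schwarz[of \<nu> d] by simp
  then have par: "norm \<nu> *\<^sub>R d = norm d *\<^sub>R \<nu>" using norm_cauchy_schwarz_eq by blast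
  define \<rho>' where "\<rho>' = norm \<nu>"
  have r': "\<rho>' \<ge> \<rho>" using nw wy y by (simp add: \<rho>'_def)
  have "\<rho>' \<noteq> 0" using n0 by (simp add: \<rho>'_def)
  then have "d = (1 / \<rho>') *\<^sub>R (\<rho>' *\<^sub>R d)" by simp
  then have dn: "d = (s / \<rho>') *\<^sub>R \<nu>" using par nd by (simp add: \<rho>'_def)
  have ypw: "y - proj w = (1 - s / \<rho>') *\<^sub>R \<nu>"
    using dn by (simp add: d_def \<nu>_def scaleR_left_diff_distrib algebra_simps)
  then have "dist y (proj w) = \<bar>1 - s/\<rho>'\<bar> * \<rho>'" by (simp add: dist_norm \<rho>'_def)
  also have "\<dots> = \<rho>' - s" using r' s y by (simp add: abs_if field_simps)
  finally have dyp: "dist y (proj w) = \<rho>' - s" .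
  have "infdist w M \<le> infdist y M + dist w y" by (rule infdist_triangle)
  then have "\<rho>' \<le> \<rho> + s" using nw y dyw by (simp add: \<rho>'_def dist_commute)
  moreover have "\<rho> \<le> dist y (proj w)" using infdist_le[OF proj_in[OF wt], of y] y by simp
  ultimately have eq: "\<rho>' = \<rho> + s" using dyp by simp
  \<comment> \<open>The point y turns out to have distance \<rho> from \<open>proj w\<close>, so
    uniqueness at y identifies \<open>proj w\<close> with z.\<close>
  have yt: "infdist y M < \<tau>" using y s by simp
  have "proj y = proj w" using dyp eq y by (intro proj_eqI[OF yt proj_in[OF wt]]) simp
  moreover have "proj y = z" using z y by (intro proj_eqI[OF yt]) auto
  ultimately have "proj w = z" by simp
  then have "y - z = (\<rho> / \<rho>') *\<^sub>R \<nu>"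
    using ypw eq y s by (simp add: diff_divide_eq_iff)
  then have "(s / \<rho>) *\<^sub>R (y - z) = (s / \<rho>') *\<^sub>R \<nu>" using y by simp
  then have "y + (s / \<rho>) *\<^sub>R (y - z) = w" using dn by (simp add: d_def algebra_simps)
  then show ?thesis using eq nw by (simp add: \<rho>'_def)
qed

text \<open>\<open>infdist_extend_step\<close> at most doubles the distance, so every r below \<tau>
  is reached by induction on the number of doublings, z remaining a nearest point
  throughout.\<close>

lemma infdist_extend:
  assumes y: "infdist y M = \<rho>" "0 < \<rho>" and z: "z \<in> M" "dist y z = \<rho>"
    and r: "\<rho> \<le> r" "r < \<tau>"
  shows "infdist (z + (r / \<rho>) *\<^sub>R (y - z)) M = r"
proof -
  have nyz: "norm (y - z) = \<rho>" using z by (simp add: dist_norm)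
  have "\<forall>r. \<rho> \<le> r \<and> r \<le> 2 ^ k * \<rho> \<and> r < \<tau> \<longrightarrow> infdist (z + (r / \<rho>) *\<^sub>R (y - z)) M = r" for k :: nat
  proof (induction k)
    case 0
    then show ?case using y by auto
  next
    case (Suc k)
    show ?case
    proof (intro allI impI)
      fix r assume r: "\<rho> \<le> r \<and> r \<le> 2 ^ Suc k * \<rho> \<and> r < \<tau>"
      \<comment> \<open>The previous stop: half of r, but never before \<rho>, so that the last
        increment r - q is at most q.\<close>
      define q where "q = max \<rho> (r/2)"
      have q: "\<rho> \<le> q" "q \<le> 2^k * \<rho>" "q < \<tau>" "q > 0" "r \<le> 2 * q" "q \<le> r" using r y(2) by (auto simp: q_def)
      define y' where "y' = z + (q / \<rho>) *\<^sub>R (y - z)"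
      have "infdist y' M = q" unfolding y'_def using Suc q by blast
      moreover have "dist y' z = q" using q nyz y(2) by (simp add: y'_def dist_norm)
      ultimately have "infdist (y' + ((r - q) / q) *\<^sub>R (y' - z)) M = q + (r - q)"
        using q r z(1) by (intro infdist_extend_step) auto
      moreover have "y' + ((r - q) / q) *\<^sub>R (y' - z) = z + (r / \<rho>) *\<^sub>R (y - z)"
      proof -
        have "(q / \<rho>) + ((r - q) / q) * (q / \<rho>) = r / \<rho>" using q y(2) by (simp add: field_simps)
        then show ?thesis unfolding y'_def by (simp add: scaleR_add_left[symmetric] add.assoc)
      qed
      ultimately show "infdist (z + (r / \<rho>) *\<^sub>R (y - z)) M = r" by simp
    qed
  qed
  moreover obtain k :: nat where "r / \<rho> < 2 ^ k" using real_arch_pow[of 2 "r/\<rho>"] by auto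
  then have "r \<le> 2 ^ k * \<rho>" using y(2) by (simp add: field_simps)
  ultimately show ?thesis using r by blast
qed

text \<open>The open ball of radius r < \<tau> that touches M at z and is centred on the ray from z
  through y contains no point of M. Expanding |w - centre| \<ge> r gives the inequality with r for
  \<tau>, and r tends to \<tau>.\<close>

lemma proximal_normal_bound:
  assumes y: "infdist y M < \<tau>" and z: "z \<in> M" "dist y z = infdist y M" and w: "w \<in> M"
  shows "(w - z) \<bullet> (y - z) \<le> (dist w z)\<^sup>2 * dist y z / (2 * \<tau>)"
proof (cases "dist y z = 0")
  case True then show ?thesis by simp
next
  case False
  define \<rho> where "\<rho> = dist y z"
  have \<rho>: "\<rho> > 0" "\<rho> < \<tau>" using False y z zero_le_dist[of y z] unfolding \<rho>_def by linarith+
  have bound: "2 * r * ((w - z) \<bullet> (y - z)) \<le> \<rho> * (dist w z)\<^sup>2" if r: "\<rho> < r" "r < \<tau>" for r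
  proof -
    have "infdist (z + (r / \<rho>) *\<^sub>R (y - z)) M = r"
      using infdist_extend[of y \<rho> z r] \<rho> z r by (simp add: \<rho>_def)
    then have "r \<le> dist (z + (r / \<rho>) *\<^sub>R (y - z)) w" using infdist_le[OF w] by metis
    then have "r\<^sup>2 \<le> (dist (z + (r / \<rho>) *\<^sub>R (y - z)) w)\<^sup>2" using r \<rho> by (intro power_mono) auto
    also have "\<dots> = (dist w z)\<^sup>2 - 2 * (r / \<rho>) * ((w - z) \<bullet> (y - z)) + (r / \<rho>)\<^sup>2 * ((y - z) \<bullet> (y - z))"
      unfolding dist_add_scaleR_sq inner_commute[of "y - z" "z - w"]
      by (simp add: inner_diff_left dist_commute diff_divide_distrib algebra_simps)
    also have "(r / \<rho>)\<^sup>2 * ((y - z) \<bullet> (y - z)) = r\<^sup>2"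
      using \<rho> by (simp add: power2_norm_eq_inner[symmetric] \<rho>_def dist_norm field_simps)
    finally show ?thesis using \<rho> by (simp add: field_simps)
  qed
  have "2 * \<tau> * ((w - z) \<bullet> (y - z)) \<le> \<rho> * (dist w z)\<^sup>2"
  proof (rule tendsto_upperbound)
    show "((\<lambda>r. 2 * r * ((w - z) \<bullet> (y - z))) \<longlongrightarrow> 2 * \<tau> * ((w - z) \<bullet> (y - z))) (at_left \<tau>)"
      by (intro tendsto_intros)
    show "\<forall>\<^sub>F r in at_left \<tau>. 2 * r * ((w - z) \<bullet> (y - z)) \<le> \<rho> * (dist w z)\<^sup>2"
      unfolding eventually_at_left_field using bound \<rho> by blast
  qed simp
  then show ?thesis using tau_pos by (simp add: \<rho>_def field_simps)
qed

text \<open>For a \<nu> that is normal only to first order, z need not be a nearest point of y = z +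
  \<rho> \<nu>. But a nearest point \<zeta> of y lies within 2 \<rho> e of z, and
  \<open>proximal_normal_bound\<close> applies there. After division by \<rho> the discrepancy is of
  order e.\<close>

lemma normal_bound:
  assumes z: "z \<in> M" and \<nu>: "norm \<nu> = 1" and w: "w \<in> M"
    and normal: "\<And>e. e > 0 \<Longrightarrow> \<exists>d>0. \<forall>w\<in>M. dist w z < d \<longrightarrow> (w - z) \<bullet> \<nu> \<le> e * dist w z"
  shows "(w - z) \<bullet> \<nu> \<le> (dist w z)\<^sup>2 / (2 * \<tau>)"
proof -
  have "\<exists>\<zeta>. dist \<zeta> z \<le> e \<and> (w - \<zeta>) \<bullet> \<nu> \<le> (dist w \<zeta>)\<^sup>2 / (2 * \<tau>) + 2 * e * dist w \<zeta>"
    if e: "0 < e" for e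
  proof -
    obtain d where d: "d > 0" and dn: "\<And>w. w \<in> M \<Longrightarrow> dist w z < d \<Longrightarrow> (w - z) \<bullet> \<nu> \<le> e * dist w z"
      using normal[OF e] by blast
    \<comment> \<open>The three bounds keep \<zeta>, which is within 2 \<rho> of z, in the range
      where normality is known, keep y inside the tube, and make 2 \<rho> e at most e.\<close>
    define \<rho> where "\<rho> = Min {d/3, \<tau>/2, 1/2}"
    have \<rho>: "0 < \<rho>" "2 * \<rho> < d" "\<rho> < \<tau>" "2 * \<rho> \<le> 1" using d tau_pos by (auto simp: \<rho>_def min_def)
    define y where "y = z + \<rho> *\<^sub>R \<nu>"
    have yz: "dist y z = \<rho>" using \<rho> \<nu> by (simp add: y_def dist_norm)
    have yM: "infdist y M \<le> \<rho>" using infdist_le[OF z, of y] yz by simp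
    then have yt: "infdist y M < \<tau>" using \<rho> by simp
    define \<zeta> where "\<zeta> = proj y"
    have \<zeta>: "\<zeta> \<in> M" "dist y \<zeta> = infdist y M" using proj_in infdist_proj yt by (auto simp: \<zeta>_def)
    have "dist \<zeta> z \<le> dist \<zeta> y + dist y z" by (rule dist_triangle)
    then have "dist \<zeta> z < d" using \<zeta> yM yz \<rho> by (simp add: dist_commute)
    then have a: "(\<zeta> - z) \<bullet> \<nu> \<le> e * dist \<zeta> z" using dn \<zeta> by blast
    have "(dist y \<zeta>)\<^sup>2 \<le> \<rho>\<^sup>2" using \<zeta> yM by (metis power_mono zero_le_dist)
    moreover have "(dist y \<zeta>)\<^sup>2 = \<rho>\<^sup>2 * (\<nu> \<bullet> \<nu>) - 2 * \<rho> * ((\<zeta> - z) \<bullet> \<nu>) + (dist \<zeta> z)\<^sup>2"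
      unfolding y_def dist_add_scaleR_sq inner_commute[of \<nu> "z - \<zeta>"]
      by (simp add: inner_diff_left dist_commute algebra_simps)
    moreover have "\<nu> \<bullet> \<nu> = 1" using \<nu> by (simp add: norm_eq_1)
    ultimately have "(dist \<zeta> z)\<^sup>2 \<le> 2 * \<rho> * ((\<zeta> - z) \<bullet> \<nu>)" by simp
    also have "\<dots> \<le> 2 * \<rho> * (e * dist \<zeta> z)" using a \<rho> by (intro mult_left_mono) auto
    finally have "dist \<zeta> z * dist \<zeta> z \<le> (2 * \<rho> * e) * dist \<zeta> z" by (simp add: power2_eq_square)
    then have \<zeta>z: "dist \<zeta> z \<le> 2 * \<rho> * e"
      using \<rho> e by (cases "dist \<zeta> z = 0") auto
    have "\<rho> * ((w - \<zeta>) \<bullet> \<nu>) = (w - \<zeta>) \<bullet> (y - \<zeta>) + (w - \<zeta>) \<bullet> (\<zeta> - z)"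
      by (simp add: y_def inner_simps algebra_simps)
    also have "(w - \<zeta>) \<bullet> (y - \<zeta>) \<le> (dist w \<zeta>)\<^sup>2 * dist y \<zeta> / (2 * \<tau>)"
      using proximal_normal_bound[OF yt \<zeta>(1) \<zeta>(2) w] .
    also have "\<dots> \<le> (dist w \<zeta>)\<^sup>2 * \<rho> / (2 * \<tau>)"
      using \<zeta> yM tau_pos by (intro divide_right_mono mult_left_mono) auto
    also have "(w - \<zeta>) \<bullet> (\<zeta> - z) \<le> dist w \<zeta> * dist \<zeta> z"
      using norm_cauchy_schwarz[of "w - \<zeta>" "\<zeta> - z"] by (simp add: dist_norm)
    also have "\<dots> \<le> dist w \<zeta> * (2 * \<rho> * e)" using \<zeta>z by (intro mult_left_mono) auto
    finally have "\<rho> * ((w - \<zeta>) \<bullet> \<nu>) \<le> \<rho> * ((dist w \<zeta>)\<^sup>2 / (2 * \<tau>) + 2 * e * dist w \<zeta>)"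
      by (simp add: algebra_simps)
    then have "(w - \<zeta>) \<bullet> \<nu> \<le> (dist w \<zeta>)\<^sup>2 / (2 * \<tau>) + 2 * e * dist w \<zeta>"
      using \<rho> by simp
    moreover have "2 * \<rho> * e \<le> 1 * e" using \<rho> e by (intro mult_right_mono) auto
    ultimately show ?thesis using \<zeta>z by (intro exI[of _ \<zeta>]) simp
  qed
  then have "\<forall>n. \<exists>\<zeta>. dist \<zeta> z \<le> 1 / real (Suc n) \<and>
      (w - \<zeta>) \<bullet> \<nu> \<le> (dist w \<zeta>)\<^sup>2 / (2 * \<tau>) + 2 * (1 / real (Suc n)) * dist w \<zeta>"
    by (intro allI) (simp del: of_nat_Suc times_divide_eq_right)
  then obtain \<zeta> where \<zeta>: "\<And>n. dist (\<zeta> n) z \<le> 1 / real (Suc n)"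
     "\<And>n. (w - \<zeta> n) \<bullet> \<nu> \<le> (dist w (\<zeta> n))\<^sup>2 / (2 * \<tau>) + 2 * (1 / real (Suc n)) * dist w (\<zeta> n)" by metis
  have l0: "(\<lambda>n. 1 / real (Suc n)) \<longlonglongrightarrow> 0" using LIMSEQ_inverse_real_of_nat by (simp add: inverse_eq_divide)
  have "(\<lambda>n. dist (\<zeta> n) z) \<longlonglongrightarrow> 0"
    by (rule real_tendsto_sandwich[OF _ _ tendsto_const l0]) (use \<zeta>(1) in auto)
  then have lz: "\<zeta> \<longlonglongrightarrow> z" using tendsto_dist_iff by blast
  have l1: "(\<lambda>n. (w - \<zeta> n) \<bullet> \<nu>) \<longlonglongrightarrow> (w - z) \<bullet> \<nu>" by (intro tendsto_intros lz)
  have l2: "(\<lambda>n. (dist w (\<zeta> n))\<^sup>2 / (2 * \<tau>) + 2 * (1 / real (Suc n)) * dist w (\<zeta> n))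
      \<longlonglongrightarrow> (dist w z)\<^sup>2 / (2 * \<tau>) + 2 * 0 * dist w z"
    using tau_pos by (intro tendsto_intros lz l0) simp
  have "(w - z) \<bullet> \<nu> \<le> (dist w z)\<^sup>2 / (2 * \<tau>) + 2 * 0 * dist w z"
    by (rule LIMSEQ_le[OF l1 l2]) (use \<zeta>(2) in blast)
  then show ?thesis by simp
qed

end

text \<open>The supremum in \<open>reach\<close> need not be attained: admissible radii exceed every
  number below \<tau>, which is why the locale asks for uniqueness only at distance strictly less
  than \<tau>.\<close>

lemma unique_projectionI:
  fixes M :: "'a::euclidean_space set"
  assumes "compact M" "M \<noteq> {}" "0 < \<tau>" "ennreal \<tau> \<le> reach M"
  shows "unique_projection M \<tau>"
proof
  fix y assume y: "infdist y M < \<tau>"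
  have "ennreal (infdist y M) < ennreal \<tau>" using y by (simp add: ennreal_lessI assms(3))
  then have "ennreal (infdist y M) < reach M" using assms(4) by (rule order.strict_trans2)
  then obtain r where "ennreal (infdist y M) < ennreal r" "r \<ge> 0"
    "\<forall>y. infdist y M \<le> r \<longrightarrow> (\<exists>!z. z \<in> M \<and> infdist y M = dist y z)"
    unfolding reach_def less_Sup_iff by blast
  then show "\<exists>!z. z \<in> M \<and> infdist y M = dist y z"
    by (metis ennreal_less_iff infdist_nonneg less_imp_le)
qed (use assms in auto)

section \<open>Smooth curves and arc length\<close>

text \<open>On an open \<open>S\<close>; the derivative of order \<open>n\<close> need not be continuous.\<close>

primrec derivable :: "nat \<Rightarrow> real set \<Rightarrow> (real \<Rightarrow> 'b::real_normed_vector) \<Rightarrow> bool" where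
  "derivable 0 S f = True"
| "derivable (Suc n) S f = (\<exists>f'. (\<forall>t\<in>S. (f has_vector_derivative f' t) (at t)) \<and> derivable n S f')"

lemma derivable_SucI:
  "(\<And>t. t \<in> S \<Longrightarrow> (f has_vector_derivative f' t) (at t)) \<Longrightarrow> derivable n S f' \<Longrightarrow> derivable (Suc n) S f"
  by auto

lemma derivable_Suc_imp: "derivable (Suc n) S f \<Longrightarrow> derivable n S f"
  by (induction n arbitrary: f) (simp, metis derivable.simps(2))

lemma derivable_subset: "derivable n S f \<Longrightarrow> T \<subseteq> S \<Longrightarrow> derivable n T f"
  by (induction n arbitrary: f) (simp, metis derivable.simps(2) subsetD)

lemma derivable_cong:
  assumes "open S" "\<And>t. t \<in> S \<Longrightarrow> f t = g t" "derivable n S f"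
  shows "derivable n S g"
proof (cases n)
  case (Suc m)
  then obtain f' where f': "\<And>t. t \<in> S \<Longrightarrow> (f has_vector_derivative f' t) (at t)" "derivable m S f'"
    using assms(3) by auto
  have "(g has_vector_derivative f' t) (at t)" if "t \<in> S" for t
    using has_vector_derivative_transform_within_open[OF f'(1)[OF that] assms(1) that] assms(2) by simp
  then show ?thesis using f'(2) Suc by auto
qed simp

lemma derivable_derivative:
  assumes "open S" "derivable (Suc n) S f"
  shows "derivable n S (\<lambda>t. vector_derivative f (at t))"
    and "\<And>t. t \<in> S \<Longrightarrow> (f has_vector_derivative vector_derivative f (at t)) (at t)"
proof -
  obtain f' where f': "\<And>t. t \<in> S \<Longrightarrow> (f has_vector_derivative f' t) (at t)" "derivable n S f'"
    using assms by auto
  have eq: "vector_derivative f (at t) = f' t" if "t \<in> S" for t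
    using vector_derivative_at[OF f'(1)[OF that]] .
  show "derivable n S (\<lambda>t. vector_derivative f (at t))"
    by (rule derivable_cong[OF assms(1) _ f'(2)]) (simp add: eq)
  show "(f has_vector_derivative vector_derivative f (at t)) (at t)" if "t \<in> S" for t
    using f'(1)[OF that] eq[OF that] by simp
qed

text \<open>\<open>vector_derivative\<close> is one candidate derivative on all of S, so derivatives
  found on the neighbourhoods U need not be glued.\<close>

lemma derivable_local:
  assumes "\<And>t. t \<in> S \<Longrightarrow> \<exists>U. open U \<and> t \<in> U \<and> derivable n U f"
  shows "derivable n S f"
  using assms
proof (induction n arbitrary: f)
  case (Suc n)
  have 1: "(f has_vector_derivative vector_derivative f (at t)) (at t)" if t: "t \<in> S" for t
    using Suc.prems[OF t] derivable_derivative(2) by blast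
  have "derivable n S (\<lambda>t. vector_derivative f (at t))"
    by (rule Suc.IH) (use Suc.prems derivable_derivative(1) in blast)
  then show ?case using 1 by (intro derivable_SucI)
qed simp

lemma derivable_const: "derivable n S (\<lambda>t. a)"
proof (induction n arbitrary: a)
  case (Suc n)
  show ?case by (rule derivable_SucI[where f' = "\<lambda>t. 0"]) (auto simp: Suc)
qed simp

lemma derivable_add: "derivable n S f \<Longrightarrow> derivable n S g \<Longrightarrow> derivable n S (\<lambda>t. f t + g t)"
proof (induction n arbitrary: f g)
  case (Suc n)
  then obtain f' g' where f': "\<And>t. t \<in> S \<Longrightarrow> (f has_vector_derivative f' t) (at t)" "derivable n S f'"
    and g': "\<And>t. t \<in> S \<Longrightarrow> (g has_vector_derivative g' t) (at t)" "derivable n S g'"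
    unfolding derivable.simps by blast
  show ?case
    by (rule derivable_SucI[where f' = "\<lambda>t. f' t + g' t"])
      (auto intro!: has_vector_derivative_add f' g' Suc.IH)
qed simp

lemma (in bounded_bilinear) derivable_prod:
  "derivable n S f \<Longrightarrow> derivable n S g \<Longrightarrow> derivable n S (\<lambda>t. prod (f t) (g t))"
proof (induction n arbitrary: f g)
  case (Suc n)
  then obtain f' g' where f': "\<And>t. t \<in> S \<Longrightarrow> (f has_vector_derivative f' t) (at t)" "derivable n S f'"
    and g': "\<And>t. t \<in> S \<Longrightarrow> (g has_vector_derivative g' t) (at t)" "derivable n S g'"
    unfolding derivable.simps by blast
  show ?case
    by (rule derivable_SucI[where f' = "\<lambda>t. prod (f t) (g' t) + prod (f' t) (g t)"])
      (use Suc.prems[THEN derivable_Suc_imp] in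
        \<open>auto intro!: has_vector_derivative f' g' derivable_add Suc.IH\<close>)
qed simp

lemmas derivable_scaleR = bounded_bilinear.derivable_prod[OF bounded_bilinear_scaleR]
lemmas derivable_mult = bounded_bilinear.derivable_prod[OF bounded_bilinear_mult]
lemmas derivable_inner = bounded_bilinear.derivable_prod[OF bounded_bilinear_inner]

lemma derivable_affine:
  "derivable n S f \<Longrightarrow> (\<And>t. t \<in> T \<Longrightarrow> a + b * t \<in> S) \<Longrightarrow> derivable n T (\<lambda>t. f (a + b * t))"
proof (induction n arbitrary: f)
  case (Suc n)
  then obtain f' where f': "\<And>t. t \<in> S \<Longrightarrow> (f has_vector_derivative f' t) (at t)" "derivable n S f'" by auto
  show ?case
  proof (rule derivable_SucI[where f' = "\<lambda>t. b *\<^sub>R f' (a + b * t)"])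
    fix t assume t: "t \<in> T"
    have "((\<lambda>t. a + b * t) has_vector_derivative b) (at t)"
      by (auto intro!: derivative_eq_intros simp: has_real_derivative_iff_has_vector_derivative[symmetric])
    from vector_diff_chain_at[OF this] f'(1)[OF Suc.prems(2)[OF t]]
    show "((\<lambda>t. f (a + b * t)) has_vector_derivative b *\<^sub>R f' (a + b * t)) (at t)"
      by (auto simp: o_def)
  next
    show "derivable n T (\<lambda>t. b *\<^sub>R f' (a + b * t))"
      by (intro derivable_scaleR derivable_const Suc.IH f'(2) Suc.prems(2))
  qed
qed simp

definition smooth_curve :: "real set \<Rightarrow> (real \<Rightarrow> 'b::real_normed_vector) \<Rightarrow> bool" where
  "smooth_curve S f \<longleftrightarrow> (\<forall>n. derivable n S f)"

lemma smooth_curve_subset: "smooth_curve S f \<Longrightarrow> T \<subseteq> S \<Longrightarrow> smooth_curve T f"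
  by (auto simp: smooth_curve_def intro: derivable_subset)

lemma smooth_curve_cong: "open S \<Longrightarrow> (\<And>t. t \<in> S \<Longrightarrow> f t = g t) \<Longrightarrow> smooth_curve S f \<Longrightarrow> smooth_curve S g"
  unfolding smooth_curve_def using derivable_cong by blast

lemma smooth_curve_local:
  "(\<And>t. t \<in> S \<Longrightarrow> \<exists>U. open U \<and> t \<in> U \<and> smooth_curve U f) \<Longrightarrow> smooth_curve S f"
  unfolding smooth_curve_def by (intro allI derivable_local) blast

lemma smooth_curve_affine:
  "smooth_curve S f \<Longrightarrow> (\<And>t. t \<in> T \<Longrightarrow> a + b * t \<in> S) \<Longrightarrow> smooth_curve T (\<lambda>t. f (a + b * t))"
  unfolding smooth_curve_def by (intro allI derivable_affine) blast+

lemma smooth_curve_const: "smooth_curve S (\<lambda>t. a)"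
  by (simp add: smooth_curve_def derivable_const)

lemma smooth_curve_scaleR: "smooth_curve S f \<Longrightarrow> smooth_curve S g \<Longrightarrow> smooth_curve S (\<lambda>t. f t *\<^sub>R g t)"
  by (simp add: smooth_curve_def derivable_scaleR)

lemma smooth_curve_derivative:
  assumes "open S" "smooth_curve S f"
  shows "smooth_curve S (\<lambda>t. vector_derivative f (at t))"
    and "\<And>t. t \<in> S \<Longrightarrow> (f has_vector_derivative vector_derivative f (at t)) (at t)"
  using assms derivable_derivative unfolding smooth_curve_def by blast+

lemma smooth_curve_continuous_on: "open S \<Longrightarrow> smooth_curve S f \<Longrightarrow> continuous_on S f"
  by (meson smooth_curve_derivative(2) has_vector_derivative_continuous continuous_at_imp_continuous_on)

text \<open>A single function \<open>q\<close> stable under the rewriting \<open>q' = - \<langle>\<gamma>', \<gamma>''\<rangle> q\<^sup>3\<close> generates all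
  derivatives, both of \<open>1 / \<parallel>\<gamma>'\<parallel>\<close> and of functions composed with the inverse arc length.\<close>

lemma smooth_curve_inverse_norm:
  fixes g :: "real \<Rightarrow> 'b::real_inner"
  assumes S: "open S" and g: "smooth_curve S g" and nz: "\<And>t. t \<in> S \<Longrightarrow> g t \<noteq> 0"
  shows "smooth_curve S (\<lambda>t. inverse (norm (g t)))"
proof -
  define g' where "g' = (\<lambda>t. vector_derivative g (at t))"
  have g': "smooth_curve S g'" "\<And>t. t \<in> S \<Longrightarrow> (g has_vector_derivative g' t) (at t)"
    using smooth_curve_derivative[OF S g] by (auto simp: g'_def)
  define q where "q t = inverse (norm (g t))" for t
  have q': "(q has_vector_derivative (- (g t \<bullet> g' t)) * (q t * (q t * q t))) (at t)" if t: "t \<in> S" for t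
  proof -
    have "((\<lambda>t. g t \<bullet> g t) has_vector_derivative (g t \<bullet> g' t + g' t \<bullet> g t)) (at t)"
      by (rule bounded_bilinear.has_vector_derivative[OF bounded_bilinear_inner]) (rule g'(2)[OF t])+
    then have d: "((\<lambda>t. g t \<bullet> g t) has_real_derivative 2 * (g t \<bullet> g' t)) (at t)"
      by (simp add: has_real_derivative_iff_has_vector_derivative inner_commute)
    have pos: "g t \<bullet> g t > 0" "norm (g t) > 0" using nz[OF t] by auto
    have "((\<lambda>t. sqrt (g t \<bullet> g t)) has_real_derivative
        inverse (sqrt (g t \<bullet> g t)) / 2 * (2 * (g t \<bullet> g' t))) (at t)"
      by (rule DERIV_chain2[OF DERIV_real_sqrt[OF pos(1)] d])
    from DERIV_inverse'[OF this] have "((\<lambda>t. inverse (sqrt (g t \<bullet> g t))) has_real_derivative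
        (- (g t \<bullet> g' t)) * (q t * (q t * q t))) (at t)"
      using pos by (simp add: q_def norm_eq_sqrt_inner mult_ac)
    then show ?thesis
      by (simp add: q_def[abs_def] has_real_derivative_iff_has_vector_derivative norm_eq_sqrt_inner)
  qed
  have "derivable n S q" for n
  proof (induction n)
    case (Suc n)
    have "derivable n S (\<lambda>t. (- 1) *\<^sub>R (g t \<bullet> g' t))"
      using g g' by (intro derivable_scaleR derivable_inner derivable_const) (auto simp: smooth_curve_def)
    then have "derivable n S (\<lambda>t. - (g t \<bullet> g' t))" by simp
    then show ?case by (intro derivable_SucI[OF q'] derivable_mult Suc) auto
  qed simp
  then show ?thesis by (simp add: smooth_curve_def q_def[abs_def])
qed

text \<open>Along \<theta>' = q(\<theta>) the derivative of G(\<theta>) is (q G')(\<theta>), again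
  of the same shape; hence the induction with G arbitrary and q fixed.\<close>

lemma smooth_curve_compose_flow:
  fixes G :: "real \<Rightarrow> 'b::real_normed_vector"
  assumes S: "open S" and q: "smooth_curve S q" and G: "smooth_curve S G"
    and \<theta>: "\<And>s. s \<in> T \<Longrightarrow> \<theta> s \<in> S" "\<And>s. s \<in> T \<Longrightarrow> (\<theta> has_real_derivative q (\<theta> s)) (at s)"
  shows "smooth_curve T (\<lambda>s. G (\<theta> s))"
proof -
  have "derivable n T (\<lambda>s. G (\<theta> s))" for n
    using G
  proof (induction n arbitrary: G)
    case (Suc n)
    define G' where "G' = (\<lambda>t. vector_derivative G (at t))"
    have G': "smooth_curve S G'" "\<And>t. t \<in> S \<Longrightarrow> (G has_vector_derivative G' t) (at t)"
      using smooth_curve_derivative[OF S Suc.prems] by (auto simp: G'_def)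
    show ?case
    proof (rule derivable_SucI[where f' = "\<lambda>s. q (\<theta> s) *\<^sub>R G' (\<theta> s)"])
      show "((\<lambda>s. G (\<theta> s)) has_vector_derivative q (\<theta> s) *\<^sub>R G' (\<theta> s)) (at s)" if s: "s \<in> T" for s
        using vector_diff_chain_at[OF \<theta>(2)[OF s, unfolded has_real_derivative_iff_has_vector_derivative]
            G'(2)[OF \<theta>(1)[OF s]]] by (simp add: o_def)
      show "derivable n T (\<lambda>s. q (\<theta> s) *\<^sub>R G' (\<theta> s))"
        by (rule Suc.IH) (intro smooth_curve_scaleR q G'(1))
    qed
  qed simp
  then show ?thesis by (simp add: smooth_curve_def)
qed

text \<open>The inverse \<theta> of the arc length satisfies the autonomous equation \<theta>' =
  1/|\<gamma>'(\<theta>)| with smooth right-hand side, so smoothness comes from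
  \<open>smooth_curve_compose_flow\<close> and only the first derivative of an inverse function has
  to be computed.\<close>

lemma arc_length_reparametrization:
  fixes \<gamma> :: "real \<Rightarrow> 'b::euclidean_space"
  assumes e: "0 < \<epsilon>" and \<gamma>: "smooth_curve {-\<epsilon><..<\<epsilon>} \<gamma>"
    and nz: "\<And>t. t \<in> {-\<epsilon><..<\<epsilon>} \<Longrightarrow> vector_derivative \<gamma> (at t) \<noteq> 0"
  shows "\<exists>\<delta>>0. \<exists>\<theta>. \<theta> 0 = 0 \<and> (\<forall>s\<in>{-\<delta><..<\<delta>}. \<theta> s \<in> {-\<epsilon><..<\<epsilon>}) \<and>
    smooth_curve {-\<delta><..<\<delta>} (\<lambda>s. \<gamma> (\<theta> s)) \<and>
    (\<forall>s\<in>{-\<delta><..<\<delta>}. norm (vector_derivative (\<lambda>s. \<gamma> (\<theta> s)) (at s)) = 1)"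
proof -
  define S where "S = {-\<epsilon><..<\<epsilon>}"
  have S: "open S" by (simp add: S_def)
  define \<gamma>' where "\<gamma>' = (\<lambda>t. vector_derivative \<gamma> (at t))"
  have \<gamma>': "smooth_curve S \<gamma>'" "\<And>t. t \<in> S \<Longrightarrow> (\<gamma> has_vector_derivative \<gamma>' t) (at t)"
    using smooth_curve_derivative[OF S] \<gamma> by (auto simp: \<gamma>'_def S_def)
  have nz: "\<gamma>' t \<noteq> 0" if "t \<in> S" for t using nz that by (simp add: \<gamma>'_def S_def)
  define q where "q t = inverse (norm (\<gamma>' t))" for t
  have q: "smooth_curve S q"
    using smooth_curve_inverse_norm[OF S \<gamma>'(1) nz] by (simp add: q_def[abs_def])
  define r where "r = \<epsilon> / 2"
  have r: "0 < r" "{-r..r} \<subseteq> S" using e by (auto simp: r_def S_def)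
  have "continuous_on {-r..r} (\<lambda>t. norm (\<gamma>' t))"
    using continuous_on_subset[OF smooth_curve_continuous_on[OF S \<gamma>'(1)] r(2)] by (intro continuous_intros)
  then obtain l0 where l0: "\<And>t. t \<in> {-r..r} \<Longrightarrow> (l0 has_vector_derivative norm (\<gamma>' t)) (at t within {-r..r})"
    using antiderivative_continuous by blast
  define l where "l = (\<lambda>t. l0 t - l0 0)"
  have lder: "(l has_real_derivative norm (\<gamma>' t)) (at t)" if "t \<in> {-r<..<r}" for t
  proof -
    have "(l0 has_vector_derivative norm (\<gamma>' t)) (at t within {-r<..<r})"
      by (rule has_vector_derivative_within_subset[OF l0]) (use that in auto)
    then have "(l0 has_vector_derivative norm (\<gamma>' t)) (at t)" using that at_within_open[of t "{-r<..<r}"] by simp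
    then have "(l0 has_real_derivative norm (\<gamma>' t)) (at t)"
      by (simp add: has_real_derivative_iff_has_vector_derivative)
    from DERIV_diff[OF this DERIV_const] show ?thesis by (simp add: l_def)
  qed
  define b where "b = r / 2"
  have b: "0 < b" "b < r" using r by (auto simp: b_def)
  have lmono: "l s < l t" if "s \<in> {-b..b}" "t \<in> {-b..b}" "s < t" for s t
  proof (rule DERIV_pos_imp_increasing[OF \<open>s < t\<close>])
    fix x assume "s \<le> x" "x \<le> t"
    then have "x \<in> {-r<..<r}" using that b by auto
    moreover from this have "x \<in> S" using r(2) by auto
    ultimately show "\<exists>y. (l has_real_derivative y) (at x) \<and> 0 < y"
      using lder nz by (intro exI[of _ "norm (\<gamma>' x)"]) simp
  qed
  have linj: "inj_on l {-b..b}"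
    by (rule linorder_inj_onI) (use lmono in force)+
  define \<theta> where "\<theta> = the_inv_into {-b..b} l"
  have \<theta>l: "\<theta> (l t) = t" if "t \<in> {-b..b}" for t
    unfolding \<theta>_def using linj that by (rule the_inv_into_f_f)
  have lc: "isCont l t" if "t \<in> {-b..b}" for t
    using lder[of t] that b by (auto intro: DERIV_isCont)
  have l00: "l 0 = 0" by (simp add: l_def)
  \<comment> \<open>Values of modulus below both l b and - l (- b) are attained strictly between -b
    and b, so \<theta> has a two-sided derivative there.\<close>
  define \<delta> where "\<delta> = min (l b) (- l (-b))"
  have d0: "\<delta> > 0" using lmono[of 0 b] lmono[of "-b" 0] b l00 by (auto simp: \<delta>_def)
  have ex: "\<exists>t\<in>{-b<..<b}. l t = s" if s: "s \<in> {-\<delta><..<\<delta>}" for s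
  proof -
    have "\<exists>t. -b \<le> t \<and> t \<le> b \<and> l t = s"
      by (rule IVT) (use s b lc in \<open>auto simp: \<delta>_def\<close>)
    then obtain t where t: "-b \<le> t" "t \<le> b" "l t = s" by blast
    then have "t \<noteq> -b" "t \<noteq> b" using s by (auto simp: \<delta>_def)
    then show ?thesis using t by (intro bexI[of _ t]) auto
  qed
  have \<theta>in: "\<theta> s \<in> {-b<..<b}" and l\<theta>: "l (\<theta> s) = s" if s: "s \<in> {-\<delta><..<\<delta>}" for s
    using ex[OF s] \<theta>l by auto
  have \<theta>c: "isCont \<theta> s" if s: "s \<in> {-\<delta><..<\<delta>}" for s
  proof -
    have "isCont \<theta> (l (\<theta> s))"
      by (rule isCont_inverse_function2[where a="-b" and b=b]) (use \<theta>in[OF s] \<theta>l lc in auto)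
    then show ?thesis using l\<theta>[OF s] by simp
  qed
  have \<theta>S: "\<theta> s \<in> S" if "s \<in> {-\<delta><..<\<delta>}" for s using \<theta>in[OF that] b r(2) by (auto simp: S_def r_def b_def)
  have \<theta>d: "(\<theta> has_real_derivative q (\<theta> s)) (at s)" if s: "s \<in> {-\<delta><..<\<delta>}" for s
    unfolding q_def
  proof (rule DERIV_inverse_function[where f=l and a="-\<delta>" and b=\<delta>])
    show "(l has_real_derivative norm (\<gamma>' (\<theta> s))) (at (\<theta> s))"
      using lder \<theta>in[OF s] b by auto
    show "norm (\<gamma>' (\<theta> s)) \<noteq> 0" using nz \<theta>S[OF s] by simp
  qed (use s l\<theta> \<theta>c in auto)
  have cs: "smooth_curve {-\<delta><..<\<delta>} (\<lambda>s. \<gamma> (\<theta> s))"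
    by (rule smooth_curve_compose_flow[OF S q _ \<theta>S \<theta>d]) (use \<gamma> in \<open>auto simp: S_def\<close>)
  have "norm (vector_derivative (\<lambda>s. \<gamma> (\<theta> s)) (at s)) = 1" if s: "s \<in> {-\<delta><..<\<delta>}" for s
  proof -
    have "((\<lambda>s. \<gamma> (\<theta> s)) has_vector_derivative q (\<theta> s) *\<^sub>R \<gamma>' (\<theta> s)) (at s)"
      using vector_diff_chain_at[OF \<theta>d[OF s, unfolded has_real_derivative_iff_has_vector_derivative]
            \<gamma>'(2)[OF \<theta>S[OF s]]] by (simp add: o_def)
    from vector_derivative_at[OF this] show ?thesis using nz \<theta>S[OF s] by (simp add: q_def)
  qed
  moreover have "\<theta> 0 = 0" using \<theta>l[of 0] l00 b by auto
  ultimately show ?thesis using d0 cs \<theta>S unfolding S_def by blast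
qed

section \<open>Iterated differentials along a line\<close>

lemma iter_deriv_along_line:
  assumes d: "iter_deriv F hs differentiable_on U" and T: "open T" "t \<in> T"
    and U: "\<And>t. t \<in> T \<Longrightarrow> a + t *\<^sub>R h \<in> U"
  shows "((\<lambda>t. iter_deriv F hs (a + t *\<^sub>R h)) has_vector_derivative iter_deriv F (h # hs) (a + t *\<^sub>R h)) (at t)"
proof -
  \<comment> \<open>U is typically open only relative to a subspace, so differentiability is
    available merely within U. On the line, the open set T of parameters restores a two-sided
    derivative.\<close>
  have "(\<lambda>t. iter_deriv F hs (a + t *\<^sub>R h)) differentiable (at t within T)"
  proof -
    have "(iter_deriv F hs \<circ> (\<lambda>t. a + t *\<^sub>R h)) differentiable (at t within T)"
    proof (rule differentiable_chain_within)
      show "(\<lambda>t. a + t *\<^sub>R h) differentiable (at t within T)"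
        by (auto intro!: derivative_intros)
      have "iter_deriv F hs differentiable (at (a + t *\<^sub>R h) within U)"
        using d U T(2) by (auto simp: differentiable_on_def)
      then show "iter_deriv F hs differentiable (at (a + t *\<^sub>R h) within (\<lambda>t. a + t *\<^sub>R h) ` T)"
        by (rule differentiable_within_subset) (use U in auto)
    qed
    then show ?thesis by (simp add: o_def)
  qed
  then have "(\<lambda>t. iter_deriv F hs (a + t *\<^sub>R h)) differentiable (at t)"
    using at_within_open[OF T(2,1)] by simp
  then have hd: "((\<lambda>t. iter_deriv F hs (a + t *\<^sub>R h)) has_vector_derivative
      vector_derivative (\<lambda>t. iter_deriv F hs (a + t *\<^sub>R h)) (at t)) (at t)"
    using vector_derivative_works by blast
  have sh: "((\<lambda>s. t + s) has_vector_derivative 1) (at 0)" for t :: real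
    by (auto intro!: derivative_eq_intros simp: has_real_derivative_iff_has_vector_derivative[symmetric])
  have "((\<lambda>t. iter_deriv F hs (a + t *\<^sub>R h)) \<circ> (\<lambda>s. t + s) has_vector_derivative
      1 *\<^sub>R vector_derivative (\<lambda>t. iter_deriv F hs (a + t *\<^sub>R h)) (at t)) (at 0)"
    by (rule vector_diff_chain_at[OF sh]) (use hd in simp)
  then have "((\<lambda>s. iter_deriv F hs ((a + t *\<^sub>R h) + s *\<^sub>R h)) has_vector_derivative
      vector_derivative (\<lambda>t. iter_deriv F hs (a + t *\<^sub>R h)) (at t)) (at 0)"
    by (simp add: o_def scaleR_add_left add.assoc)
  from vector_derivative_at[OF this] hd show ?thesis by simp
qed

lemma smooth_on_imp_smooth_curve:
  assumes F: "smooth_on H U F" and T: "open T" and h: "h \<in> H"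
    and U: "\<And>t. t \<in> T \<Longrightarrow> a + t *\<^sub>R h \<in> U"
  shows "smooth_curve T (\<lambda>t. F (a + t *\<^sub>R h))"
proof -
  \<comment> \<open>The number m of directions already used must vary in the induction: the
    derivative of the m-fold directional derivative is the (m+1)-fold one.\<close>
  have *: "derivable n T (\<lambda>t. iter_deriv F (replicate m h) (a + t *\<^sub>R h))" for n m
  proof (induction n arbitrary: m)
    case (Suc n)
    have "set (replicate m h) \<subseteq> H \<and> length (replicate m h) < Suc m" using h by auto
    then have "iter_deriv F (replicate m h) differentiable_on U"
      using F unfolding smooth_on_def times_differentiable_on_def by blast
    then show ?case
      by (intro derivable_SucI[OF _ Suc[of "Suc m"]]) (auto simp del: iter_deriv.simps intro!: iter_deriv_along_line T U)
  qed simp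
  show ?thesis using *[of _ 0] by (simp add: smooth_curve_def)
qed

text \<open>E is known only on the line through u, but derivatives in directions of that line never
  leave it. The scalars of the list accumulate as factors, so only the existence of a smooth g is
  recorded.\<close>

lemma iter_deriv_of_curve:
  fixes u :: "'a::real_normed_vector"
  assumes S: "open S" and E: "\<And>s. s \<in> S \<Longrightarrow> E (s *\<^sub>R u) = c s" and c: "smooth_curve S c"
    and hs: "set hs \<subseteq> range (\<lambda>k. k *\<^sub>R u)"
  shows "\<exists>g. smooth_curve S g \<and> (\<forall>s\<in>S. iter_deriv E hs (s *\<^sub>R u) = g s)"
  using hs
proof (induction hs)
  case Nil
  then show ?case using E c by auto
next
  case (Cons h hs)
  then obtain g where g: "smooth_curve S g" "\<And>s. s \<in> S \<Longrightarrow> iter_deriv E hs (s *\<^sub>R u) = g s" by auto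
  obtain k where k: "h = k *\<^sub>R u" using Cons.prems by auto
  define g' where "g' = (\<lambda>t. vector_derivative g (at t))"
  have g': "smooth_curve S g'" "\<And>t. t \<in> S \<Longrightarrow> (g has_vector_derivative g' t) (at t)"
    using smooth_curve_derivative[OF S g(1)] by (auto simp: g'_def)
  have "iter_deriv E (h # hs) (s *\<^sub>R u) = k *\<^sub>R g' s" if s: "s \<in> S" for s
  proof -
    have sh: "((\<lambda>t. s + t * k) has_vector_derivative k) (at 0)"
      by (auto intro!: derivative_eq_intros simp: has_real_derivative_iff_has_vector_derivative[symmetric])
    have "(g \<circ> (\<lambda>t. s + t * k) has_vector_derivative k *\<^sub>R g' s) (at 0)"
      by (rule vector_diff_chain_at[OF sh]) (use g'(2)[OF s] in simp)
    then have 1: "((\<lambda>t. g (s + t * k)) has_vector_derivative k *\<^sub>R g' s) (at 0)" by (simp add: o_def)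
    have "open ((\<lambda>t. s + t * k) -` S)" by (rule open_vimage[OF S]) (intro continuous_intros)
    then have "((\<lambda>t. iter_deriv E hs (s *\<^sub>R u + t *\<^sub>R h)) has_vector_derivative k *\<^sub>R g' s) (at 0)"
      by (rule has_vector_derivative_transform_within_open[OF 1])
        (use s g(2) in \<open>auto simp: k scaleR_add_left[symmetric]\<close>)
    then show ?thesis by (simp add: vector_derivative_at)
  qed
  moreover have "smooth_curve S (\<lambda>s. k *\<^sub>R g' s)" by (intro smooth_curve_scaleR smooth_curve_const g')
  ultimately show ?case by blast
qed

lemma smooth_curve_imp_smooth_on:
  assumes S: "open S" and c: "smooth_curve S (c :: real \<Rightarrow> 'b::real_normed_vector)"
  shows "smooth_on UNIV S c"
  unfolding smooth_on_def times_differentiable_on_def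
proof (intro allI impI)
  fix hs :: "real list"
  obtain g where g: "smooth_curve S g" "\<And>s. s \<in> S \<Longrightarrow> iter_deriv c hs (s *\<^sub>R 1) = g s"
    using iter_deriv_of_curve[OF S _ c, of c 1 hs] by auto
  have "(iter_deriv c hs has_vector_derivative vector_derivative g (at s)) (at s)" if s: "s \<in> S" for s
    using has_vector_derivative_transform_within_open[OF smooth_curve_derivative(2)[OF S g(1) s] S s] g(2) by simp
  then show "iter_deriv c hs differentiable_on S"
    by (intro differentiable_at_imp_differentiable_on differentiableI_vector) blast
qed

lemma smooth_on_real_iff: "open S \<Longrightarrow> smooth_on UNIV S c \<longleftrightarrow> smooth_curve S c"
  using smooth_curve_imp_smooth_on[of S c] smooth_on_imp_smooth_curve[of UNIV S c S 1 0] by auto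

section \<open>Tangent lines of a curve of positive reach\<close>

lemma vector_derivative_lipschitz:
  fixes f :: "real \<Rightarrow> 'b::real_normed_vector"
  assumes "convex S" "\<And>t. t \<in> S \<Longrightarrow> (f has_vector_derivative f' t) (at t)"
    "\<And>t. t \<in> S \<Longrightarrow> norm (f' t) \<le> B" "s \<in> S" "t \<in> S"
  shows "norm (f s - f t) \<le> B * \<bar>s - t\<bar>"
proof -
  have B: "0 \<le> B" using assms(3)[OF assms(4)] norm_ge_zero[of "f' s"] by linarith
  have "norm (f s - f t) \<le> B * norm (s - t)"
  proof (rule differentiable_bound[OF assms(1)])
    show "(f has_derivative (\<lambda>x. x *\<^sub>R f' t)) (at t within S)" if "t \<in> S" for t
      using assms(2)[OF that] by (simp add: has_vector_derivative_def has_derivative_at_withinI)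
    show "onorm (\<lambda>x. x *\<^sub>R f' t) \<le> B" if "t \<in> S" for t
      by (rule onorm_bound[OF B]) (use assms(3)[OF that] in \<open>auto intro: mult_left_mono simp: mult.commute[of B]\<close>)
  qed (use assms in auto)
  then show ?thesis by simp
qed

text \<open>Otherwise the normalised component of x orthogonal to v would be a \<nu> contradicting
  the hypothesis.\<close>

lemma parallel_if_orthogonal:
  fixes v x :: "'a::real_inner"
  assumes "v \<noteq> 0" "\<And>\<nu>. norm \<nu> = 1 \<Longrightarrow> \<nu> \<bullet> v = 0 \<Longrightarrow> x \<bullet> \<nu> = 0"
  shows "x = ((x \<bullet> v) / (v \<bullet> v)) *\<^sub>R v"
proof (rule ccontr)
  define n where "n = x - ((x \<bullet> v) / (v \<bullet> v)) *\<^sub>R v"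
  assume "x \<noteq> ((x \<bullet> v) / (v \<bullet> v)) *\<^sub>R v"
  then have n: "n \<noteq> 0" by (simp add: n_def)
  have nv: "n \<bullet> v = 0" using assms(1) by (simp add: n_def inner_simps)
  have "x \<bullet> (n /\<^sub>R norm n) = 0" by (rule assms(2)) (use n nv in auto)
  then have "x \<bullet> n = 0" using n by simp
  moreover have "n \<bullet> n = x \<bullet> n - ((x \<bullet> v) / (v \<bullet> v)) * (n \<bullet> v)"
    by (simp add: n_def inner_diff_left inner_diff_right inner_commute)
  ultimately show False using n nv by simp
qed

lemma has_vector_derivative_inner:
  fixes c :: "real \<Rightarrow> 'a::real_inner"
  shows "(c has_vector_derivative c') (at t) \<Longrightarrow> ((\<lambda>s. (c s - a) \<bullet> \<nu>) has_real_derivative c' \<bullet> \<nu>) (at t)"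
  unfolding has_real_derivative_iff_has_vector_derivative
  using bounded_linear.has_vector_derivative[OF bounded_linear_inner_left
      has_vector_derivative_diff[OF _ has_vector_derivative_const]] by fastforce

locale closed_curve = unique_projection +
  assumes submanifold: "smooth_submanifold 1 M"
begin

text \<open>The last property, that the chart fills a neighbourhood of z in M, turns statements
  about one curve into statements about all nearby points of M. It comes from continuity of the
  straightening map \<phi>.\<close>

lemma chart:
  assumes z: "z \<in> M"
  obtains \<gamma> :: "real \<Rightarrow> 'a" and \<epsilon> where "0 < \<epsilon>" "smooth_curve {-\<epsilon><..<\<epsilon>} \<gamma>" "\<gamma> 0 = z"
    "\<And>t. t \<in> {-\<epsilon><..<\<epsilon>} \<Longrightarrow> \<gamma> t \<in> M" "\<And>t. t \<in> {-\<epsilon><..<\<epsilon>} \<Longrightarrow> vector_derivative \<gamma> (at t) \<noteq> 0"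
    "\<And>e. 0 < e \<Longrightarrow> \<exists>d>0. \<forall>w\<in>M. dist w z < d \<longrightarrow> (\<exists>t. \<bar>t\<bar> < e \<and> w = \<gamma> t)"
proof -
  obtain U V \<phi> \<psi> H where U: "open U" "z \<in> U" and V: "open V" and H: "subspace H" "dim H = 1"
    and hom: "homeomorphism U V \<phi> \<psi>" and sm: "smooth_on UNIV U \<phi>" "smooth_on UNIV V (\<psi> :: 'a \<Rightarrow> 'a)"
    and im: "\<phi> ` (U \<inter> M) = V \<inter> H"
    using bspec[OF submanifold[unfolded smooth_submanifold_def] z] by (elim exE conjE) (rule that)
  define a where "a = \<phi> z"
  have a: "a \<in> V" "a \<in> H" using im U z by (auto simp: a_def)
  obtain B where B: "B \<subseteq> H" "independent B" "H \<subseteq> span B" "card B = dim H" using basis_exists by blast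
  then obtain h where h: "B = {h}" using H by (metis card_1_singletonE)
  have h0: "h \<noteq> 0" using B(2) h by (auto simp: dependent_zero)
  have hH: "h \<in> H" using B h by auto
  have Hh: "\<exists>k. x = k *\<^sub>R h" if "x \<in> H" for x
    using B(3) that h span_singleton[of h] by auto
  obtain \<epsilon>' where e': "\<epsilon>' > 0" "ball a \<epsilon>' \<subseteq> V" using V a openE by blast
  define \<epsilon> where "\<epsilon> = \<epsilon>' / norm h"
  have e: "\<epsilon> > 0" using e' h0 by (simp add: \<epsilon>_def)
  have lineV: "a + t *\<^sub>R h \<in> V" if "t \<in> {-\<epsilon><..<\<epsilon>}" for t
  proof -
    have "\<bar>t\<bar> < \<epsilon>' / norm h" using that by (auto simp: \<epsilon>_def)
    then have "\<bar>t\<bar> * norm h < \<epsilon>'" using h0 by (simp add: pos_less_divide_eq)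
    then show ?thesis using e'(2) by (auto simp: dist_norm)
  qed
  define \<gamma> where "\<gamma> t = \<psi> (a + t *\<^sub>R h)" for t
  have cs: "smooth_curve {-\<epsilon><..<\<epsilon>} \<gamma>"
    unfolding \<gamma>_def[abs_def] by (rule smooth_on_imp_smooth_curve[OF sm(2)]) (auto intro: lineV)
  have \<psi>\<phi>: "\<psi> (\<phi> x) = x" if "x \<in> U" for x using hom that by (simp add: homeomorphism_def)
  have \<phi>\<psi>: "\<phi> (\<psi> x) = x" if "x \<in> V" for x using hom that by (simp add: homeomorphism_def)
  have \<gamma>M: "\<gamma> t \<in> M \<and> \<gamma> t \<in> U" if t: "t \<in> {-\<epsilon><..<\<epsilon>}" for t
  proof -
    have "a + t *\<^sub>R h \<in> V \<inter> H" using lineV[OF t] a hH H by (auto intro: subspace_add subspace_scale)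
    then obtain m where "m \<in> U \<inter> M" "a + t *\<^sub>R h = \<phi> m" using im by auto
    then show ?thesis using \<psi>\<phi> by (auto simp: \<gamma>_def)
  qed
  \<comment> \<open>\<open>\<phi> \<circ> \<gamma>\<close> is a straight line with velocity h
    \<noteq> 0, so by the chain rule the velocity of \<gamma> cannot vanish.\<close>
  have nz: "vector_derivative \<gamma> (at t) \<noteq> 0" if t: "t \<in> {-\<epsilon><..<\<epsilon>}" for t
  proof
    assume 0: "vector_derivative \<gamma> (at t) = 0"
    have "(\<gamma> has_vector_derivative 0) (at t)" using smooth_curve_derivative(2)[OF _ cs t] 0 by simp
    then have d\<gamma>: "(\<gamma> has_derivative (\<lambda>_. 0)) (at t)" by (simp add: has_vector_derivative_def)
    have "times_differentiable_on 1 UNIV U \<phi>" using sm(1) by (simp add: smooth_on_def)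
    then have "iter_deriv \<phi> [] differentiable_on U" by (simp add: times_differentiable_on_def)
    moreover have "iter_deriv \<phi> [] = \<phi>" by (rule ext) simp
    ultimately have "\<phi> differentiable (at (\<gamma> t))"
      using \<gamma>M[OF t] at_within_open[OF _ U(1)] by (metis differentiable_on_def)
    then obtain D where D: "(\<phi> has_derivative D) (at (\<gamma> t))" by (auto simp: differentiable_def)
    have "((\<phi> \<circ> \<gamma>) has_derivative (D \<circ> (\<lambda>_. 0))) (at t)" by (rule diff_chain_at[OF d\<gamma> D])
    moreover have "D 0 = 0" using D has_derivative_bounded_linear linear_simps(3) by blast
    ultimately have "((\<lambda>t. \<phi> (\<gamma> t)) has_vector_derivative 0) (at t)"
      by (simp add: has_vector_derivative_def o_def)
    then have "((\<lambda>t. a + t *\<^sub>R h) has_vector_derivative 0) (at t)"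
      by (rule has_vector_derivative_transform_within_open[OF _ open_greaterThanLessThan t])
        (use lineV \<phi>\<psi> in \<open>auto simp: \<gamma>_def\<close>)
    moreover have "((\<lambda>t. a + t *\<^sub>R h) has_vector_derivative h) (at t)"
    proof -
      have "((\<lambda>t. t) has_vector_derivative 1) (at t)"
        by (simp add: has_real_derivative_iff_has_vector_derivative[symmetric])
      from bounded_linear.has_vector_derivative[OF bounded_linear_scaleR_left this, of h]
      have "((\<lambda>t. t *\<^sub>R h) has_vector_derivative h) (at t)" by simp
      from has_vector_derivative_add[OF has_vector_derivative_const this] show ?thesis by simp
    qed
    ultimately show False using h0 vector_derivative_unique_at by blast
  qed
  have cov: "\<exists>d>0. \<forall>w\<in>M. dist w z < d \<longrightarrow> (\<exists>t. \<bar>t\<bar> < e \<and> w = \<gamma> t)" if e: "e > 0" for e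
  proof -
    have "continuous_on U \<phi>" using hom by (simp add: homeomorphism_def)
    then have "isCont \<phi> z" using U continuous_on_eq_continuous_at by blast
    then obtain d1 where d1: "d1 > 0" "\<And>w. dist w z < d1 \<Longrightarrow> dist (\<phi> w) a < e * norm h"
      using e h0 unfolding continuous_at_eps_delta a_def by (metis mult_pos_pos zero_less_norm_iff)
    obtain d2 where d2: "d2 > 0" "ball z d2 \<subseteq> U" using U openE by blast
    have "\<exists>t. \<bar>t\<bar> < e \<and> w = \<gamma> t" if w: "w \<in> M" "dist w z < min d1 d2" for w
    proof -
      have wU: "w \<in> U" using w d2 by (auto simp: dist_commute)
      then have "\<phi> w \<in> H" using im w by blast
      then obtain k where k: "\<phi> w - a = k *\<^sub>R h" using Hh a H subspace_diff by blast
      have "norm (\<phi> w - a) < e * norm h" using d1(2)[of w] w by (simp add: dist_norm)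
      then have "\<bar>k\<bar> < e" using h0 k by simp
      moreover have "\<phi> w = a + k *\<^sub>R h" using k by (simp add: algebra_simps)
      then have "w = \<gamma> k" using \<psi>\<phi>[OF wU] by (simp add: \<gamma>_def)
      ultimately show ?thesis by blast
    qed
    then show ?thesis using d1 d2 by (intro exI[of _ "min d1 d2"]) auto
  qed
  show thesis
    by (rule that[OF e cs _ _ nz cov]) (use \<gamma>M \<psi>\<phi> U in \<open>auto simp: \<gamma>_def a_def\<close>)
qed

definition unit_speed :: "real set \<Rightarrow> (real \<Rightarrow> 'a) \<Rightarrow> bool" where
  "unit_speed S c \<longleftrightarrow> smooth_curve S c \<and> (\<forall>t\<in>S. c t \<in> M \<and> norm (vector_derivative c (at t)) = 1)"

lemma arc_in: "unit_speed S c \<Longrightarrow> t \<in> S \<Longrightarrow> c t \<in> M"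
  and arc_norm: "unit_speed S c \<Longrightarrow> t \<in> S \<Longrightarrow> norm (vector_derivative c (at t)) = 1"
  by (auto simp: unit_speed_def)

lemma arc_derivative:
  "open S \<Longrightarrow> unit_speed S c \<Longrightarrow> t \<in> S \<Longrightarrow> (c has_vector_derivative vector_derivative c (at t)) (at t)"
  by (auto simp: unit_speed_def intro: smooth_curve_derivative(2))

lemma arc_isCont: "open S \<Longrightarrow> unit_speed S c \<Longrightarrow> t \<in> S \<Longrightarrow> isCont c t"
  using arc_derivative has_vector_derivative_continuous by blast

lemma arc_subset: "unit_speed S c \<Longrightarrow> T \<subseteq> S \<Longrightarrow> unit_speed T c"
  by (auto simp: unit_speed_def intro: smooth_curve_subset)

lemma arc_cong:
  assumes S: "open S" "\<And>t. t \<in> S \<Longrightarrow> f t = g t" and f: "unit_speed S f"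
  shows "unit_speed S g"
proof -
  have "vector_derivative g (at t) = vector_derivative f (at t)" if t: "t \<in> S" for t
    using has_vector_derivative_transform_within_open[OF arc_derivative[OF S(1) f t] S(1) t S(2)]
    by (rule vector_derivative_at)
  then show ?thesis using f S smooth_curve_cong[OF S] by (auto simp: unit_speed_def)
qed

lemma arc_local: "(\<And>t. t \<in> S \<Longrightarrow> \<exists>U. open U \<and> t \<in> U \<and> unit_speed U f) \<Longrightarrow> unit_speed S f"
  unfolding unit_speed_def by (meson smooth_curve_local)

lemma arc_affine:
  assumes S: "open S" and c: "unit_speed S c" and T: "\<And>t. t \<in> T \<Longrightarrow> a + b * t \<in> S" and b: "\<bar>b\<bar> = 1"
  shows "unit_speed T (\<lambda>t. c (a + b * t))"
    and "\<And>t. t \<in> T \<Longrightarrow> vector_derivative (\<lambda>t. c (a + b * t)) (at t) = b *\<^sub>R vector_derivative c (at (a + b * t))"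
proof -
  have "((\<lambda>t. c (a + b * t)) has_vector_derivative b *\<^sub>R vector_derivative c (at (a + b * t))) (at t)"
    if t: "t \<in> T" for t
  proof -
    have "((\<lambda>t. a + b * t) has_vector_derivative b) (at t)"
      by (auto intro!: derivative_eq_intros simp: has_real_derivative_iff_has_vector_derivative[symmetric])
    from vector_diff_chain_at[OF this arc_derivative[OF S c T[OF t]]] show ?thesis by (simp add: o_def)
  qed
  from vector_derivative_at[OF this]
  show *: "\<And>t. t \<in> T \<Longrightarrow> vector_derivative (\<lambda>t. c (a + b * t)) (at t) = b *\<^sub>R vector_derivative c (at (a + b * t))" .
  show "unit_speed T (\<lambda>t. c (a + b * t))"
    unfolding unit_speed_def using c T smooth_curve_affine[of S c T a b] b by (auto simp: unit_speed_def *)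
qed

text \<open>In the chart w - z = t v + o(t), so the component of w - z along a \<nu> orthogonal to v
  is o(|w - z|). This is the hypothesis of \<open>normal_bound\<close>, whose conclusion then covers
  every w in M.\<close>

lemma tangent_line:
  assumes z: "z \<in> M"
  obtains v where "v \<noteq> 0"
    "\<And>w \<nu>. w \<in> M \<Longrightarrow> norm \<nu> = 1 \<Longrightarrow> \<nu> \<bullet> v = 0 \<Longrightarrow> (w - z) \<bullet> \<nu> \<le> (dist w z)\<^sup>2 / (2 * \<tau>)"
proof -
  obtain \<gamma> \<epsilon> where \<gamma>: "0 < \<epsilon>" "smooth_curve {-\<epsilon><..<\<epsilon>} \<gamma>" "\<gamma> 0 = z"
    and "\<And>t. t \<in> {-\<epsilon><..<\<epsilon>} \<Longrightarrow> \<gamma> t \<in> M"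
    and nz: "\<And>t. t \<in> {-\<epsilon><..<\<epsilon>} \<Longrightarrow> vector_derivative \<gamma> (at t) \<noteq> 0"
    and cov: "\<And>e. 0 < e \<Longrightarrow> \<exists>d>0. \<forall>w\<in>M. dist w z < d \<longrightarrow> (\<exists>t. \<bar>t\<bar> < e \<and> w = \<gamma> t)"
    by (rule chart[OF z]) (rule that)
  define v where "v = vector_derivative \<gamma> (at 0)"
  have v: "v \<noteq> 0" using nz[of 0] \<gamma>(1) by (simp add: v_def)
  have dv: "(\<gamma> has_vector_derivative v) (at 0)"
    unfolding v_def by (rule smooth_curve_derivative(2)[OF _ \<gamma>(2)]) (use \<gamma>(1) in auto)
  have "(w - z) \<bullet> \<nu> \<le> (dist w z)\<^sup>2 / (2 * \<tau>)" if w: "w \<in> M" and \<nu>: "norm \<nu> = 1" "\<nu> \<bullet> v = 0" for w \<nu>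
  proof (rule normal_bound[OF z \<nu>(1) w])
    fix e :: real assume e: "e > 0"
    \<comment> \<open>The first bound gives |t| |v| / 2 \<le> |w - z|; with the second one the
      remainder \<eta> |t| is then at most e |w - z|.\<close>
    define \<eta> where "\<eta> = min (norm v / 2) (e * norm v / 2)"
    have \<eta>: "\<eta> > 0" "\<eta> \<le> norm v / 2" "\<eta> \<le> e * norm v / 2" using e v by (auto simp: \<eta>_def)
    obtain e0 where e0: "e0 > 0" "\<And>t. \<bar>t\<bar> < e0 \<Longrightarrow> norm (\<gamma> t - z - t *\<^sub>R v) \<le> \<eta> * \<bar>t\<bar>"
      using dv \<eta>(1) unfolding has_vector_derivative_def has_derivative_at_alt
      by (metis \<gamma>(3) diff_zero real_norm_def)
    obtain d where d: "d > 0" "\<And>w. w \<in> M \<Longrightarrow> dist w z < d \<Longrightarrow> \<exists>t. \<bar>t\<bar> < e0 \<and> w = \<gamma> t"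
      using cov[OF e0(1)] by blast
    have "(w - z) \<bullet> \<nu> \<le> e * dist w z" if w: "w \<in> M" "dist w z < d" for w
    proof -
      obtain t where t: "\<bar>t\<bar> < e0" "w = \<gamma> t" using d w by blast
      define x where "x = w - z - t *\<^sub>R v"
      have x: "norm x \<le> \<eta> * \<bar>t\<bar>" using e0(2)[OF t(1)] t(2) by (simp add: x_def)
      have "norm (t *\<^sub>R v) \<le> norm (w - z) + norm x"
        using norm_triangle_ineq4[of "w - z" x] by (simp add: x_def)
      then have "\<bar>t\<bar> * norm v \<le> dist w z + \<bar>t\<bar> * (norm v / 2)"
        using x mult_right_mono[OF \<eta>(2) abs_ge_zero[of t]] by (simp add: dist_norm mult_ac)
      then have lo: "\<bar>t\<bar> * norm v / 2 \<le> dist w z" by simp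
      have "(w - z) \<bullet> \<nu> = x \<bullet> \<nu>" using \<nu>(2) by (simp add: x_def inner_diff_left inner_commute[of v])
      also have "\<dots> \<le> norm x" using norm_cauchy_schwarz[of x \<nu>] \<nu> by simp
      also have "\<dots> \<le> (e * norm v / 2) * \<bar>t\<bar>" using x mult_right_mono[OF \<eta>(3) abs_ge_zero[of t]] by linarith
      also have "\<dots> \<le> e * dist w z" using mult_left_mono[OF lo, of e] e by (simp add: mult_ac)
      finally show ?thesis .
    qed
    then show "\<exists>d>0. \<forall>w\<in>M. dist w z < d \<longrightarrow> (w - z) \<bullet> \<nu> \<le> e * dist w z" using d(1) by blast
  qed
  then show thesis using that v by blast
qed

text \<open>By \<open>star\<close> the function (\<sigma>(s) - \<sigma>(t)) \<bullet> \<nu> -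
  |\<sigma>(s) - \<sigma>(t)|^2 / (2\<tau>) of s has a maximum at t, and its quadratic term has
  derivative 0 there.\<close>

lemma velocity_orthogonal:
  assumes \<nu>: "norm \<nu> = 1"
    and star: "\<And>w. w \<in> M \<Longrightarrow> (w - \<sigma> t) \<bullet> \<nu> \<le> (dist w (\<sigma> t))\<^sup>2 / (2 * \<tau>)"
    and \<sigma>: "(\<sigma> has_vector_derivative x) (at t)" "open S" "t \<in> S" "\<And>s. s \<in> S \<Longrightarrow> \<sigma> s \<in> M"
  shows "x \<bullet> \<nu> = 0"
proof -
  have d1: "((\<lambda>s. (\<sigma> s - \<sigma> t) \<bullet> \<nu>) has_real_derivative x \<bullet> \<nu>) (at t)"
    by (rule has_vector_derivative_inner[OF \<sigma>(1)])
  have d2: "((\<lambda>s. \<sigma> s - \<sigma> t) has_vector_derivative x) (at t)"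
    using has_vector_derivative_diff[OF \<sigma>(1) has_vector_derivative_const[of "\<sigma> t"]] by simp
  have "((\<lambda>s. (\<sigma> s - \<sigma> t) \<bullet> (\<sigma> s - \<sigma> t)) has_vector_derivative 0) (at t)"
    using bounded_bilinear.has_vector_derivative[OF bounded_bilinear_inner d2 d2] by simp
  then have "((\<lambda>s. (\<sigma> s - \<sigma> t) \<bullet> (\<sigma> s - \<sigma> t)) has_real_derivative 0) (at t)"
    by (simp add: has_real_derivative_iff_has_vector_derivative)
  from DERIV_diff[OF d1 DERIV_cdivide[OF this, of "2 * \<tau>"]]
  have d: "((\<lambda>s. (\<sigma> s - \<sigma> t) \<bullet> \<nu> - (\<sigma> s - \<sigma> t) \<bullet> (\<sigma> s - \<sigma> t) / (2 * \<tau>)) has_real_derivative x \<bullet> \<nu>) (at t)"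
    by simp
  obtain e where e: "e > 0" "ball t e \<subseteq> S" using \<sigma>(2,3) openE by blast
  show ?thesis
  proof (rule DERIV_local_max[OF d e(1)], intro allI impI)
    fix s assume "\<bar>t - s\<bar> < e"
    then have "s \<in> S" using e(2) by (auto simp: dist_real_def)
    from star[OF \<sigma>(4)[OF this]]
    show "(\<sigma> s - \<sigma> t) \<bullet> \<nu> - (\<sigma> s - \<sigma> t) \<bullet> (\<sigma> s - \<sigma> t) / (2 * \<tau>)
       \<le> (\<sigma> t - \<sigma> t) \<bullet> \<nu> - (\<sigma> t - \<sigma> t) \<bullet> (\<sigma> t - \<sigma> t) / (2 * \<tau>)"
      by (simp add: dist_norm power2_norm_eq_inner)
  qed
qed

text \<open>The direction v of \<open>tangent_line\<close> comes from an unspecified chart. The unit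
  velocity of c is orthogonal to every \<nu> normal to v, hence a nonzero multiple of v, and may
  replace it. The same argument then applies to any other velocity x at that point.\<close>

lemma velocity_parallel:
  assumes c: "open S" "unit_speed S c" "t \<in> S"
    and \<sigma>: "(\<sigma> has_vector_derivative x) (at r)" "open T" "r \<in> T" "\<And>s. s \<in> T \<Longrightarrow> \<sigma> s \<in> M" "\<sigma> r = c t"
  shows "x = (x \<bullet> vector_derivative c (at t)) *\<^sub>R vector_derivative c (at t)"
    and "norm \<nu> = 1 \<Longrightarrow> \<nu> \<bullet> vector_derivative c (at t) = 0 \<Longrightarrow> w \<in> M \<Longrightarrow>
      (w - c t) \<bullet> \<nu> \<le> (dist w (c t))\<^sup>2 / (2 * \<tau>)"
proof -
  define u where "u = vector_derivative c (at t)"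
  have u: "norm u = 1" using arc_norm c by (simp add: u_def)
  obtain v where v: "v \<noteq> 0"
    "\<And>w \<nu>. w \<in> M \<Longrightarrow> norm \<nu> = 1 \<Longrightarrow> \<nu> \<bullet> v = 0 \<Longrightarrow> (w - c t) \<bullet> \<nu> \<le> (dist w (c t))\<^sup>2 / (2 * \<tau>)"
    by (rule tangent_line[OF arc_in[OF c(2,3)]]) (rule that)
  have uv: "u = ((u \<bullet> v) / (v \<bullet> v)) *\<^sub>R v"
  proof (rule parallel_if_orthogonal[OF v(1)])
    show "u \<bullet> \<nu> = 0" if "norm \<nu> = 1" "\<nu> \<bullet> v = 0" for \<nu>
      by (rule velocity_orthogonal[OF that(1) _ _ c(1,3)])
        (use v(2) that arc_derivative[OF c] arc_in[OF c(2)] in \<open>auto simp: u_def\<close>)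
  qed
  have k: "(u \<bullet> v) / (v \<bullet> v) \<noteq> 0" using uv u by force
  have star: "(w - c t) \<bullet> \<nu> \<le> (dist w (c t))\<^sup>2 / (2 * \<tau>)" if "norm \<nu> = 1" "\<nu> \<bullet> u = 0" "w \<in> M" for \<nu> w
  proof -
    have "((u \<bullet> v) / (v \<bullet> v)) * (\<nu> \<bullet> v) = \<nu> \<bullet> u" by (subst (2) uv) (simp add: inner_commute)
    then have "\<nu> \<bullet> v = 0" using that(2) k by simp
    then show ?thesis using v(2) that by blast
  qed
  then show "norm \<nu> = 1 \<Longrightarrow> \<nu> \<bullet> vector_derivative c (at t) = 0 \<Longrightarrow> w \<in> M \<Longrightarrow>
      (w - c t) \<bullet> \<nu> \<le> (dist w (c t))\<^sup>2 / (2 * \<tau>)" by (simp add: u_def)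
  have "x = ((x \<bullet> u) / (u \<bullet> u)) *\<^sub>R u"
  proof (rule parallel_if_orthogonal)
    show "u \<noteq> 0" using u by auto
    show "x \<bullet> \<nu> = 0" if "norm \<nu> = 1" "\<nu> \<bullet> u = 0" for \<nu>
      by (rule velocity_orthogonal[OF that(1) _ \<sigma>(1-4)]) (use star that \<sigma>(5) in auto)
  qed
  moreover have "u \<bullet> u = 1" using u by (simp add: norm_eq_1)
  ultimately show "x = (x \<bullet> vector_derivative c (at t)) *\<^sub>R vector_derivative c (at t)"
    by (simp add: u_def)
qed

lemma arc_normal:
  assumes "open S" "unit_speed S c" "t \<in> S"
    and "norm \<nu> = 1" "\<nu> \<bullet> vector_derivative c (at t) = 0" "w \<in> M"
  shows "(w - c t) \<bullet> \<nu> \<le> (dist w (c t))\<^sup>2 / (2 * \<tau>)"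
  by (rule velocity_parallel(2)[OF assms(1-3) arc_derivative[OF assms(1-3)] assms(1,3)
        arc_in[OF assms(2)] refl assms(4-6)])

text \<open>|c'| = 1 makes c'' normal. If |c''| exceeded 1/\<tau>, then in direction c''/|c''| the
  curve would rise above the parabola (s - t)^2/(2\<tau>), which bounds it by
  \<open>arc_normal\<close> and |c(s) - c(t)| \<le> |s - t|.\<close>

lemma arc_second_derivative:
  assumes S: "open S" and c: "unit_speed S c" and t: "t \<in> S"
  shows "norm (vector_derivative (\<lambda>s. vector_derivative c (at s)) (at t)) \<le> 1 / \<tau>"
    and "vector_derivative (\<lambda>s. vector_derivative c (at s)) (at t) \<bullet> vector_derivative c (at t) = 0"
    and "((\<lambda>s. vector_derivative c (at s)) has_vector_derivative
      vector_derivative (\<lambda>s. vector_derivative c (at s)) (at t)) (at t)"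
proof -
  define c' where "c' = (\<lambda>s. vector_derivative c (at s))"
  define c'' where "c'' = vector_derivative c' (at t)"
  have cs': "smooth_curve S c'"
    unfolding c'_def using c by (intro smooth_curve_derivative(1)[OF S]) (simp add: unit_speed_def)
  have d: "(c has_vector_derivative c' s) (at s)" if "s \<in> S" for s
    using arc_derivative[OF S c that] by (simp add: c'_def)
  have d': "(c' has_vector_derivative c'') (at t)"
    using smooth_curve_derivative(2)[OF S cs' t] by (simp add: c''_def)
  then show "((\<lambda>s. vector_derivative c (at s)) has_vector_derivative
      vector_derivative (\<lambda>s. vector_derivative c (at s)) (at t)) (at t)"
    by (simp add: c'_def c''_def)
  have n1: "norm (c' s) = 1" if "s \<in> S" for s using arc_norm[OF c that] by (simp add: c'_def)
  have "((\<lambda>s. c' s \<bullet> c' s) has_vector_derivative (c' t \<bullet> c'' + c'' \<bullet> c' t)) (at t)"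
    by (rule bounded_bilinear.has_vector_derivative[OF bounded_bilinear_inner d' d'])
  moreover have "((\<lambda>s. c' s \<bullet> c' s) has_vector_derivative 0) (at t)"
    by (rule has_vector_derivative_transform_within_open[OF has_vector_derivative_const[of 1] S t])
      (use n1 in \<open>simp add: norm_eq_1[symmetric]\<close>)
  ultimately have orth: "c'' \<bullet> c' t = 0"
    using vector_derivative_unique_at inner_commute[of c'' "c' t"] by fastforce
  then show "vector_derivative (\<lambda>s. vector_derivative c (at s)) (at t) \<bullet> vector_derivative c (at t) = 0"
    by (simp add: c'_def c''_def)
  have "norm c'' \<le> 1 / \<tau>"
  proof (rule ccontr)
    assume gt: "\<not> ?thesis"
    then have n0: "norm c'' > 1 / \<tau>" and nz: "c'' \<noteq> 0" using tau_pos by auto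
    define \<nu> where "\<nu> = c'' /\<^sub>R norm c''"
    have \<nu>: "norm \<nu> = 1" "\<nu> \<bullet> c' t = 0" "c'' \<bullet> \<nu> = norm c''"
      using nz orth by (auto simp: \<nu>_def) (simp add: power2_norm_eq_inner[symmetric] power2_eq_square)
    obtain e where e: "e > 0" "ball t e \<subseteq> S" using S t openE by blast
    define G where "G s = (c s - c t) \<bullet> \<nu> - (s - t)\<^sup>2 / (2 * \<tau>)" for s
    define G' where "G' s = (c' s - 0) \<bullet> \<nu> - (s - t) / \<tau>" for s
    have chi: "G s \<le> 0" if s: "\<bar>s - t\<bar> < e" for s
    proof -
      have sb: "s \<in> ball t e" using s by (auto simp: dist_real_def)
      have "norm (c s - c t) \<le> 1 * \<bar>s - t\<bar>"
        by (rule vector_derivative_lipschitz[OF convex_ball[of t e] d]) (use e sb n1 in auto)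
      then have "(dist (c s) (c t))\<^sup>2 \<le> (s - t)\<^sup>2"
        by (simp add: dist_norm abs_le_square_iff[symmetric])
      moreover have "(c s - c t) \<bullet> \<nu> \<le> (dist (c s) (c t))\<^sup>2 / (2 * \<tau>)"
        by (rule arc_normal[OF S c t \<nu>(1)]) (use \<nu>(2) arc_in[OF c] e sb in \<open>auto simp: c'_def\<close>)
      ultimately have "(c s - c t) \<bullet> \<nu> \<le> (s - t)\<^sup>2 / (2 * \<tau>)"
        using tau_pos by (smt (verit) divide_right_mono mult_pos_pos)
      then show ?thesis by (simp add: G_def)
    qed
    have dchi: "(G has_real_derivative G' s) (at s)" if "s \<in> S" for s
    proof -
      have "((\<lambda>s. (s - t)\<^sup>2 / (2 * \<tau>)) has_real_derivative (s - t) / \<tau>) (at s)"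
        using tau_pos by (auto intro!: derivative_eq_intros simp: field_simps)
      from DERIV_diff[OF has_vector_derivative_inner[OF d[OF that]] this]
      show ?thesis by (simp add: G_def[abs_def] G'_def)
    qed
    have "((\<lambda>s. (s - t) / \<tau>) has_real_derivative 1 / \<tau>) (at t)"
      using tau_pos by (auto intro!: derivative_eq_intros)
    from DERIV_diff[OF has_vector_derivative_inner[OF d', of 0 \<nu>] this]
    have dchi': "(G' has_real_derivative norm c'' - 1 / \<tau>) (at t)"
      using \<nu>(3) by (simp add: G'_def[abs_def])
    have "0 < norm c'' - 1 / \<tau>" using n0 by simp
    \<comment> \<open>G' vanishes at t and has a positive derivative there, so G increases just to
      the right of t, although it starts at 0 and must stay nonpositive.\<close>
    from DERIV_pos_inc_right[OF dchi' this]
    obtain \<eta> where \<eta>: "\<eta> > 0" "\<And>h. h > 0 \<Longrightarrow> h < \<eta> \<Longrightarrow> G' t < G' (t + h)"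
      by blast
    have chi't: "G' t = 0" using \<nu>(2) by (simp add: G'_def inner_commute)
    define h where "h = min \<eta> e / 2"
    have h: "0 < h" "h < \<eta>" "h < e" using \<eta> e by (auto simp: h_def)
    have "G t < G (t + h)"
    proof (rule DERIV_pos_imp_increasing_open[where f = G])
      show "t < t + h" using h by simp
    next
      fix x assume x: "t < x" "x < t + h"
      then have "x \<in> S" using e h by (auto simp: dist_real_def)
      moreover have "G' x > 0" using \<eta>(2)[of "x - t"] x h chi't by simp
      ultimately show "\<exists>y. (G has_real_derivative y) (at x) \<and> 0 < y" using dchi by blast
    next
      show "continuous_on {t..t + h} G"
      proof (intro continuous_at_imp_continuous_on ballI)
        fix x assume "x \<in> {t..t+h}"
        then have "x \<in> S" using e h by (auto simp: dist_real_def)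
        then show "isCont G x" using dchi DERIV_isCont by blast
      qed
    qed
    moreover have "G t = 0" by (simp add: G_def)
    ultimately show False using chi[of "t + h"] h by simp
  qed
  then show "norm (vector_derivative (\<lambda>s. vector_derivative c (at s)) (at t)) \<le> 1 / \<tau>"
    by (simp add: c'_def c''_def)
qed

lemma arc_lipschitz:
  assumes S: "open S" "convex S" and c: "unit_speed S c" and t: "s \<in> S" "t \<in> S"
  shows "dist (c s) (c t) \<le> \<bar>s - t\<bar>"
  using vector_derivative_lipschitz[OF S(2) arc_derivative[OF S(1) c], of 1 s t] arc_norm[OF c] t
  by (simp add: dist_norm)

text \<open>The chord is at least as long as its projection on c'(t), which grows at rate c'(r)
  \<bullet> c'(t) = 1 - |c'(r) - c'(t)|^2/2; and c' is Lipschitz with constant 1/\<tau>.\<close>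

lemma chord_lower:
  assumes S: "open S" "convex S" and c: "unit_speed S c" and t: "s \<in> S" "t \<in> S"
  shows "\<bar>s - t\<bar> * (1 - (s - t)\<^sup>2 / (2 * \<tau>\<^sup>2)) \<le> dist (c s) (c t)"
proof -
  have *: "(s - t) * (1 - (s - t)\<^sup>2 / (2 * \<tau>\<^sup>2)) \<le> dist (c s) (c t)" if st: "t < s" "s \<in> S" "t \<in> S" for s t
  proof -
    define c' where "c' = (\<lambda>s. vector_derivative c (at s))"
    have seg: "{t..s} \<subseteq> S" using S(2) st closed_segment_subset[of t S s] by (simp add: closed_segment_eq_real_ivl)
    define f where "f r = (c r - c t) \<bullet> c' t" for r
    have df: "(f has_real_derivative c' r \<bullet> c' t) (at r)" if "r \<in> S" for r
      unfolding f_def[abs_def] c'_def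
      by (rule has_vector_derivative_inner[OF arc_derivative[OF S(1) c that]])
    have low: "1 - (s - t)\<^sup>2 / (2 * \<tau>\<^sup>2) \<le> c' r \<bullet> c' t" if r: "t \<le> r" "r \<le> s" for r
    proof -
      have rS: "r \<in> S" using r seg by auto
      have "norm (c' r - c' t) \<le> (1 / \<tau>) * \<bar>r - t\<bar>"
        unfolding c'_def
        by (rule vector_derivative_lipschitz[OF S(2)
            arc_second_derivative(3)[OF S(1) c] arc_second_derivative(1)[OF S(1) c] rS st(3)])
      also have "\<dots> \<le> (1 / \<tau>) * (s - t)" using r tau_pos by (intro mult_left_mono) auto
      finally have "(norm (c' r - c' t))\<^sup>2 \<le> ((s - t) / \<tau>)\<^sup>2" by (intro power_mono) auto
      moreover have "norm (c' r) = 1" "norm (c' t) = 1" using arc_norm[OF c] rS st by (auto simp: c'_def)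
      then have "(norm (c' r - c' t))\<^sup>2 = 2 - 2 * (c' r \<bullet> c' t)"
        by (simp add: power2_norm_eq_inner inner_diff_left inner_diff_right inner_commute[of "c' t" "c' r"] norm_eq_1)
      moreover have "((s - t) / \<tau>)\<^sup>2 = 2 * ((s - t)\<^sup>2 / (2 * \<tau>\<^sup>2))" by (simp add: power_divide)
      ultimately show ?thesis by linarith
    qed
    have "\<And>r. t \<le> r \<Longrightarrow> r \<le> s \<Longrightarrow> (f has_real_derivative c' r \<bullet> c' t) (at r)"
      using df seg by (meson atLeastAtMost_iff subsetD)
    from MVT2[OF st(1) this] obtain z where z: "t < z" "z < s" "f s - f t = (s - t) * (c' z \<bullet> c' t)"
      by blast
    have "(s - t) * (1 - (s - t)\<^sup>2 / (2 * \<tau>\<^sup>2)) \<le> f s - f t"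
      unfolding z(3) using low[of z] z st by (intro mult_left_mono) auto
    also have "\<dots> = (c s - c t) \<bullet> c' t" by (simp add: f_def)
    also have "\<dots> \<le> norm (c s - c t)"
      using norm_cauchy_schwarz[of "c s - c t" "c' t"] arc_norm[OF c st(3)] by (simp add: c'_def)
    finally show ?thesis by (simp add: dist_norm)
  qed
  consider "t < s" | "s < t" | "s = t" by linarith
  then show ?thesis
  proof cases
    case 1
    then show ?thesis using *[of t s] t by simp
  next
    case 2
    then show ?thesis using *[of s t] t by (simp add: dist_commute power2_commute)
  qed simp
qed

lemma arc_le_twice_chord:
  assumes S: "open S" "convex S" and c: "unit_speed S c" and t: "s \<in> S" "t \<in> S" and le: "\<bar>s - t\<bar> \<le> \<tau>"
  shows "\<bar>s - t\<bar> \<le> 2 * dist (c s) (c t)"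
proof -
  have "(s - t)\<^sup>2 \<le> \<tau>\<^sup>2" using le tau_pos by (simp add: abs_le_square_iff[symmetric])
  then have "1 / 2 \<le> 1 - (s - t)\<^sup>2 / (2 * \<tau>\<^sup>2)" using tau_pos by (simp add: field_simps)
  then have "\<bar>s - t\<bar> * (1 / 2) \<le> \<bar>s - t\<bar> * (1 - (s - t)\<^sup>2 / (2 * \<tau>\<^sup>2))" by (intro mult_left_mono) auto
  then show ?thesis using chord_lower[OF S c t] by simp
qed

text \<open>A bootstrap: with D the chord, the crude bound |s - t| \<le> 2 D inserted into
  \<open>chord_lower\<close> gives |s - t| (1 - 2x) \<le> D for x = D^2/\<tau>^2. As x \<le> 1/4,
  the inverse of 1 - 2x is at most 1 + 4x.\<close>

lemma arc_le_chord:
  assumes S: "open S" "convex S" and c: "unit_speed S c" and t: "s \<in> S" "t \<in> S" and le: "\<bar>s - t\<bar> \<le> \<tau>"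
    and D: "dist (c s) (c t) \<le> \<tau> / 2"
  shows "\<bar>s - t\<bar> \<le> (1 + 4 * (dist (c s) (c t))\<^sup>2 / \<tau>\<^sup>2) * dist (c s) (c t)"
proof -
  define D where "D = dist (c s) (c t)"
  have D0: "0 \<le> D" "D \<le> \<tau> / 2" using D by (auto simp: D_def)
  have st: "\<bar>s - t\<bar> \<le> 2 * D" using arc_le_twice_chord[OF S c t le] by (simp add: D_def)
  then have "(s - t)\<^sup>2 \<le> (2 * D)\<^sup>2" using D0 abs_le_square_iff[of "s - t" "2 * D"] by simp
  then have 1: "1 - 2 * (D\<^sup>2 / \<tau>\<^sup>2) \<le> 1 - (s - t)\<^sup>2 / (2 * \<tau>\<^sup>2)" using tau_pos by (simp add: field_simps)
  define x where "x = D\<^sup>2 / \<tau>\<^sup>2"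
  have "D\<^sup>2 \<le> (\<tau> / 2)\<^sup>2" using D0 by (intro power_mono) auto
  then have x: "0 \<le> x" "x \<le> 1 / 4" using tau_pos by (auto simp: x_def power_divide field_simps)
  have "\<bar>s - t\<bar> * (1 - 2 * x) \<le> D"
    using chord_lower[OF S c t] mult_left_mono[OF 1 abs_ge_zero[of "s - t"]] by (simp add: D_def x_def)
  then have "\<bar>s - t\<bar> * (1 - 2 * x) * (1 + 4 * x) \<le> D * (1 + 4 * x)" using x by (intro mult_right_mono) auto
  moreover have "1 \<le> (1 - 2 * x) * (1 + 4 * x)"
  proof -
    have "(1 - 2 * x) * (1 + 4 * x) = 1 + 2 * x * (1 - 4 * x)" by (simp add: algebra_simps)
    moreover have "0 \<le> 2 * x * (1 - 4 * x)" using x by (intro mult_nonneg_nonneg) auto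
    ultimately show ?thesis by linarith
  qed
  then have "\<bar>s - t\<bar> * 1 \<le> \<bar>s - t\<bar> * ((1 - 2 * x) * (1 + 4 * x))" by (intro mult_left_mono) auto
  ultimately show ?thesis by (simp add: D_def x_def mult_ac)
qed

text \<open>The point of the arc nearest to \<open>w\<close> is an inner one, so \<open>w\<close> lies on the normal space there,
  where the tube forbids other points of \<open>M\<close>.\<close>

lemma arc_covers:
  assumes S: "open S" "convex S" and c: "unit_speed S c" and r: "0 < r" "r \<le> \<tau>" "{t0 - r..t0 + r} \<subseteq> S"
    and w: "w \<in> M" "dist w (c t0) < r / 4"
  obtains t where "\<bar>t - t0\<bar> < r" "w = c t"
proof -
  let ?I = "{t0 - r..t0 + r}"
  have "continuous_on ?I c"
    by (intro continuous_at_imp_continuous_on ballI arc_isCont[OF S(1) c]) (use r in auto)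
  then have "continuous_on ?I (\<lambda>t. dist w (c t))" by (intro continuous_intros)
  then obtain t where t: "t \<in> ?I" "\<And>s. s \<in> ?I \<Longrightarrow> dist w (c t) \<le> dist w (c s)"
    using continuous_attains_inf[of ?I "\<lambda>t. dist w (c t)"] r by (auto simp: less_imp_le)
  have tS: "t \<in> S" and t0S: "t0 \<in> S" using t r by auto
  have wt: "dist w (c t) < r / 4" using t(2)[of t0] r w by auto
  have "dist (c t) (c t0) \<le> dist w (c t) + dist w (c t0)" by (metis dist_commute dist_triangle)
  \<comment> \<open>The radius r/4 is chosen for this: a chord below r/2 forces |t - t0| < r, so the
    minimum is not taken at an endpoint.\<close>
  then have "dist (c t) (c t0) < r / 2" using wt w by linarith
  moreover have "\<bar>t - t0\<bar> \<le> 2 * dist (c t) (c t0)"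
    by (rule arc_le_twice_chord[OF S c tS t0S]) (use t r in auto)
  ultimately have inner: "\<bar>t - t0\<bar> < r" by linarith
  define u where "u = vector_derivative c (at t)"
  have "((\<lambda>s. (c s - w)) has_vector_derivative u) (at t)"
    using has_vector_derivative_diff[OF arc_derivative[OF S(1) c tS] has_vector_derivative_const[of w]]
    by (simp add: u_def)
  from bounded_bilinear.has_vector_derivative[OF bounded_bilinear_inner this this]
  have "((\<lambda>s. (c s - w) \<bullet> (c s - w)) has_real_derivative 2 * ((c t - w) \<bullet> u)) (at t)"
    by (simp add: has_real_derivative_iff_has_vector_derivative inner_commute)
  then have "2 * ((c t - w) \<bullet> u) = 0"
  proof (rule DERIV_local_min)
    show "0 < r - \<bar>t - t0\<bar>" using inner by simp
    show "\<forall>s. \<bar>t - s\<bar> < r - \<bar>t - t0\<bar> \<longrightarrow> (c t - w) \<bullet> (c t - w) \<le> (c s - w) \<bullet> (c s - w)"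
    proof (intro allI impI)
      fix s assume "\<bar>t - s\<bar> < r - \<bar>t - t0\<bar>"
      then have "s \<in> ?I" by (auto simp: abs_if split: if_splits)
      then have "(dist w (c t))\<^sup>2 \<le> (dist w (c s))\<^sup>2" using t(2) by (intro power_mono) auto
      then show "(c t - w) \<bullet> (c t - w) \<le> (c s - w) \<bullet> (c s - w)"
        by (simp add: dist_norm norm_minus_commute[of w] power2_norm_eq_inner)
    qed
  qed
  then have orth: "(w - c t) \<bullet> u = 0" by (simp add: inner_diff_left)
  have "w = c t"
  proof (rule ccontr)
    assume ne: "w \<noteq> c t"
    \<comment> \<open>In this direction all of w - c t counts, so \<open>arc_normal\<close> reads D
      \<le> D^2/(2\<tau>) for D = |w - c t|, impossible when 0 < D < r/4 \<le> \<tau>/4.\<close>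
    define \<nu> where "\<nu> = (w - c t) /\<^sub>R norm (w - c t)"
    have "(w - c t) \<bullet> \<nu> \<le> (dist w (c t))\<^sup>2 / (2 * \<tau>)"
      by (rule arc_normal[OF S(1) c tS]) (use ne orth w in \<open>auto simp: \<nu>_def u_def\<close>)
    moreover have "(w - c t) \<bullet> \<nu> = dist w (c t)"
      using ne by (simp add: \<nu>_def dist_norm) (simp add: power2_norm_eq_inner[symmetric] power2_eq_square)
    ultimately have "dist w (c t) * (2 * \<tau>) \<le> dist w (c t) * dist w (c t)"
      using tau_pos by (simp add: field_simps power2_eq_square)
    then have "2 * \<tau> \<le> dist w (c t)" using ne by simp
    then show False using wt r tau_pos by simp
  qed
  then show thesis using that inner by blast
qed

end

section \<open>Uniqueness and existence of unit-speed curves\<close>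

text \<open>Multiplication by exp(-K t) makes g nonincreasing to the right of t0, multiplication by
  exp(K t) nondecreasing to the left; both products are nonnegative and vanish at t0.\<close>

lemma gronwall_zero:
  fixes g g' :: "real \<Rightarrow> real"
  assumes d: "\<And>t. \<bar>t - t0\<bar> < d \<Longrightarrow> (g has_real_derivative g' t) (at t)"
    and b: "\<And>t. \<bar>t - t0\<bar> < d \<Longrightarrow> \<bar>g' t\<bar> \<le> K * g t"
    and g: "\<And>t. \<bar>t - t0\<bar> < d \<Longrightarrow> 0 \<le> g t" and g0: "g t0 = 0" and t: "\<bar>t - t0\<bar> < d"
  shows "g t = 0"
proof (cases "t0 \<le> t")
  case True
  have "g t * exp (- (K * t)) \<le> g t0 * exp (- (K * t0))"
  proof (rule DERIV_nonpos_imp_nonincreasing[OF True, of "\<lambda>t. g t * exp (- (K * t))"])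
    fix x assume "t0 \<le> x" "x \<le> t"
    then have x: "\<bar>x - t0\<bar> < d" using t by auto
    have "((\<lambda>t. g t * exp (- (K * t))) has_real_derivative (g' x - K * g x) * exp (- (K * x))) (at x)"
      by (auto intro!: derivative_eq_intros d[OF x] simp: algebra_simps)
    moreover have "(g' x - K * g x) * exp (- (K * x)) \<le> 0"
      using b[OF x] by (intro mult_nonpos_nonneg) auto
    ultimately show "\<exists>y. ((\<lambda>t. g t * exp (- (K * t))) has_real_derivative y) (at x) \<and> y \<le> 0" by blast
  qed
  then show ?thesis using g0 g[OF t] by (simp add: mult_le_0_iff)
next
  case False
  then have le: "t \<le> t0" by simp
  have "g t * exp (K * t) \<le> g t0 * exp (K * t0)"
  proof (rule DERIV_nonneg_imp_nondecreasing[OF le, of "\<lambda>t. g t * exp (K * t)"])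
    fix x assume "t \<le> x" "x \<le> t0"
    then have x: "\<bar>x - t0\<bar> < d" using t by auto
    have "((\<lambda>t. g t * exp (K * t)) has_real_derivative (g' x + K * g x) * exp (K * x)) (at x)"
      by (auto intro!: derivative_eq_intros d[OF x] simp: algebra_simps)
    moreover have "(g' x + K * g x) * exp (K * x) \<ge> 0"
      using b[OF x] by (intro mult_nonneg_nonneg) auto
    ultimately show "\<exists>y. ((\<lambda>t. g t * exp (K * t)) has_real_derivative y) (at x) \<and> 0 \<le> y" by blast
  qed
  then show ?thesis using g0 g[OF t] by (simp add: mult_le_0_iff)
qed

context closed_curve begin

text \<open>\<open>arc_normal\<close> for the normalised normal component n of e = w - c t gives |n|
  \<le> |e|^2/(2\<tau>). Pythagoras turns this into a lower bound for the tangential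
  component.\<close>

lemma tangential_part:
  assumes S: "open S" and c: "unit_speed S c" and t: "t \<in> S" and w: "w \<in> M"
  shows "(w - c t) \<bullet> (w - c t) - ((w - c t) \<bullet> (w - c t))\<^sup>2 / (4 * \<tau>\<^sup>2)
    \<le> ((w - c t) \<bullet> vector_derivative c (at t))\<^sup>2"
proof -
  define e where "e = w - c t"
  define u where "u = vector_derivative c (at t)"
  have u: "u \<bullet> u = 1" using arc_norm[OF c t] by (simp add: u_def norm_eq_1)
  define n where "n = e - (e \<bullet> u) *\<^sub>R u"
  have nu: "n \<bullet> u = 0" using u by (simp add: n_def inner_diff_left)
  have en: "e \<bullet> n = n \<bullet> n" using nu by (simp add: n_def inner_diff_left inner_diff_right inner_commute)
  have nn: "n \<bullet> n = e \<bullet> e - (e \<bullet> u)\<^sup>2"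
    using en by (simp add: n_def inner_diff_right power2_eq_square)
  have "norm n \<le> (e \<bullet> e) / (2 * \<tau>)"
  proof (cases "n = 0")
    case True then show ?thesis using tau_pos by simp
  next
    case False
    have "(w - c t) \<bullet> (n /\<^sub>R norm n) \<le> (dist w (c t))\<^sup>2 / (2 * \<tau>)"
      by (rule arc_normal[OF S c t]) (use False nu w in \<open>auto simp: u_def\<close>)
    moreover have "(w - c t) \<bullet> (n /\<^sub>R norm n) = norm n"
      using False en by (simp add: e_def power2_norm_eq_inner[symmetric] power2_eq_square)
    ultimately show ?thesis by (simp add: e_def dist_norm power2_norm_eq_inner)
  qed
  then have "(norm n)\<^sup>2 \<le> ((e \<bullet> e) / (2 * \<tau>))\<^sup>2" by (intro power_mono) auto
  then have "n \<bullet> n \<le> (e \<bullet> e)\<^sup>2 / (4 * \<tau>\<^sup>2)" by (simp add: power2_norm_eq_inner power_divide power_mult_distrib)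
  then show ?thesis using nn by (simp add: e_def u_def)
qed

text \<open>Two unit-speed curves with common initial data: \<open>a - b\<close> is nearly tangent to both, so
  \<open>\<langle>a - b, a' - b'\<rangle>\<close> is bounded by a multiple of \<open>\<parallel>a - b\<parallel>\<^sup>2\<close>.\<close>

lemma arc_unique_local:
  assumes S: "open S" and a: "unit_speed S a" and b: "unit_speed S b" and t0: "t0 \<in> S"
    and eq: "a t0 = b t0" "vector_derivative a (at t0) = vector_derivative b (at t0)"
  shows "\<exists>d>0. \<forall>t. \<bar>t - t0\<bar> < d \<longrightarrow> t \<in> S \<and> a t = b t"
proof -
  define a' where "a' = (\<lambda>t. vector_derivative a (at t))"
  define b' where "b' = (\<lambda>t. vector_derivative b (at t))"
  have da: "(a has_vector_derivative a' t) (at t)" and db: "(b has_vector_derivative b' t) (at t)" if "t \<in> S" for t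
    using arc_derivative[OF S a that] arc_derivative[OF S b that] by (auto simp: a'_def b'_def)
  have "isCont a' t0" "isCont b' t0"
    using has_vector_derivative_continuous[OF arc_second_derivative(3)[OF S a t0]]
      has_vector_derivative_continuous[OF arc_second_derivative(3)[OF S b t0]] by (auto simp: a'_def b'_def)
  then have "isCont (\<lambda>t. norm (a' t - b' t)) t0" by (intro continuous_intros)
  moreover have "norm (a' t0 - b' t0) = 0" using eq by (simp add: a'_def b'_def)
  ultimately obtain d1 where d1: "d1 > 0" "\<And>t. dist t t0 < d1 \<Longrightarrow> norm (a' t - b' t) < 1"
    unfolding continuous_at_eps_delta by (auto simp: dist_real_def) (metis zero_less_one)
  have "isCont a t0" "isCont b t0" using arc_isCont S a b t0 by blast+
  then have "isCont (\<lambda>t. dist (a t) (b t)) t0" by (intro continuous_intros)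
  then obtain d2 where d2: "d2 > 0" "\<And>t. dist t t0 < d2 \<Longrightarrow> dist (a t) (b t) < \<tau>"
    unfolding continuous_at_eps_delta using eq tau_pos by (auto simp: dist_real_def)
  obtain d3 where d3: "d3 > 0" "ball t0 d3 \<subseteq> S" using S t0 openE by blast
  \<comment> \<open>Near t0 the velocities differ by less than 1 and the points by less than \<tau>;
    these two conditions give (p - q)^2 \<le> G and G \<le> \<tau>^2 below.\<close>
  define d where "d = min d1 (min d2 d3)"
  have d: "d > 0" using d1 d2 d3 by (simp add: d_def)
  have inS: "t \<in> S" if "\<bar>t - t0\<bar> < d" for t using that d3(2) by (auto simp: d_def dist_real_def)
  define g where "g t = (a t - b t) \<bullet> (a t - b t)" for t
  define g' where "g' t = 2 * ((a t - b t) \<bullet> (a' t - b' t))" for t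
  have "g t = 0" if t: "\<bar>t - t0\<bar> < d" for t
  proof (rule gronwall_zero[where g = g and g' = g' and K = "1 / (2 * \<tau>)", OF _ _ _ _ t])
    fix t assume t: "\<bar>t - t0\<bar> < d"
    note tS = inS[OF t]
    have "((\<lambda>t. a t - b t) has_vector_derivative a' t - b' t) (at t)"
      by (intro has_vector_derivative_diff da db tS)
    from bounded_bilinear.has_vector_derivative[OF bounded_bilinear_inner this this]
    show "(g has_real_derivative g' t) (at t)"
      by (simp add: has_real_derivative_iff_has_vector_derivative g_def[abs_def] g'_def
          inner_commute[of "a' t - b' t" "a t - b t"])
    show "0 \<le> g t" by (simp add: g_def)
    define p where "p = (a t - b t) \<bullet> a' t"
    define q where "q = (a t - b t) \<bullet> b' t"
    define G where "G = g t"
    have G0: "0 \<le> G" by (simp add: G_def g_def)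
    have Gn: "G = (dist (a t) (b t))\<^sup>2" by (simp add: G_def g_def dist_norm power2_norm_eq_inner)
    have q1: "G - G\<^sup>2 / (4 * \<tau>\<^sup>2) \<le> q\<^sup>2"
      using tangential_part[OF S b tS arc_in[OF a tS]] by (simp add: G_def g_def q_def b'_def)
    have "(b t - a t) \<bullet> (b t - a t) = G" "((b t - a t) \<bullet> a' t)\<^sup>2 = p\<^sup>2"
      by (simp_all add: G_def g_def p_def inner_diff_left inner_diff_right power2_commute)
    then have p1: "G - G\<^sup>2 / (4 * \<tau>\<^sup>2) \<le> p\<^sup>2"
      using tangential_part[OF S a tS arc_in[OF b tS]] by (simp add: a'_def)
    have CS: "((a t - b t) \<bullet> v)\<^sup>2 \<le> G * (norm v)\<^sup>2" for v
      using Cauchy_Schwarz_ineq[of "a t - b t" v] by (simp add: G_def g_def power2_norm_eq_inner)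
    have "norm (a' t) = 1" "norm (b' t) = 1" using arc_norm a b tS by (auto simp: a'_def b'_def)
    then have p2: "p\<^sup>2 \<le> G" and q2: "q\<^sup>2 \<le> G" using CS[of "a' t"] CS[of "b' t"] by (simp_all add: p_def q_def)
    have "norm (a' t - b' t) < 1" using d1(2)[of t] t by (simp add: d_def dist_real_def)
    then have "(norm (a' t - b' t))\<^sup>2 \<le> 1\<^sup>2" by (intro power_mono) auto
    then have "G * (norm (a' t - b' t))\<^sup>2 \<le> G * 1" using G0 by (intro mult_left_mono) auto
    moreover have pq: "(a t - b t) \<bullet> (a' t - b' t) = p - q" by (simp add: p_def q_def inner_diff_right)
    ultimately have pq1: "(p - q)\<^sup>2 \<le> G" using CS[of "a' t - b' t"] by simp
    have "dist (a t) (b t) < \<tau>" using d2(2)[of t] t by (simp add: d_def dist_real_def)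
    then have "G \<le> \<tau>\<^sup>2" unfolding Gn by (intro power_mono) auto
    then have x: "G / (4 * \<tau>\<^sup>2) \<le> 1 / 4" using tau_pos by (simp add: field_simps)
    have GG: "G\<^sup>2 / (4 * \<tau>\<^sup>2) \<le> G / 4"
      using mult_left_mono[OF x G0] by (simp add: power2_eq_square)
    \<comment> \<open>Both squares are at least 3G/4 and (p - q)^2 \<le> G, so p + q stays away from
      0 and p - q is controlled by p^2 - q^2.\<close>
    have "(p + q)\<^sup>2 = 2 * p\<^sup>2 + 2 * q\<^sup>2 - (p - q)\<^sup>2" by (simp add: power2_eq_square algebra_simps)
    then have pq2: "G \<le> (p + q)\<^sup>2" using p1 q1 pq1 GG G0 by linarith
    have "\<bar>p\<^sup>2 - q\<^sup>2\<bar> \<le> G\<^sup>2 / (4 * \<tau>\<^sup>2)" using p1 p2 q1 q2 by linarith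
    then have "\<bar>p\<^sup>2 - q\<^sup>2\<bar>\<^sup>2 \<le> (G\<^sup>2 / (4 * \<tau>\<^sup>2))\<^sup>2" by (intro power_mono) auto
    also have "\<bar>p\<^sup>2 - q\<^sup>2\<bar>\<^sup>2 = (p - q)\<^sup>2 * (p + q)\<^sup>2"
      unfolding power2_abs by (simp add: power2_eq_square algebra_simps)
    also have "(G\<^sup>2 / (4 * \<tau>\<^sup>2))\<^sup>2 = G * (G * G * (G / (4 * \<tau>\<^sup>2)) / (4 * \<tau>\<^sup>2))"
      by (simp add: power2_eq_square)
    \<comment> \<open>Bounding one of the factors G/(4\<tau>^2) by 1/4 leaves G times the square of
      G/(4\<tau>). Cancelling G gives |p - q| \<le> G/(4\<tau>), the linear bound in g = G that
      \<open>gronwall_zero\<close> requires.\<close>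
    also have "\<dots> \<le> G * (G * G * (1 / 4) / (4 * \<tau>\<^sup>2))"
      using x G0 by (intro mult_left_mono divide_right_mono) auto
    finally have "(p - q)\<^sup>2 * (p + q)\<^sup>2 \<le> G * (G / (4 * \<tau>))\<^sup>2"
      by (simp add: power2_eq_square)
    moreover have "(p - q)\<^sup>2 * G \<le> (p - q)\<^sup>2 * (p + q)\<^sup>2" by (rule mult_left_mono[OF pq2]) simp
    ultimately have "G * (p - q)\<^sup>2 \<le> G * (G / (4 * \<tau>))\<^sup>2" by (simp add: mult.commute)
    then have "(p - q)\<^sup>2 \<le> (G / (4 * \<tau>))\<^sup>2"
      using pq1 G0 by (cases "G = 0") (auto simp: mult_le_cancel_left)
    then have "\<bar>p - q\<bar> \<le> G / (4 * \<tau>)"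
      using G0 tau_pos abs_le_square_iff[of "p - q" "G / (4 * \<tau>)"] by simp
    then show "\<bar>g' t\<bar> \<le> 1 / (2 * \<tau>) * g t" using pq by (simp add: g'_def G_def abs_mult)
  next
    show "g t0 = 0" using eq by (simp add: g_def)
  qed
  then have "a t = b t" if "\<bar>t - t0\<bar> < d" for t using that by (simp add: g_def)
  then show ?thesis using d inS by blast
qed

text \<open>The set where positions and velocities agree is closed by continuity and open by
  \<open>arc_unique_local\<close>, and the convex set S is connected.\<close>

lemma arc_unique:
  assumes S: "open S" "convex S" and a: "unit_speed S a" and b: "unit_speed S b" and t0: "t0 \<in> S"
    and eq: "a t0 = b t0" "vector_derivative a (at t0) = vector_derivative b (at t0)"
    and t: "t \<in> S"
  shows "a t = b t"
proof -
  define a' where "a' = (\<lambda>t. vector_derivative a (at t))"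
  define b' where "b' = (\<lambda>t. vector_derivative b (at t))"
  define Z where "Z = {t \<in> S. (a t - b t, a' t - b' t) = (0, 0)}"
  have "continuous_on S a'" "continuous_on S b'"
    using smooth_curve_continuous_on[OF S(1) smooth_curve_derivative(1)[OF S(1)]] a b
    by (auto simp: a'_def b'_def unit_speed_def)
  moreover have "continuous_on S a" "continuous_on S b"
    using smooth_curve_continuous_on[OF S(1)] a b by (auto simp: unit_speed_def)
  ultimately have "closedin (top_of_set S) Z"
    unfolding Z_def by (intro continuous_closedin_preimage_constant continuous_intros)
  moreover have "open Z"
    unfolding open_dist
  proof
    fix s assume s: "s \<in> Z"
    then obtain d where d: "d > 0" "\<And>t. \<bar>t - s\<bar> < d \<Longrightarrow> t \<in> S \<and> a t = b t"
      using arc_unique_local[OF S(1) a b, of s] by (auto simp: Z_def a'_def b'_def)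
    have "r \<in> Z" if r: "dist r s < d" for r
    proof -
      have rS: "r \<in> S" using d(2) r by (simp add: dist_real_def)
      have "(b has_vector_derivative a' r) (at r)"
        unfolding a'_def
        by (rule has_vector_derivative_transform_within_open[OF arc_derivative[OF S(1) a rS] open_ball[of s d]])
          (use d(2) r in \<open>auto simp: dist_real_def abs_minus_commute\<close>)
      then have "b' r = a' r" unfolding b'_def by (rule vector_derivative_at)
      then show ?thesis using rS d(2)[of r] r by (auto simp: Z_def dist_real_def)
    qed
    then show "\<exists>e>0. \<forall>y. dist y s < e \<longrightarrow> y \<in> Z" using d(1) by blast
  qed
  then have "openin (top_of_set S) Z" by (rule open_subset[rotated]) (auto simp: Z_def)
  moreover have "t0 \<in> Z" using t0 eq by (simp add: Z_def a'_def b'_def)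
  ultimately have "Z = S" using convex_connected[OF S(2)] unfolding connected_clopen by blast
  then show ?thesis using t by (auto simp: Z_def)
qed

lemma arc_exists_local:
  assumes z: "z \<in> M"
  shows "\<exists>\<delta>>0. \<exists>c. unit_speed {-\<delta><..<\<delta>} c \<and> c 0 = z"
proof -
  obtain \<gamma> \<epsilon> where \<gamma>: "0 < \<epsilon>" "smooth_curve {-\<epsilon><..<\<epsilon>} \<gamma>" "\<gamma> 0 = z"
    "\<And>t. t \<in> {-\<epsilon><..<\<epsilon>} \<Longrightarrow> \<gamma> t \<in> M" "\<And>t. t \<in> {-\<epsilon><..<\<epsilon>} \<Longrightarrow> vector_derivative \<gamma> (at t) \<noteq> 0"
    by (rule chart[OF z]) (rule that)
  from arc_length_reparametrization[OF \<gamma>(1,2,5)] obtain \<delta> \<theta> where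
    "\<delta> > 0" "\<theta> 0 = 0" "\<forall>s\<in>{-\<delta><..<\<delta>}. \<theta> s \<in> {-\<epsilon><..<\<epsilon>}" "smooth_curve {-\<delta><..<\<delta>} (\<lambda>s. \<gamma> (\<theta> s))"
    "\<forall>s\<in>{-\<delta><..<\<delta>}. norm (vector_derivative (\<lambda>s. \<gamma> (\<theta> s)) (at s)) = 1" by blast
  then show ?thesis using \<gamma>(3,4)
    by (intro exI[of _ \<delta>] conjI exI[of _ "\<lambda>s. \<gamma> (\<theta> s)"]) (auto simp: unit_speed_def)
qed

text \<open>One local curve through z serves all w near z: by \<open>arc_covers\<close> such a w
  lies on it and can be made the new origin. Compactness of M leaves finitely many half-lengths to
  compare.\<close>

lemma arc_exists_uniform: "\<exists>\<rho>>0. \<forall>z\<in>M. \<exists>c. unit_speed {-\<rho><..<\<rho>} c \<and> c 0 = z"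
proof -
  have "\<forall>z\<in>M. \<exists>r>0. \<forall>w\<in>M. dist w z < r / 4 \<longrightarrow> (\<exists>c. unit_speed {-r<..<r} c \<and> c 0 = w)"
  proof
    fix z assume "z \<in> M"
    then obtain \<delta> c where c: "\<delta> > 0" "unit_speed {-\<delta><..<\<delta>} c" "c 0 = z" using arc_exists_local by blast
    \<comment> \<open>Half of \<delta>, since moving the origin by less than r and then going on by
      less than r must stay in the domain; r \<le> \<tau> is for \<open>arc_covers\<close>.\<close>
    define r where "r = min (\<delta> / 2) \<tau>"
    have r: "0 < r" "r \<le> \<delta> / 2" "r \<le> \<tau>" using c tau_pos by (auto simp: r_def)
    have "\<exists>c. unit_speed {-r<..<r} c \<and> c 0 = w" if w: "w \<in> M" "dist w z < r / 4" for w
    proof -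
      have "{0 - r..0 + r} \<subseteq> {-\<delta><..<\<delta>}" using r by auto
      then obtain t where t: "\<bar>t - 0\<bar> < r" "w = c t"
        by (rule arc_covers[OF open_greaterThanLessThan convex_real_interval(8) c(2) r(1,3) _ w(1) w(2)[folded c(3)]])
      have "unit_speed {-r<..<r} (\<lambda>s. c (t + 1 * s))"
        by (rule arc_affine(1)[OF _ c(2)]) (use t r in auto)
      then show ?thesis using t by (intro exI[of _ "\<lambda>s. c (t + 1 * s)"]) simp
    qed
    then show "\<exists>r>0. \<forall>w\<in>M. dist w z < r / 4 \<longrightarrow> (\<exists>c. unit_speed {-r<..<r} c \<and> c 0 = w)" using r by blast
  qed
  then obtain r where r: "\<And>z. z \<in> M \<Longrightarrow> r z > 0"
    "\<And>z w. z \<in> M \<Longrightarrow> w \<in> M \<Longrightarrow> dist w z < r z / 4 \<Longrightarrow> \<exists>c. unit_speed {-r z<..<r z} c \<and> c 0 = w" by metis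
  obtain C where C: "C \<subseteq> M" "finite C" "M \<subseteq> (\<Union>z\<in>C. ball z (r z / 4))"
    by (rule compactE_image[OF compact_M, of M "\<lambda>z. ball z (r z / 4)"]) (use r(1) in \<open>auto intro!: bexI\<close>)
  have ne: "C \<noteq> {}" using C M_ne by auto
  define \<rho> where "\<rho> = Min (r ` C)"
  have "\<rho> > 0" using C ne r(1) by (auto simp: \<rho>_def)
  moreover have "\<exists>c. unit_speed {-\<rho><..<\<rho>} c \<and> c 0 = w" if w: "w \<in> M" for w
  proof -
    obtain z where z: "z \<in> C" "dist w z < r z / 4" using C(3) w by (auto simp: dist_commute)
    then obtain c where c: "unit_speed {-r z<..<r z} c" "c 0 = w" using r(2) C(1) w by blast
    have "\<rho> \<le> r z" using z C by (simp add: \<rho>_def)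
    then have "unit_speed {-\<rho><..<\<rho>} c" by (intro arc_subset[OF c(1)]) auto
    then show ?thesis using c by blast
  qed
  ultimately show ?thesis by blast
qed

lemma arc_extend:
  assumes \<rho>: "\<rho> > 0" "\<forall>z\<in>M. \<exists>c. unit_speed {-\<rho><..<\<rho>} c \<and> c 0 = z"
    and c: "unit_speed {a<..<b} c" "b - a > \<rho>"
  shows "\<exists>d. unit_speed {a<..<b + \<rho> / 2} d \<and> (\<forall>t\<in>{a<..<b}. d t = c t)"
proof -
  \<comment> \<open>Attached \<rho>/4 before the end, the new curve reaches b + 3\<rho>/4, beyond b
    + \<rho>/2; and b - a > \<rho> keeps t1 in the old interval.\<close>
  define t1 where "t1 = b - \<rho> / 4"
  have t1: "t1 \<in> {a<..<b}" using c \<rho> by (auto simp: t1_def)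
  obtain e where e: "unit_speed {-\<rho><..<\<rho>} e" "e 0 = c t1" using \<rho>(2) arc_in[OF c(1) t1] by blast
  have o: "(0::real) \<in> {-\<rho><..<\<rho>}" using \<rho> by simp
  \<comment> \<open>Two unit velocities at the same point of M are parallel, so k is 1 or -1; it
    orients e like c.\<close>
  define k where "k = vector_derivative c (at t1) \<bullet> vector_derivative e (at 0)"
  have par: "vector_derivative c (at t1) = k *\<^sub>R vector_derivative e (at 0)"
    unfolding k_def
    by (rule velocity_parallel(1)[OF _ e(1) o arc_derivative[OF _ c(1) t1] _ t1]) (use arc_in[OF c(1)] e in auto)
  have k: "\<bar>k\<bar> = 1" using arg_cong[OF par, of norm] arc_norm[OF c(1) t1] arc_norm[OF e(1) o] by simp
  define f where "f = (\<lambda>t. e (- k * t1 + k * t))"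
  have kk: "k * k = 1" using k by (cases "k \<ge> 0") (auto simp: abs_if split: if_splits)
  have in1: "- k * t1 + k * t \<in> {-\<rho><..<\<rho>}" if t: "t \<in> {t1 - \<rho><..<t1 + \<rho>}" for t
  proof -
    have "\<bar>k * (t - t1)\<bar> < \<rho>" using t k by (auto simp: abs_mult)
    then show ?thesis by (auto simp: abs_less_iff algebra_simps)
  qed
  have f: "unit_speed {t1 - \<rho><..<t1 + \<rho>} f"
    unfolding f_def by (rule arc_affine(1)[OF _ e(1) in1 k]) auto
  have f': "vector_derivative f (at t1) = vector_derivative c (at t1)"
    unfolding f_def
    using arc_affine(2)[OF open_greaterThanLessThan e(1) in1 k, of "{t1 - \<rho><..<t1 + \<rho>}" t1] \<rho> par by auto
  have f0: "f t1 = c t1" using e by (simp add: f_def)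
  have agree: "f t = c t" if t: "t \<in> {a<..<b} \<inter> {t1 - \<rho><..<t1 + \<rho>}" for t
    by (rule arc_unique[of "{a<..<b} \<inter> {t1 - \<rho><..<t1 + \<rho>}" f c t1])
      (use t f f0 f' t1 \<rho> c in \<open>auto intro: arc_subset convex_Int convex_real_interval\<close>)
  define d where "d t = (if t < b then c t else f t)" for t
  have "unit_speed {a<..<b + \<rho> / 2} d"
  proof (rule arc_local)
    fix t assume t: "t \<in> {a<..<b + \<rho> / 2}"
    show "\<exists>U. open U \<and> t \<in> U \<and> unit_speed U d"
    proof (cases "t < b")
      case True
      have "unit_speed {a<..<b} d" by (rule arc_cong[OF _ _ c(1)]) (auto simp: d_def)
      then show ?thesis using t True by (intro exI[of _ "{a<..<b}"]) auto
    next
      case False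
      let ?U = "{max a t1<..<b + \<rho> / 2}"
      have "unit_speed ?U f" by (rule arc_subset[OF f]) (use \<rho> in \<open>auto simp: t1_def\<close>)
      then have "unit_speed ?U d"
        by (rule arc_cong[rotated 2]) (use agree \<rho> t1 in \<open>auto simp: d_def t1_def\<close>)
      then show ?thesis using t t1 False by (intro exI[of _ ?U]) auto
    qed
  qed
  then show ?thesis by (intro exI[of _ d]) (auto simp: d_def)
qed

text \<open>\<open>arc_extend\<close> works at the right end; the left end is reached by reversing
  time, extending, and reversing again.\<close>

lemma arc_exists_long:
  assumes \<rho>: "\<rho> > 0" "\<forall>z\<in>M. \<exists>c. unit_speed {-\<rho><..<\<rho>} c \<and> c 0 = z" and c0: "unit_speed {-\<rho><..<\<rho>} c0"
  shows "\<exists>c. unit_speed {-(\<rho> + real n * (\<rho> / 2))<..<\<rho> + real n * (\<rho> / 2)} c \<and> (\<forall>t\<in>{-\<rho><..<\<rho>}. c t = c0 t)"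
proof (induction n)
  case 0
  then show ?case using c0 by auto
next
  case (Suc n)
  define R where "R = \<rho> + real n * (\<rho> / 2)"
  have R: "\<rho> \<le> R" using \<rho> by (simp add: R_def)
  obtain c where c: "unit_speed {-R<..<R} c" "\<And>t. t \<in> {-\<rho><..<\<rho>} \<Longrightarrow> c t = c0 t"
    using Suc by (auto simp: R_def)
  obtain d where d: "unit_speed {-R<..<R + \<rho>/2} d" "\<And>t. t \<in> {-R<..<R} \<Longrightarrow> d t = c t"
    using arc_extend[OF \<rho> c(1)] R \<rho> by auto
  have "unit_speed {-(R + \<rho>/2)<..<R} (\<lambda>t. d (0 + (-1) * t))"
    by (rule arc_affine(1)[OF _ d(1)]) auto
  from arc_extend[OF \<rho> this] obtain e where e: "unit_speed {-(R + \<rho>/2)<..<R + \<rho>/2} e"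
     "\<And>t. t \<in> {-(R+\<rho>/2)<..<R} \<Longrightarrow> e t = d (- t)"
    using R \<rho> by auto
  have "unit_speed {-(R + \<rho>/2)<..<R + \<rho>/2} (\<lambda>t. e (0 + (-1) * t))"
    by (rule arc_affine(1)[OF _ e(1)]) auto
  moreover have "e (0 + (-1) * t) = c0 t" if "t \<in> {-\<rho><..<\<rho>}" for t
    using that R e(2)[of "-t"] d(2)[of t] c(2)[of t] \<rho> by auto
  moreover have "R + \<rho>/2 = \<rho> + real (Suc n) * (\<rho> / 2)" by (simp add: R_def field_simps)
  ultimately show ?case by (intro exI[of _ "\<lambda>t. e (0 + (-1) * t)"]) metis
qed

lemma arc_exists_global:
  assumes z: "z \<in> M"
  obtains c where "unit_speed UNIV c" "c 0 = z"
proof -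
  obtain \<rho> where \<rho>: "\<rho> > 0" "\<forall>z\<in>M. \<exists>c. unit_speed {-\<rho><..<\<rho>} c \<and> c 0 = z" using arc_exists_uniform by blast
  obtain c0 where c0: "unit_speed {-\<rho><..<\<rho>} c0" "c0 0 = z" using \<rho> z by blast
  have ex: "\<exists>c. unit_speed {-R<..<R} c \<and> (\<forall>t\<in>{-\<rho><..<\<rho>}. c t = c0 t)" for R
  proof -
    obtain n :: nat where n: "R / (\<rho> / 2) < real n" using reals_Archimedean2 by blast
    then have "R < real n * (\<rho> / 2)" using \<rho>(1) by (simp add: field_simps)
    then have "R \<le> \<rho> + real n * (\<rho> / 2)" using \<rho> by simp
    then show ?thesis using arc_exists_long[OF \<rho> c0(1), of n]
      by (metis (no_types, lifting) arc_subset greaterThanLessThan_subseteq_greaterThanLessThan le_imp_neg_le)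
  qed
  define F where "F R = (SOME c. unit_speed {-R<..<R} c \<and> (\<forall>t\<in>{-\<rho><..<\<rho>}. c t = c0 t))" for R
  have F: "unit_speed {-R<..<R} (F R)" "\<And>t. t \<in> {-\<rho><..<\<rho>} \<Longrightarrow> F R t = c0 t" for R
    using someI_ex[OF ex[of R]] by (auto simp: F_def)
  have o: "(0::real) \<in> {-\<rho><..<\<rho>}" using \<rho> by simp
  have F0: "vector_derivative (F R) (at 0) = vector_derivative c0 (at 0)" for R
    by (rule vector_derivative_at)
      (rule has_vector_derivative_transform_within_open[OF arc_derivative[OF _ c0(1) o] _ o], use F(2) in auto)
  have agree: "F R t = F R' t" if "\<bar>t\<bar> < R" "R \<le> R'" for R R' t
  proof (rule arc_unique[of "{-R<..<R}" _ _ 0])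
    show "unit_speed {-R<..<R} (F R')" by (rule arc_subset[OF F(1)]) (use that in auto)
  qed (use that F F0 o in auto)
  \<comment> \<open>Uniqueness makes the curves \<open>F R\<close> compatible, so at t any R > |t|
    will do; |t| + \<rho> is one.\<close>
  define C where "C t = F (\<bar>t\<bar> + \<rho>) t" for t
  have "unit_speed UNIV C"
  proof (rule arc_local)
    fix t :: real
    let ?U = "{-(\<bar>t\<bar> + 1)<..<\<bar>t\<bar> + 1}"
    have "unit_speed ?U (F (\<bar>t\<bar> + 1 + \<rho>))" by (rule arc_subset[OF F(1)]) (use \<rho> in auto)
    then have "unit_speed ?U C"
    proof (rule arc_cong[rotated 2])
      fix s assume "s \<in> ?U"
      then have "\<bar>s\<bar> < \<bar>t\<bar> + 1" by auto
      then show "F (\<bar>t\<bar> + 1 + \<rho>) s = C s" using agree[of s "\<bar>s\<bar> + \<rho>" "\<bar>t\<bar> + 1 + \<rho>"] \<rho> by (simp add: C_def)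
    qed simp
    then show "\<exists>U. open U \<and> t \<in> U \<and> unit_speed U C" by (intro exI[of _ ?U]) auto
  qed
  moreover have "C 0 = z" using F(2)[OF o] c0 by (simp add: C_def)
  ultimately show thesis using that by blast
qed

end

section \<open>The exponential map\<close>

lemma has_vector_derivative_affine:
  assumes "(f has_vector_derivative f') (at (a + b * t))"
  shows "((\<lambda>s. f (a + b * s)) has_vector_derivative b *\<^sub>R f') (at t)"
proof -
  have "((\<lambda>t. a + b * t) has_vector_derivative b) (at t)"
    by (auto intro!: derivative_eq_intros simp: has_real_derivative_iff_has_vector_derivative[symmetric])
  from vector_diff_chain_at[OF this assms] show ?thesis by (simp add: o_def)
qed

context closed_curve begin

lemma tangent_space_arc:
  assumes c: "unit_speed UNIV c"
  shows "tangent_space M (c t) = range (\<lambda>k. k *\<^sub>R vector_derivative c (at t))"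
proof (intro equalityI subsetI)
  fix v assume "v \<in> tangent_space M (c t)"
  then obtain \<epsilon> \<sigma> where \<sigma>: "\<epsilon> > 0" "\<sigma> ` {-\<epsilon><..<\<epsilon>} \<subseteq> M" "\<sigma> 0 = c t" "(\<sigma> has_vector_derivative v) (at 0)"
    unfolding tangent_space_def by blast
  have "v = (v \<bullet> vector_derivative c (at t)) *\<^sub>R vector_derivative c (at t)"
    by (rule velocity_parallel(1)[OF open_UNIV c UNIV_I \<sigma>(4) open_greaterThanLessThan[of "-\<epsilon>" \<epsilon>]])
      (use \<sigma> in auto)
  then show "v \<in> range (\<lambda>k. k *\<^sub>R vector_derivative c (at t))" by blast
next
  fix v assume "v \<in> range (\<lambda>k. k *\<^sub>R vector_derivative c (at t))"
  then obtain k where k: "v = k *\<^sub>R vector_derivative c (at t)" by blast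
  define \<sigma> where "\<sigma> = (\<lambda>s. c (t + k * s))"
  have "smooth_curve {-1<..<1} \<sigma>"
    unfolding \<sigma>_def by (rule smooth_curve_affine[of UNIV]) (use c in \<open>auto simp: unit_speed_def\<close>)
  then have "smooth_on UNIV {-1<..<1} \<sigma>" by (intro smooth_curve_imp_smooth_on) auto
  moreover have "(\<sigma> has_vector_derivative v) (at 0)"
    unfolding \<sigma>_def k by (rule has_vector_derivative_affine) (use arc_derivative[OF open_UNIV c UNIV_I, of t] in simp)
  moreover have "\<sigma> ` {-1<..<1} \<subseteq> M" "\<sigma> 0 = c t" using arc_in[OF c] by (auto simp: \<sigma>_def)
  ultimately show "v \<in> tangent_space M (c t)"
    unfolding tangent_space_def mem_Collect_eq by (intro exI[of _ 1] conjI exI[of _ \<sigma>]) auto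
qed

text \<open>In dimension one every curve of constant speed is a geodesic: its acceleration is
  orthogonal to the velocity of c, which spans the tangent space. The factor k may be 0 or
  negative.\<close>

lemma geodesic_arc:
  assumes c: "unit_speed UNIV c"
  shows "geodesic M (\<lambda>t. c (k * t))"
    and "vector_derivative (\<lambda>t. c (k * t)) (at 0) = k *\<^sub>R vector_derivative c (at 0)"
proof -
  define c' where "c' = (\<lambda>t. vector_derivative c (at t))"
  have d: "((\<lambda>t. c (k * t)) has_vector_derivative k *\<^sub>R c' (k * t)) (at t)" for t
    using has_vector_derivative_affine[of c "c' (k * t)" 0 k t] arc_derivative[OF open_UNIV c UNIV_I, of "k * t"]
    by (simp add: c'_def)
  then have v: "(\<lambda>s. vector_derivative (\<lambda>t. c (k * t)) (at s)) = (\<lambda>s. k *\<^sub>R c' (k * s))"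
    by (intro ext vector_derivative_at)
  from fun_cong[OF v, of 0] show "vector_derivative (\<lambda>t. c (k * t)) (at 0) = k *\<^sub>R vector_derivative c (at 0)"
    by (simp add: c'_def)
  have d': "((\<lambda>s. c' (k * s)) has_vector_derivative k *\<^sub>R vector_derivative c' (at (k * t))) (at t)" for t
    using has_vector_derivative_affine[of c' "vector_derivative c' (at (k * t))" 0 k t]
      arc_second_derivative(3)[OF open_UNIV c UNIV_I, of "k * t"] by (simp add: c'_def)
  have "((\<lambda>s. k *\<^sub>R c' (k * s)) has_vector_derivative k *\<^sub>R k *\<^sub>R vector_derivative c' (at (k * t))) (at t)" for t
    by (rule bounded_linear.has_vector_derivative[OF bounded_linear_scaleR_right d'])
  then have v2: "vector_derivative (\<lambda>s. vector_derivative (\<lambda>t. c (k * t)) (at s)) (at t) =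
    k *\<^sub>R k *\<^sub>R vector_derivative c' (at (k * t))" for t
    unfolding v by (rule vector_derivative_at)
  have "smooth_curve UNIV (\<lambda>t. c (0 + k * t))"
    by (rule smooth_curve_affine[of UNIV]) (use c in \<open>auto simp: unit_speed_def\<close>)
  then have "smooth_on UNIV UNIV (\<lambda>t. c (k * t))" using smooth_curve_imp_smooth_on by force
  then show "geodesic M (\<lambda>t. c (k * t))"
    unfolding geodesic_def v2 tangent_space_arc[OF c]
    using arc_in[OF c] arc_second_derivative(2)[OF open_UNIV c UNIV_I] by (auto simp: c'_def)
qed

text \<open>A geodesic has constant speed, because b' is itself tangent and hence orthogonal to b''.
  For k \<noteq> 0 rescaling time by 1/|k| yields a unit-speed curve, which is compared with c run
  in the direction sgn k.\<close>

lemma geodesic_unique: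
  assumes c: "unit_speed UNIV c" and b: "geodesic M b" "b 0 = c 0"
    "vector_derivative b (at 0) = k *\<^sub>R vector_derivative c (at 0)"
  shows "b 1 = c k"
proof -
  define b' where "b' = (\<lambda>t. vector_derivative b (at t))"
  have cs: "smooth_curve UNIV b" and bM: "b t \<in> M" for t
    using b(1) by (auto simp: geodesic_def smooth_on_real_iff)
  have cs': "smooth_curve UNIV b'" unfolding b'_def by (rule smooth_curve_derivative(1)[OF open_UNIV cs])
  have d: "(b has_vector_derivative b' t) (at t)" for t
    using smooth_curve_derivative(2)[OF open_UNIV cs UNIV_I] by (simp add: b'_def)
  have d': "(b' has_vector_derivative vector_derivative b' (at t)) (at t)" for t
    using smooth_curve_derivative(2)[OF open_UNIV cs' UNIV_I] by simp
  have orth: "vector_derivative b' (at t) \<bullet> b' t = 0" for t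
  proof -
    define \<sigma> where "\<sigma> = (\<lambda>s. b (t + 1 * s))"
    have "smooth_curve {-1<..<1} \<sigma>"
      unfolding \<sigma>_def by (rule smooth_curve_affine[OF cs]) auto
    then have "smooth_on UNIV {-1<..<1} \<sigma>" by (intro smooth_curve_imp_smooth_on) auto
    moreover have "(\<sigma> has_vector_derivative 1 *\<^sub>R b' t) (at 0)"
      unfolding \<sigma>_def by (rule has_vector_derivative_affine) (use d[of t] in simp)
    moreover have "\<sigma> ` {-1<..<1} \<subseteq> M" "\<sigma> 0 = b t" using bM by (auto simp: \<sigma>_def)
    ultimately have "b' t \<in> tangent_space M (b t)"
      unfolding tangent_space_def mem_Collect_eq by (intro exI[of _ 1] conjI exI[of _ \<sigma>]) auto
    then show ?thesis using b(1) by (auto simp: geodesic_def b'_def)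
  qed
  have "((\<lambda>t. b' t \<bullet> b' t) has_real_derivative 0) (at t)" for t
    using bounded_bilinear.has_vector_derivative[OF bounded_bilinear_inner d' d', of t] orth[of t]
    by (simp add: has_real_derivative_iff_has_vector_derivative inner_commute)
  then have "b' t \<bullet> b' t = b' 0 \<bullet> b' 0" for t using DERIV_isconst_all by blast
  then have nb: "norm (b' t) = \<bar>k\<bar>" for t
    using b(3) arc_norm[OF c, of 0] norm_eq_sqrt_inner[of "b' t"] norm_eq_sqrt_inner[of "b' 0"]
    by (simp add: b'_def)
  show ?thesis
  proof (cases "k = 0")
    case True
    have "norm (b 1 - b 0) \<le> 0 * \<bar>1 - 0\<bar>"
      by (rule vector_derivative_lipschitz[OF convex_UNIV d]) (use nb True in auto)
    then show ?thesis using b True by simp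
  next
    case False
    define e where "e = (\<lambda>t. b (0 + (1 / \<bar>k\<bar>) * t))"
    have e': "(e has_vector_derivative (1 / \<bar>k\<bar>) *\<^sub>R b' (0 + (1 / \<bar>k\<bar>) * t)) (at t)" for t
      unfolding e_def by (rule has_vector_derivative_affine) (rule d)
    have "smooth_curve UNIV e" unfolding e_def by (rule smooth_curve_affine[OF cs]) auto
    then have e: "unit_speed UNIV e"
      using False nb bM vector_derivative_at[OF e'] by (auto simp: unit_speed_def) (simp add: e_def)
    have sk: "\<bar>sgn k\<bar> = 1" using False by (simp add: sgn_if)
    define f where "f = (\<lambda>t. c (0 + sgn k * t))"
    have f: "unit_speed UNIV f" unfolding f_def by (rule arc_affine(1)[OF open_UNIV c _ sk]) auto
    have f': "vector_derivative f (at 0) = sgn k *\<^sub>R vector_derivative c (at 0)"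
      unfolding f_def using arc_affine(2)[OF open_UNIV c _ sk, of UNIV 0 0] by simp
    have "e \<bar>k\<bar> = f \<bar>k\<bar>"
    proof (rule arc_unique[OF open_UNIV convex_UNIV e f UNIV_I[of 0]])
      show "e 0 = f 0" using b by (simp add: e_def f_def)
      have "vector_derivative e (at 0) = (k / \<bar>k\<bar>) *\<^sub>R vector_derivative c (at 0)"
        using vector_derivative_at[OF e', of 0] b(3) by (simp add: b'_def)
      then show "vector_derivative e (at 0) = vector_derivative f (at 0)"
        using f' by (simp add: sgn_if abs_if)
    qed simp
    then show ?thesis using False by (simp add: e_def f_def mult_sgn_abs)
  qed
qed

text \<open>Here the exponential chart is identified with arc length: \<open>geodesic_arc\<close>
  supplies a value for the definite description and \<open>geodesic_unique\<close> its
  uniqueness.\<close>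

lemma riemannian_exp_arc:
  assumes c: "unit_speed UNIV c"
  shows "riemannian_exp M (c 0) (k *\<^sub>R vector_derivative c (at 0)) = c k"
  unfolding riemannian_exp_def
proof (rule the_equality)
  show "\<exists>b. geodesic M b \<and> b 0 = c 0 \<and> vector_derivative b (at 0) = k *\<^sub>R vector_derivative c (at 0) \<and> b 1 = c k"
    using geodesic_arc[OF c, of k] by (intro exI[of _ "\<lambda>t. c (k * t)"]) simp
  show "y = c k" if "\<exists>b. geodesic M b \<and> b 0 = c 0 \<and> vector_derivative b (at 0) = k *\<^sub>R vector_derivative c (at 0) \<and> b 1 = y" for y
    using that geodesic_unique[OF c] by blast
qed

lemma arc_inj_on:
  assumes c: "unit_speed UNIV c"
  shows "inj_on c {-(\<tau>/2)<..<\<tau>/2}"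
proof (rule inj_onI)
  fix s t assume "s \<in> {-(\<tau>/2)<..<\<tau>/2}" "t \<in> {-(\<tau>/2)<..<\<tau>/2}" "c s = c t"
  then show "s = t" using arc_le_twice_chord[OF open_UNIV convex_UNIV c UNIV_I UNIV_I, of s t] by auto
qed

lemma openin_arc_image:
  assumes c: "unit_speed UNIV c"
  shows "openin (top_of_set M) (c ` {-(\<tau>/2)<..<\<tau>/2})"
proof -
  let ?I = "{-(\<tau>/2)<..<\<tau>/2}"
  have "\<exists>r>0. ball (c t) r \<inter> M \<subseteq> c ` ?I" if t: "t \<in> ?I" for t
  proof -
    define r where "r = \<tau>/2 - \<bar>t\<bar>"
    have r: "0 < r" "r \<le> \<tau>" using t tau_pos by (auto simp: r_def)
    have "w \<in> c ` ?I" if w: "w \<in> M" "dist w (c t) < r / 4" for w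
    proof -
      obtain s where s: "\<bar>s - t\<bar> < r" "w = c s"
        by (rule arc_covers[OF open_UNIV convex_UNIV c r _ w]) auto
      then have "s \<in> ?I" by (auto simp: r_def)
      then show ?thesis using s by blast
    qed
    then show ?thesis using r by (intro exI[of _ "r/4"]) (auto simp: dist_commute)
  qed
  then show ?thesis
    unfolding openin_contains_ball using arc_in[OF c] by auto
qed

lemma continuous_on_arc_inverse:
  assumes c: "unit_speed UNIV c"
  shows "continuous_on (c ` {-(\<tau>/2)<..<\<tau>/2}) (the_inv_into {-(\<tau>/2)<..<\<tau>/2} c)"
  unfolding continuous_on_iff
proof (intro ballI allI impI)
  let ?I = "{-(\<tau>/2)<..<\<tau>/2}"
  fix x e assume x: "x \<in> c ` ?I" and e: "(0::real) < e"
  have "dist (the_inv_into ?I c x') (the_inv_into ?I c x) \<le> 2 * dist x' x" if "x' \<in> c ` ?I" for x'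
    using that x arc_le_twice_chord[OF open_UNIV convex_UNIV c UNIV_I UNIV_I]
      the_inv_into_f_f[OF arc_inj_on[OF c]] by (auto simp: dist_real_def)
  then show "\<exists>d>0. \<forall>x'\<in>c ` ?I. dist x' x < d \<longrightarrow> dist (the_inv_into ?I c x') (the_inv_into ?I c x) < e"
    using e by (intro exI[of _ "e / 2"]) fastforce
qed

text \<open>This bounds the injectivity radius below by \<tau>/2: parameters in the interval differ
  by less than \<tau>, where an arc is at most twice its chord, so c is injective with a 2-Lipschitz
  inverse.\<close>

lemma smooth_parametrization_exp:
  assumes c: "unit_speed UNIV c"
  shows "smooth_parametrization M (tangent_space M (c 0))
    (subspace_ball (tangent_space M (c 0)) (ennreal (\<tau>/2))) (riemannian_exp M (c 0))"
proof -
  define u where "u = vector_derivative c (at 0)"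
  define H where "H = tangent_space M (c 0)"
  define U where "U = subspace_ball H (ennreal (\<tau>/2))"
  define E where "E = riemannian_exp M (c 0)"
  define I where "I = {-(\<tau>/2)<..<\<tau>/2}"
  have nu: "norm u = 1" using arc_norm[OF c] by (simp add: u_def)
  then have uu: "u \<bullet> u = 1" by (simp add: norm_eq_1)
  have H: "H = range (\<lambda>k. k *\<^sub>R u)" using tangent_space_arc[OF c] by (simp add: H_def u_def)
  have E: "E (k *\<^sub>R u) = c k" for k using riemannian_exp_arc[OF c] by (simp add: E_def u_def)
  have U: "U = (\<lambda>k. k *\<^sub>R u) ` I"
  proof -
    have "k *\<^sub>R u \<in> U \<longleftrightarrow> k \<in> I" for k
      using tau_pos nu by (auto simp: U_def subspace_ball_def H I_def ennreal_less_iff)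
    moreover have "U \<subseteq> range (\<lambda>k. k *\<^sub>R u)" by (auto simp: U_def subspace_ball_def H)
    ultimately show ?thesis by blast
  qed
  have EU: "E ` U = c ` I" unfolding U image_image E ..
  have cs: "smooth_curve UNIV c" using c by (simp add: unit_speed_def)
  have "smooth_on H U E"
    unfolding smooth_on_def times_differentiable_on_def
  proof (intro allI impI)
    fix k and hs :: "'a list" assume "set hs \<subseteq> H \<and> length hs < k"
    then obtain g where g: "smooth_curve UNIV g" "\<And>s. iter_deriv E hs (s *\<^sub>R u) = g s"
      using iter_deriv_of_curve[OF open_UNIV E cs] H by blast
    show "iter_deriv E hs differentiable_on U"
      unfolding differentiable_on_def
    proof
      fix v assume v: "v \<in> U"
      \<comment> \<open>The exponential map is controlled only on the tangent line, so
        differentiability is shown within U, through the linear coordinate v \<bullet> u.\<close>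
      have dg: "g differentiable (at (v \<bullet> u))"
        using smooth_curve_derivative(2)[OF open_UNIV g(1) UNIV_I] by (rule differentiableI_vector)
      have "(\<lambda>v. v \<bullet> u) differentiable (at v within U)"
        by (intro bounded_linear_imp_differentiable bounded_linear_inner_left)
      moreover have "g differentiable (at (v \<bullet> u) within (\<lambda>v. v \<bullet> u) ` U)"
        using dg differentiable_at_withinI by blast
      ultimately have "(g \<circ> (\<lambda>v. v \<bullet> u)) differentiable (at v within U)"
        by (rule differentiable_chain_within)
      then show "iter_deriv E hs differentiable (at v within U)"
      proof (rule differentiable_transform_within[OF _ zero_less_one v])
        fix w assume "w \<in> U"
        then obtain s where "w = s *\<^sub>R u" by (auto simp: U)
        then show "(g \<circ> (\<lambda>v. v \<bullet> u)) w = iter_deriv E hs w" using g(2) uu by simp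
      qed
    qed
  qed
  moreover have "openin (top_of_set M) (E ` U)"
    unfolding EU I_def by (rule openin_arc_image[OF c])
  moreover have "\<exists>\<psi>. homeomorphism U (E ` U) E \<psi>"
  proof -
    define \<sigma> where "\<sigma> = the_inv_into I c"
    have inj: "inj_on c I" using arc_inj_on[OF c] by (simp add: I_def)
    have \<sigma>: "\<sigma> (c t) = t" if "t \<in> I" for t unfolding \<sigma>_def by (rule the_inv_into_f_f[OF inj that])
    have "continuous_on (c ` I) \<sigma>"
      unfolding \<sigma>_def I_def by (rule continuous_on_arc_inverse[OF c])
    then have "continuous_on (c ` I) (\<lambda>y. \<sigma> y *\<^sub>R u)" by (intro continuous_intros)
    moreover have "continuous_on U E"
    proof -
      have "continuous_on UNIV c" by (rule smooth_curve_continuous_on[OF open_UNIV cs])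
      then have "continuous_on U (\<lambda>v. c (v \<bullet> u))"
        by (rule continuous_on_compose2) (auto intro!: continuous_intros)
      then show ?thesis by (rule continuous_on_eq) (auto simp: U E uu)
    qed
    ultimately have "homeomorphism U (E ` U) E (\<lambda>y. \<sigma> y *\<^sub>R u)"
      unfolding homeomorphism_def EU by (auto simp: U E \<sigma> image_image)
    then show ?thesis by blast
  qed
  moreover have "iter_deriv E [h] v \<noteq> 0" if "v \<in> U" "h \<in> H" "h \<noteq> 0" for v h
  proof -
    obtain s where s: "v = s *\<^sub>R u" using \<open>v \<in> U\<close> by (auto simp: U)
    obtain k where k: "h = k *\<^sub>R u" using \<open>h \<in> H\<close> by (auto simp: H)
    have sk: "v = s *\<^sub>R u" "h = k *\<^sub>R u" "k \<noteq> 0" using s k \<open>h \<noteq> 0\<close> by auto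
    have "((\<lambda>t. c (s + k * t)) has_vector_derivative k *\<^sub>R vector_derivative c (at s)) (at 0)"
      by (rule has_vector_derivative_affine) (use arc_derivative[OF open_UNIV c UNIV_I, of s] in simp)
    moreover have "E (v + t *\<^sub>R h) = c (s + k * t)" for t
      using E[of "s + k * t"] by (simp add: sk scaleR_add_left mult.commute)
    ultimately have "iter_deriv E [h] v = k *\<^sub>R vector_derivative c (at s)"
      by (simp add: vector_derivative_at)
    then show ?thesis using sk(3) arc_norm[OF c, of s] by auto
  qed
  ultimately show ?thesis
    unfolding smooth_parametrization_def H_def[symmetric] U_def[symmetric] E_def[symmetric] by blast
qed

lemma injectivity_ball_arc:
  assumes c: "unit_speed UNIV c" and k: "\<bar>k\<bar> < \<tau> / 2"
  shows "k *\<^sub>R vector_derivative c (at 0) \<in> injectivity_ball M (c 0)"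
proof -
  have "ennreal (\<tau> / 2) \<le> injectivity_radius M (c 0)"
    unfolding injectivity_radius_def
    by (rule Sup_upper) (use smooth_parametrization_exp[OF c] tau_pos in \<open>auto intro!: exI[of _ "\<tau> / 2"]\<close>)
  moreover have "ennreal \<bar>k\<bar> < ennreal (\<tau> / 2)" using k by (simp add: ennreal_less_iff)
  ultimately have "ennreal \<bar>k\<bar> < injectivity_radius M (c 0)" by simp
  then show ?thesis
    using arc_norm[OF c, of 0] tangent_space_arc[OF c, of 0]
    by (auto simp: injectivity_ball_def subspace_ball_def)
qed

text \<open>Maclaurin's formula for f along c, stopped at order k =
  \<open>holder_order \<beta>\<close>: replacing the k-th derivative at the intermediate point by
  its value at 0 costs at most R |t|^(\<beta> - k) by the Hoelder bound.\<close>

lemma holder_taylor: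
  fixes f :: "'a \<Rightarrow> real"
  assumes c: "unit_speed UNIV c" and f: "f \<in> holder_class M \<beta>" "holder_norm M \<beta> f \<le> ennreal R" and R: "0 \<le> R" and \<beta>: "\<beta> > 0"
  shows "\<exists>a. \<forall>t. \<bar>t\<bar> < \<tau> / 2 \<longrightarrow>
    \<bar>f (c t) - (\<Sum>j\<le>holder_order \<beta>. a j * t ^ j)\<bar> \<le> R * \<bar>t\<bar> powr \<beta>"
proof -
  define k where "k = holder_order \<beta>"
  define u where "u = vector_derivative c (at 0)"
  define F where "F = f \<circ> riemannian_exp M (c 0)"
  define D where "D j t = iter_deriv F (replicate j u) (t *\<^sub>R u)" for j t
  define I where "I = {-(\<tau>/2)<..<\<tau>/2}"
  \<comment> \<open>The ceiling of \<beta> - 1 is strictly below \<beta>, also for integer \<beta>,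
    so the Hoelder exponent \<beta> - k is positive.\<close>
  have k: "real k < \<beta>" using \<beta> unfolding k_def holder_order_def by linarith
  have nu: "norm u = 1" using arc_norm[OF c] by (simp add: u_def)
  have uT: "u \<in> tangent_space M (c 0)" 
    using tangent_space_arc[OF c] u_def by (metis rangeI scaleR_one)
  have inI: "t *\<^sub>R u \<in> injectivity_ball M (c 0)" if "t \<in> I" for t
    using injectivity_ball_arc[OF c, of t] that by (auto simp: I_def u_def)
  have M0: "c 0 \<in> M" using arc_in[OF c] by simp
  have D0: "D 0 t = f (c t)" for t using riemannian_exp_arc[OF c] by (simp add: D_def F_def u_def)
  have DD: "(D j has_real_derivative D (Suc j) t) (at t)" if j: "j < k" and t: "t \<in> I" for j t
  proof -
    have "set (replicate j u) \<subseteq> tangent_space M (c 0)" using uT by auto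
    then have "iter_deriv F (replicate j u) differentiable_on injectivity_ball M (c 0)"
      using f(1) M0 j unfolding holder_class_def times_differentiable_on_def k_def F_def by simp
    from iter_deriv_along_line[OF this _ t, of 0 u]
    have "((\<lambda>t. iter_deriv F (replicate j u) (0 + t *\<^sub>R u)) has_vector_derivative
      iter_deriv F (u # replicate j u) (0 + t *\<^sub>R u)) (at t)" using inI by (auto simp: I_def simp del: iter_deriv.simps)
    then show ?thesis
      by (simp add: D_def[abs_def] has_real_derivative_iff_has_vector_derivative del: iter_deriv.simps)
  qed
  have Dk: "\<bar>D k s - D k t\<bar> \<le> R * \<bar>s - t\<bar> powr (\<beta> - k)" if st: "s \<in> I" "t \<in> I" "s \<noteq> t" for s t
  proof -
    have u0: "u \<noteq> 0" using nu by auto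
    have "holder_quotient M \<beta> f (c 0) (s *\<^sub>R u) (t *\<^sub>R u) \<le> holder_norm M \<beta> f"
      unfolding holder_norm_def
      by (rule SUP_upper2[OF M0], rule SUP_upper2[of "(s *\<^sub>R u, t *\<^sub>R u)"]) (use st inI u0 in auto)
    also have "\<dots> \<le> ennreal R" by (rule f(2))
    finally have q: "holder_quotient M \<beta> f (c 0) (s *\<^sub>R u) (t *\<^sub>R u) \<le> ennreal R" .
    have "ennreal \<bar>D k s - D k t\<bar> \<le> multilinear_op_norm (tangent_space M (c 0)) k
        (\<lambda>hs. iter_deriv F hs (s *\<^sub>R u) - iter_deriv F hs (t *\<^sub>R u))"
      unfolding multilinear_op_norm_def
      by (rule SUP_upper2[of "replicate k u"]) (use uT nu in \<open>auto simp: D_def\<close>)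
    then have "ennreal \<bar>D k s - D k t\<bar> / ennreal (norm (s *\<^sub>R u - t *\<^sub>R u) powr (\<beta> - real k)) \<le> ennreal R"
      using q unfolding holder_quotient_def k_def[symmetric] F_def[symmetric]
      by (meson divide_right_mono_ennreal order_trans)
    moreover have "norm (s *\<^sub>R u - t *\<^sub>R u) = \<bar>s - t\<bar>" using nu by (simp add: scaleR_left_diff_distrib[symmetric])
    ultimately have "ennreal (\<bar>D k s - D k t\<bar> / \<bar>s - t\<bar> powr (\<beta> - real k)) \<le> ennreal R"
      using st by (simp add: divide_ennreal)
    then have "\<bar>D k s - D k t\<bar> / \<bar>s - t\<bar> powr (\<beta> - real k) \<le> R" using R by (simp add: ennreal_le_iff)
    then show ?thesis using st by (simp add: divide_le_eq)
  qed
  have "\<bar>f (c t) - (\<Sum>j\<le>k. D j 0 / fact j * t ^ j)\<bar> \<le> R * \<bar>t\<bar> powr \<beta>" if t: "\<bar>t\<bar> < \<tau> / 2" for t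
  proof -
    have "\<exists>s. \<bar>s\<bar> \<le> \<bar>t\<bar> \<and> D 0 t = (\<Sum>m<k. D m 0 / fact m * t ^ m) + D k s / fact k * t ^ k"
    proof (rule Maclaurin_bi_le[of D "D 0"], rule refl, intro allI impI)
      fix m s assume "m < k \<and> \<bar>s\<bar> \<le> \<bar>t\<bar>"
      then show "(D m has_real_derivative D (Suc m) s) (at s)" using t by (intro DD) (auto simp: I_def)
    qed
    then obtain s where s: "\<bar>s\<bar> \<le> \<bar>t\<bar>" "D 0 t = (\<Sum>m<k. D m 0 / fact m * t ^ m) + D k s / fact k * t ^ k" by blast
    have "f (c t) - (\<Sum>j\<le>k. D j 0 / fact j * t ^ j) = (D k s - D k 0) / fact k * t ^ k"
      using s(2) D0 by (simp add: lessThan_Suc_atMost[symmetric] diff_divide_distrib algebra_simps)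
    then have eq: "\<bar>f (c t) - (\<Sum>j\<le>k. D j 0 / fact j * t ^ j)\<bar> = \<bar>D k s - D k 0\<bar> / fact k * \<bar>t\<bar> ^ k"
      by (simp add: abs_mult power_abs)
    show ?thesis
    proof (cases "s = 0 \<or> t = 0")
      \<comment> \<open>Separate because \<open>holder_norm\<close> compares distinct points
        only.\<close>
      case True
      then have "\<bar>D k s - D k 0\<bar> = 0" using s(1) by auto
      then show ?thesis unfolding eq using R by simp
    next
      case False
      have "\<bar>D k s - D k 0\<bar> \<le> R * \<bar>s - 0\<bar> powr (\<beta> - k)"
        by (rule Dk) (use s t False in \<open>auto simp: I_def\<close>)
      also have "\<dots> \<le> R * \<bar>t\<bar> powr (\<beta> - k)"
        using s k R by (intro mult_left_mono powr_mono2) auto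
      finally have 1: "\<bar>D k s - D k 0\<bar> \<le> R * \<bar>t\<bar> powr (\<beta> - k)" .
      have "\<bar>D k s - D k 0\<bar> / fact k \<le> \<bar>D k s - D k 0\<bar> / 1"
        by (intro divide_left_mono) (auto simp: fact_ge_1)
      then have "\<bar>D k s - D k 0\<bar> / fact k * \<bar>t\<bar> ^ k \<le> R * \<bar>t\<bar> powr (\<beta> - k) * \<bar>t\<bar> ^ k"
        using 1 by (intro mult_right_mono) auto
      also have "\<dots> = R * \<bar>t\<bar> powr \<beta>"
        using False by (simp add: powr_realpow[symmetric] powr_add[symmetric] mult.assoc)
      finally show ?thesis unfolding eq .
    qed
  qed
  then show ?thesis unfolding k_def by (intro exI[of _ "\<lambda>j. D j 0 / fact j"]) blast
qed

end

section \<open>Length measure on a curve\<close>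

lemma sets_hausdorff_measure: "sets (hausdorff_measure d :: 'a::metric_space measure) = sets borel"
  using sets.sigma_sets_eq[of "borel :: 'a measure"] by (simp add: hausdorff_measure_def sets_measure_of_conv)

lemma hausdorff_gauge_1: "hausdorff_gauge (Suc 0) S = ennreal (diameter S)"
  by (simp add: hausdorff_gauge_def unit_ball_vol_1)

context closed_curve begin

text \<open>Since c is 1-Lipschitz, cutting the interval into equal pieces no longer than \<delta>
  gives covers whose diameters add up to at most b - a.\<close>

lemma hausdorff_outer_arc_le:
  assumes c: "unit_speed UNIV c" and ab: "a < b"
  shows "hausdorff_outer 1 (c ` {a<..<b}) \<le> ennreal (b - a)"
  unfolding hausdorff_outer_def
proof (rule SUP_least)
  fix \<delta> :: real assume "\<delta> \<in> {0<..}"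
  then have \<delta>: "\<delta> > 0" by simp
  obtain N :: nat where N: "(b - a) / \<delta> < real N" using reals_Archimedean2 by blast
  moreover have "(b - a) / \<delta> > 0" using ab \<delta> by simp
  ultimately have N0: "N > 0" by (metis gr0I of_nat_0 order_less_asym)
  define h where "h = (b - a) / real N"
  have h: "0 < h" "h \<le> \<delta>" using N N0 ab \<delta> by (auto simp: h_def field_simps)
  have Nh: "real N * h = b - a" using N0 by (simp add: h_def)
  define S where "S i = (if i < N then c ` {a + real i * h..a + real (Suc i) * h} else {})" for i
  have dist: "norm (x - y) \<le> h" if "x \<in> S i" "y \<in> S i" for x y i
  proof -
    from that obtain s t where "s \<in> {a + real i * h..a + real (Suc i) * h}" "t \<in> {a + real i * h..a + real (Suc i) * h}"
      "x = c s" "y = c t" by (auto simp: S_def split: if_splits)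
    moreover from this have "\<bar>s - t\<bar> \<le> h" by (auto simp: algebra_simps)
    ultimately show ?thesis
      using arc_lipschitz[OF open_UNIV convex_UNIV c UNIV_I UNIV_I, of s t] by (simp add: dist_norm)
  qed
  have bS: "bounded (S i)" for i
    unfolding bounded_def dist_norm using dist[of _ i] norm_minus_commute by (metis empty_iff equals0I)
  have dS: "diameter (S i) \<le> h" for i
    by (rule diameter_le) (use dist[of _ i] h in auto)
  have "c ` {a<..<b} \<subseteq> (\<Union>i. S i)"
  proof
    fix y assume "y \<in> c ` {a<..<b}"
    then obtain t where t: "a < t" "t < b" "y = c t" by auto
    define i where "i = nat \<lfloor>(t - a) / h\<rfloor>"
    have "0 \<le> (t - a) / h" using t h by simp
    then have i: "real i \<le> (t - a) / h" "(t - a) / h < real i + 1" unfolding i_def by linarith+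
    then have i': "real i * h \<le> t - a" "t - a < (real i + 1) * h" using h by (auto simp: field_simps)
    then have "real i * h < real N * h" using t Nh by linarith
    then have "i < N" using h by simp
    then have "y \<in> S i" using i' t by (auto simp: S_def algebra_simps)
    then show "y \<in> (\<Union>i. S i)" by blast
  qed
  then have "(INF S \<in> {S. c ` {a<..<b} \<subseteq> (\<Union>i. S i) \<and> (\<forall>i. bounded (S i) \<and> diameter (S i) \<le> \<delta>)}.
      \<Sum>i. hausdorff_gauge 1 (S i)) \<le> (\<Sum>i. hausdorff_gauge 1 (S i))"
    using order_trans[OF dS h(2)] bS by (intro INF_lower) auto
  also have "\<dots> = (\<Sum>i<N. hausdorff_gauge 1 (S i))"
    by (rule suminf_finite) (auto simp: hausdorff_gauge_1 S_def)
  also have "\<dots> \<le> (\<Sum>i<N. ennreal h)"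
    by (rule sum_mono) (use dS in \<open>simp add: hausdorff_gauge_1 ennreal_leI\<close>)
  also have "\<dots> = ennreal (real N * h)" using h by (simp add: ennreal_mult ennreal_of_nat_eq_real_of_nat)
  finally show "(INF S \<in> {S. c ` {a<..<b} \<subseteq> (\<Union>i. S i) \<and> (\<forall>i. bounded (S i) \<and> diameter (S i) \<le> \<delta>)}.
      \<Sum>i. hausdorff_gauge 1 (S i)) \<le> ennreal (b - a)" unfolding Nh .
qed

text \<open>Pulled back to parameters, each set of a fine cover has extent at most K times its
  diameter by \<open>arc_le_chord\<close>, so the Lebesgue measure of the interval bounds the sum of
  diameters from below. The factor K tends to 1 with \<delta>.\<close>

lemma hausdorff_outer_arc_ge:
  assumes c: "unit_speed UNIV c" and ab: "a < b" "b - a \<le> \<tau>"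
  shows "ennreal (b - a) \<le> hausdorff_outer 1 (c ` {a<..<b})"
proof -
  define X where "X = hausdorff_outer 1 (c ` {a<..<b})"
  have key: "ennreal (b - a) \<le> ennreal (1 + 4 * \<delta>\<^sup>2 / \<tau>\<^sup>2) * X" if \<delta>: "0 < \<delta>" "\<delta> \<le> \<tau> / 2" for \<delta>
  proof -
    define K where "K = 1 + 4 * \<delta>\<^sup>2 / \<tau>\<^sup>2"
    have K: "K \<ge> 1" by (simp add: K_def)
    have "ennreal (b - a) / ennreal K \<le> (INF S \<in> {S. c ` {a<..<b} \<subseteq> (\<Union>i. S i) \<and>
       (\<forall>i. bounded (S i) \<and> diameter (S i) \<le> \<delta>)}. \<Sum>i. hausdorff_gauge 1 (S i))"
    proof (rule INF_greatest)
      fix S :: "nat \<Rightarrow> 'a set"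
      assume "S \<in> {S. c ` {a<..<b} \<subseteq> (\<Union>i. S i) \<and> (\<forall>i. bounded (S i) \<and> diameter (S i) \<le> \<delta>)}"
      then have S: "c ` {a<..<b} \<subseteq> (\<Union>i. S i)" "\<And>i. bounded (S i)" "\<And>i. diameter (S i) \<le> \<delta>" by auto
      define T where "T i = {t \<in> {a<..<b}. c t \<in> S i}" for i
      \<comment> \<open>The covering sets are arbitrary, so their preimages T i may fail to be
        measurable; the interval hulls are.\<close>
      define J where "J i = (if T i = {} then {} else {Inf (T i)..Sup (T i)})" for i
      have bdd: "bdd_below (T i)" "bdd_above (T i)" for i
        by (auto simp: T_def intro: bdd_belowI[of _ a] bdd_aboveI[of _ b])
      have st: "s - t \<le> K * diameter (S i)" if "s \<in> T i" "t \<in> T i" for s t i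
      proof -
        have D: "dist (c s) (c t) \<le> diameter (S i)"
          by (rule diameter_bounded_bound) (use that S in \<open>auto simp: T_def\<close>)
        then have D2: "dist (c s) (c t) \<le> \<delta>" using S(3)[of i] by linarith
        have "\<bar>s - t\<bar> \<le> (1 + 4 * (dist (c s) (c t))\<^sup>2 / \<tau>\<^sup>2) * dist (c s) (c t)"
          by (rule arc_le_chord[OF open_UNIV convex_UNIV c]) (use that ab D2 \<delta> in \<open>auto simp: T_def\<close>)
        also have "\<dots> \<le> K * diameter (S i)"
        proof (rule mult_mono)
          have "(dist (c s) (c t))\<^sup>2 \<le> \<delta>\<^sup>2" using D2 by (intro power_mono) auto
          then show "1 + 4 * (dist (c s) (c t))\<^sup>2 / \<tau>\<^sup>2 \<le> K"
            unfolding K_def by (intro add_left_mono divide_right_mono) auto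
        qed (use D K in auto)
        finally show ?thesis by simp
      qed
      have eJ: "emeasure lborel (J i) \<le> ennreal K * hausdorff_gauge 1 (S i)" for i
      proof (cases "T i = {}")
        case False
        then obtain t0 where t0: "t0 \<in> T i" by blast
        have "s - K * diameter (S i) \<le> Inf (T i)" if "s \<in> T i" for s
          by (rule cInf_greatest[OF False]) (use st[OF that] in \<open>auto simp: algebra_simps\<close>)
        then have "Sup (T i) \<le> Inf (T i) + K * diameter (S i)"
          by (intro cSup_least[OF False]) (auto simp: algebra_simps)
        moreover have "Inf (T i) \<le> Sup (T i)"
          using cInf_lower[OF t0 bdd(1)] cSup_upper[OF t0 bdd(2)] by linarith
        ultimately have "emeasure lborel (J i) \<le> ennreal (K * diameter (S i))"
          using False by (simp add: J_def ennreal_leI)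
        then show ?thesis using K by (simp add: hausdorff_gauge_1 ennreal_mult')
      qed (simp add: J_def)
      have "{a<..<b} \<subseteq> (\<Union>i. J i)"
      proof
        fix t assume t: "t \<in> {a<..<b}"
        then obtain i where "c t \<in> S i" using S(1) by blast
        then have "t \<in> T i" using t by (simp add: T_def)
        then have "t \<in> J i" using cInf_lower[OF _ bdd(1)] cSup_upper[OF _ bdd(2)] by (auto simp: J_def)
        then show "t \<in> (\<Union>i. J i)" by blast
      qed
      then have "emeasure lborel {a<..<b} \<le> emeasure lborel (\<Union>i. J i)"
        by (intro emeasure_mono) (auto simp: J_def)
      also have "\<dots> \<le> (\<Sum>i. emeasure lborel (J i))"
        by (rule emeasure_subadditive_countably) (auto simp: J_def)
      also have "\<dots> \<le> (\<Sum>i. ennreal K * hausdorff_gauge 1 (S i))"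
        by (intro suminf_le eJ) auto
      also have "\<dots> = ennreal K * (\<Sum>i. hausdorff_gauge 1 (S i))" by (simp add: ennreal_suminf_cmult)
      finally have "ennreal (b - a) \<le> ennreal K * (\<Sum>i. hausdorff_gauge 1 (S i))" using ab by simp
      then show "ennreal (b - a) / ennreal K \<le> (\<Sum>i. hausdorff_gauge 1 (S i))"
        using K by (intro divide_le_posI_ennreal) (auto simp: mult.commute)
    qed
    also have "\<dots> \<le> X"
      unfolding X_def hausdorff_outer_def by (rule SUP_upper) (use \<delta> in simp)
    finally have "ennreal (b - a) / ennreal K * ennreal K \<le> X * ennreal K" by (rule mult_right_mono) simp
    moreover have "ennreal (b - a) / ennreal K * ennreal K = ennreal (b - a)"
      using K ab by (simp add: divide_ennreal ennreal_mult'[symmetric])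
    ultimately show ?thesis unfolding K_def by (simp only: mult.commute)
  qed
  show ?thesis
  proof (cases X)
    case (real x)
    have "b - a \<le> (1 + 4 * 0\<^sup>2 / \<tau>\<^sup>2) * x"
    proof (rule tendsto_lowerbound)
      show "((\<lambda>\<delta>. (1 + 4 * \<delta>\<^sup>2 / \<tau>\<^sup>2) * x) \<longlongrightarrow> (1 + 4 * 0\<^sup>2 / \<tau>\<^sup>2) * x) (at_right 0)"
        using tau_pos by (intro tendsto_intros) auto
      have "b - a \<le> (1 + 4 * \<delta>\<^sup>2 / \<tau>\<^sup>2) * x" if "0 < \<delta>" "\<delta> < \<tau> / 2" for \<delta>
      proof -
        have "0 \<le> 1 + 4 * \<delta>\<^sup>2 / \<tau>\<^sup>2" by simp
        then show ?thesis using key[of \<delta>] that real ab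
          by (simp add: ennreal_mult'[symmetric] del: ennreal_plus)
      qed
      then show "\<forall>\<^sub>F \<delta> in at_right 0. b - a \<le> (1 + 4 * \<delta>\<^sup>2 / \<tau>\<^sup>2) * x"
        unfolding eventually_at_right_field using tau_pos by (intro exI[of _ "\<tau> / 2"]) auto
    qed simp
    then show ?thesis unfolding X_def[symmetric] using real by (simp add: ennreal_leI)
  next
    case top
    then show ?thesis by (simp add: X_def)
  qed
qed

lemma hausdorff_outer_arc:
  assumes "unit_speed UNIV c" "a < b" "b - a \<le> \<tau>"
  shows "hausdorff_outer 1 (c ` {a<..<b}) = ennreal (b - a)"
  using hausdorff_outer_arc_le hausdorff_outer_arc_ge assms by (intro antisym) auto

text \<open>Arc-length coordinate on the arc around \<open>c 0\<close>; the value \<open>\<tau>\<close> marks the points off that arc.\<close>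

definition coord :: "(real \<Rightarrow> 'a) \<Rightarrow> 'a \<Rightarrow> real" where
  "coord c y = (if y \<in> c ` {-(\<tau>/2)<..<\<tau>/2} then the_inv_into {-(\<tau>/2)<..<\<tau>/2} c y else \<tau>)"

lemma coord_arc: "unit_speed UNIV c \<Longrightarrow> \<bar>t\<bar> < \<tau> / 2 \<Longrightarrow> coord c (c t) = t"
proof -
  assume c: "unit_speed UNIV c" and "\<bar>t\<bar> < \<tau> / 2"
  then have t: "t \<in> {-(\<tau>/2)<..<\<tau>/2}" by auto
  then have "c t \<in> c ` {-(\<tau>/2)<..<\<tau>/2}" by (rule imageI)
  then show ?thesis using the_inv_into_f_f[OF arc_inj_on[OF c] t] by (simp only: coord_def if_True)
qed

lemma coord_cases:
  assumes "unit_speed UNIV c"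
  obtains t where "\<bar>t\<bar> < \<tau> / 2" "y = c t" "coord c y = t" | "y \<notin> c ` {-(\<tau>/2)<..<\<tau>/2}" "coord c y = \<tau>"
proof (cases "y \<in> c ` {-(\<tau>/2)<..<\<tau>/2}")
  case True
  then obtain t where "y = c t" "t \<in> {-(\<tau>/2)<..<\<tau>/2}" by (rule imageE)
  moreover from this have "\<bar>t\<bar> < \<tau> / 2" by auto
  ultimately have "\<bar>t\<bar> < \<tau> / 2" "y = c t" by auto
  then show thesis using coord_arc[OF assms] that(1) by blast
next
  case False
  moreover from this have "coord c y = \<tau>" by (simp only: coord_def if_False)
  ultimately show thesis using that(2) by blast
qed

lemma arc_image_borel:
  assumes c: "unit_speed UNIV c"
  shows "c ` {-(\<tau>/2)<..<\<tau>/2} \<in> sets borel"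
proof -
  obtain U where "open U" "c ` {-(\<tau>/2)<..<\<tau>/2} = M \<inter> U"
    using openin_arc_image[OF c] by (auto simp: openin_open)
  moreover from this have "M \<inter> U \<in> sets borel"
    using compact_M by (intro sets.Int borel_open borel_closed compact_imp_closed)
  ultimately show ?thesis by simp
qed

lemma borel_measurable_coord:
  assumes c: "unit_speed UNIV c"
  shows "coord c \<in> borel_measurable borel"
  unfolding coord_def[abs_def]
  by (intro borel_measurable_continuous_on_if arc_image_borel[OF c] continuous_on_arc_inverse[OF c]) auto

lemma borel_measurable_arc: "unit_speed UNIV c \<Longrightarrow> c \<in> borel_measurable borel"
  by (intro borel_measurable_continuous_onI smooth_curve_continuous_on) (auto simp: unit_speed_def)

text \<open>Boxes are stable under intersection and generate the Borel sets, so it is enough that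
  short arcs have their length as outer measure. H is a separate hypothesis because
  \<open>measure_of\<close> reproduces the outer measure only where that is a measure;
  \<open>nn_integral_coord\<close> verifies it.\<close>

lemma distr_coord_hausdorff:
  assumes c: "unit_speed UNIV c"
    and H: "\<And>A. A \<in> sets borel \<Longrightarrow> emeasure (hausdorff_measure 1 :: 'a measure) A = hausdorff_outer 1 A"
  shows "distr (density (hausdorff_measure 1) (indicator (c ` {-(\<tau>/2)<..<\<tau>/2}))) borel (coord c)
    = density lborel (indicator {-(\<tau>/2)<..<\<tau>/2})" (is "?N = ?L")
proof -
  let ?I = "{-(\<tau>/2)<..<\<tau>/2}"
  have sH: "sets (hausdorff_measure 1 :: 'a measure) = sets borel"
    by (rule sets_hausdorff_measure)
  have mc[measurable]: "coord c \<in> borel_measurable (hausdorff_measure 1)"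
    using borel_measurable_coord[OF c] sH by (simp cong: measurable_cong_sets)
  have cI[measurable]: "c ` ?I \<in> sets (hausdorff_measure 1)" using arc_image_borel[OF c] sH by simp
  have *: "emeasure ?N (box a b) = emeasure ?L (box a b)" for a b :: real
  proof -
    have bm: "box a b \<in> sets borel" by simp
    have "emeasure ?N (box a b) = emeasure (hausdorff_measure 1) (c ` ?I \<inter> (coord c -` box a b \<inter> space (hausdorff_measure 1)))"
    proof -
      have "coord c \<in> borel_measurable (density (hausdorff_measure 1) (indicator (c ` ?I)))" using mc by simp
      from emeasure_distr[OF this bm] show ?thesis
        using emeasure_restricted[OF cI measurable_sets[OF mc bm]] by simp
    qed
    also have "c ` ?I \<inter> (coord c -` box a b \<inter> space (hausdorff_measure 1)) = c ` (?I \<inter> box a b)"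
      using coord_arc[OF c] sets_eq_imp_space_eq[OF sH] by auto
    also have "?I \<inter> box a b = {max (-(\<tau>/2)) a<..<min (\<tau>/2) b}" by (auto simp: box_real)
    also have "emeasure (hausdorff_measure 1) (c ` {max (-(\<tau>/2)) a<..<min (\<tau>/2) b}) =
      emeasure lborel {max (-(\<tau>/2)) a<..<min (\<tau>/2) b}"
    proof (cases "max (-(\<tau>/2)) a < min (\<tau>/2) b")
      case True
      have "c ` {max (-(\<tau>/2)) a<..<min (\<tau>/2) b} = c ` ?I \<inter> (coord c -` box a b \<inter> space (hausdorff_measure 1))"
        using coord_arc[OF c] sets_eq_imp_space_eq[OF sH] by (auto simp: box_real)
      also have "\<dots> \<in> sets (hausdorff_measure 1)"
        by (intro sets.Int cI measurable_sets[OF mc bm])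
      finally have "c ` {max (-(\<tau>/2)) a<..<min (\<tau>/2) b} \<in> sets borel" using sH by simp
      then show ?thesis using True H hausdorff_outer_arc[OF c True] by simp
    next
      case False
      then have "{max (-(\<tau>/2)) a<..<min (\<tau>/2) b} = {}" by (simp only: greaterThanLessThan_empty_iff not_less)
      then show ?thesis by (simp only: image_empty emeasure_empty)
    qed
    also have "{max (-(\<tau>/2)) a<..<min (\<tau>/2) b} = ?I \<inter> box a b" by (auto simp: box_real)
    also have "emeasure lborel (?I \<inter> box a b) = emeasure ?L (box a b)"
      by (simp add: emeasure_restricted)
    finally show ?thesis .
  qed
  show ?thesis
  proof (rule measure_eqI_generator_eq[where E = "range (\<lambda>(a, b). box a b)" and \<Omega> = UNIV
        and A = "\<lambda>i. box (- real i) (real i)"])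
    show "Int_stable (range (\<lambda>(a, b). box a b :: real set))"
      by (auto simp: Int_stable_def box_Int_box)
    have "sets (borel :: real measure) = sigma_sets UNIV (range (\<lambda>(a, b). box a b))"
      by (subst borel_eq_box) (simp add: sets_measure_of_conv)
    then show "sets ?N = sigma_sets UNIV (range (\<lambda>(a, b). box a b))"
      "sets ?L = sigma_sets UNIV (range (\<lambda>(a, b). box a b))" by simp_all
    show "(\<Union>i. box (- real i) (real i)) = UNIV"
    proof (intro equalityI subsetI UNIV_I)
      fix x :: real
      obtain n :: nat where "\<bar>x\<bar> < real n" using reals_Archimedean2 by blast
      then have "x \<in> box (- real n) (real n)" by (auto simp: box_real)
      then show "x \<in> (\<Union>i. box (- real i) (real i))" by blast
    qed
    fix i
    have "emeasure ?L (box (- real i) (real i)) \<le> emeasure ?L (space ?L)" by (rule emeasure_space)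
    also have "\<dots> = emeasure lborel ?I" by (simp add: emeasure_density)
    also have "\<dots> < \<infinity>" using tau_pos by simp
    finally show "emeasure ?N (box (- real i) (real i)) \<noteq> \<infinity>" unfolding * by simp
  qed (use * in auto)
qed

text \<open>Expectations of functions of the coordinate become Lebesgue integrals with density f(c
  t). As \<phi> vanishes at the marker value \<tau>, the rest of M contributes nothing.\<close>

lemma nn_integral_coord:
  fixes f :: "'a \<Rightarrow> real" and \<phi> :: "real \<Rightarrow> ennreal"
  assumes c: "unit_speed UNIV c" and f: "f \<in> borel_measurable borel"
    and P: "prob_space P" "P = density (volume_measure 1 M) (\<lambda>y. ennreal (f y))"
    and \<phi>: "\<phi> \<in> borel_measurable borel" "\<And>t. \<tau> / 2 \<le> \<bar>t\<bar> \<Longrightarrow> \<phi> t = 0"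
  shows "(\<integral>\<^sup>+y. \<phi> (coord c y) \<partial>P) = (\<integral>\<^sup>+t. \<phi> t * ennreal (f (c t)) \<partial>lborel)"
proof -
  let ?I = "{-(\<tau>/2)<..<\<tau>/2}"
  let ?H = "hausdorff_measure 1 :: 'a measure"
  have sH: "sets ?H = sets borel"
    by (rule sets_hausdorff_measure)
  \<comment> \<open>Were the outer measure not additive on Borel sets, \<open>measure_of\<close> would be the zero measure, and so
    would \<open>P\<close>.\<close>
  have H: "emeasure ?H A = hausdorff_outer 1 A" if A: "A \<in> sets borel" for A
  proof (cases "measure_space UNIV (sigma_sets UNIV (sets (borel :: 'a measure))) (hausdorff_outer 1)")
    case True
    then show ?thesis
      using A sets.sigma_sets_eq[of "borel :: 'a measure"] by (simp add: hausdorff_measure_def emeasure_measure_of_conv)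
  next
    case False
    then have 0: "emeasure ?H A = 0" for A by (simp add: hausdorff_measure_def emeasure_measure_of_conv)
    have Mb: "M \<in> sets ?H" using compact_M sH by (simp add: borel_closed compact_imp_closed)
    have "AE x in ?H. False" using 0[of "space ?H"] by (intro AE_I[of _ _ "space ?H"]) auto
    then have "AE x in P. False"
      unfolding P(2) volume_measure_def using f sH Mb
      by (subst AE_density) (auto simp: AE_density cong: measurable_cong_sets)
    then show ?thesis using prob_space.ae_filter_bot[OF P(1)] by (simp add: trivial_limit_def)
  qed
  have mb: "g \<in> borel_measurable borel \<Longrightarrow> g \<in> borel_measurable ?H" for g :: "'a \<Rightarrow> 'b::topological_space"
    using sH by (simp cong: measurable_cong_sets)
  have Mb: "M \<in> sets borel" using compact_M by (simp add: borel_closed compact_imp_closed)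
  note coordm = borel_measurable_coord[OF c]
  have fc: "(\<lambda>t. f (c t)) \<in> borel_measurable borel"
    using measurable_compose[OF borel_measurable_arc[OF c] f] .
  have "(\<integral>\<^sup>+y. \<phi> (coord c y) \<partial>P) = (\<integral>\<^sup>+y. indicator M y * (ennreal (f y) * \<phi> (coord c y)) \<partial>?H)"
  proof -
    have m1: "(\<lambda>y. \<phi> (coord c y)) \<in> borel_measurable borel" by (rule measurable_compose[OF coordm \<phi>(1)])
    have m2: "indicator M \<in> borel_measurable ?H" by (rule mb) (use Mb in simp)
    have m3: "(\<lambda>y. ennreal (f y)) \<in> borel_measurable borel" using f by measurable
    show ?thesis unfolding P(2) volume_measure_def
      by (subst nn_integral_density, (use m1 m2 m3 mb in \<open>auto cong: measurable_cong_sets simp: sH\<close>)[2])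
        (subst nn_integral_density, use m2 mb[OF borel_measurable_times_ennreal[OF m3 m1]] in auto)
  qed
  \<comment> \<open>On the arc y = c (coord c y), which makes the integrand a function of the
    coordinate and permits passing to the image measure.\<close>
  also have "\<dots> = (\<integral>\<^sup>+y. indicator (c ` ?I) y * (ennreal (f (c (coord c y))) * \<phi> (coord c y)) \<partial>?H)"
  proof (rule nn_integral_cong)
    fix y
    show "indicator M y * (ennreal (f y) * \<phi> (coord c y)) =
        indicator (c ` ?I) y * (ennreal (f (c (coord c y))) * \<phi> (coord c y))"
    proof (cases rule: coord_cases[OF c, of y])
      case (1 t)
      then have "t \<in> ?I" by auto
      then have "y \<in> c ` ?I" unfolding 1(2) by (rule imageI)
      then show ?thesis using 1 arc_in[OF c] by (simp add: indicator_def)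
    next
      case 2
      then show ?thesis using \<phi>(2)[of \<tau>] tau_pos by simp
    qed
  qed
  also have "\<dots> = (\<integral>\<^sup>+y. ennreal (f (c (coord c y))) * \<phi> (coord c y) \<partial>density ?H (indicator (c ` ?I)))"
  proof (rule nn_integral_density[symmetric])
    show "indicator (c ` ?I) \<in> borel_measurable ?H" by (rule mb) (use arc_image_borel[OF c] in simp)
    show "(\<lambda>y. ennreal (f (c (coord c y))) * \<phi> (coord c y)) \<in> borel_measurable ?H"
      by (rule mb) (use measurable_compose[OF coordm fc] measurable_compose[OF coordm \<phi>(1)] in measurable)
  qed
  also have "\<dots> = (\<integral>\<^sup>+t. ennreal (f (c t)) * \<phi> t \<partial>distr (density ?H (indicator (c ` ?I))) borel (coord c))"
    by (rule nn_integral_distr[symmetric]) (use mb[OF coordm] fc \<phi>(1) in \<open>auto\<close>)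
  also have "\<dots> = (\<integral>\<^sup>+t. indicator ?I t * (ennreal (f (c t)) * \<phi> t) \<partial>lborel)"
  proof -
    have eq: "distr (density ?H (indicator (c ` ?I))) borel (coord c) = density lborel (indicator ?I)"
      by (rule distr_coord_hausdorff[OF c H])
    show ?thesis unfolding eq by (rule nn_integral_density) (use fc \<phi>(1) in auto)
  qed
  also have "\<dots> = (\<integral>\<^sup>+t. \<phi> t * ennreal (f (c t)) \<partial>lborel)"
  proof (rule nn_integral_cong)
    fix t show "indicator ?I t * (ennreal (f (c t)) * \<phi> t) = \<phi> t * ennreal (f (c t))"
      using \<phi>(2)[of t] by (cases "t \<in> ?I") (auto simp: mult.commute)
  qed
  finally show ?thesis .
qed

end

section \<open>Kernels of high order and exponential moments\<close>

text \<open>Richardson extrapolation: each step cancels the next even moment of the kernel.\<close>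

primrec kern :: "nat \<Rightarrow> real \<Rightarrow> real" where
  "kern 0 t = 3 / 4 * max 0 (1 - t\<^sup>2)"
| "kern (Suc m) t = (4 ^ Suc m * kern m t - kern m (t / 2) / 2) / (4 ^ Suc m - 1)"

lemma kern_minus: "kern m (- t) = kern m t"
  by (induction m arbitrary: t) auto

lemma kern_abs: "kern m \<bar>t\<bar> = kern m t"
  by (simp add: abs_if kern_minus)

text \<open>The dilated copy in the recursion doubles the support at each step.\<close>

lemma kern_eq_0: "2 ^ m \<le> \<bar>t\<bar> \<Longrightarrow> kern m t = 0"
proof (induction m arbitrary: t)
  case 0
  then have "1 \<le> t\<^sup>2" using abs_le_square_iff[of 1 t] by simp
  then show ?case by simp
next
  case (Suc m)
  have "(1::real) \<le> 2 ^ m" by simp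
  then have "2 ^ m \<le> \<bar>t\<bar>" "2 ^ m \<le> \<bar>t / 2\<bar>" using Suc.prems by auto
  then show ?case using Suc.IH[of t] Suc.IH[of "t / 2"] by simp
qed

lemma kern_lipschitz: "\<exists>\<Lambda>\<ge>0. \<forall>s t. \<bar>kern m s - kern m t\<bar> \<le> \<Lambda> * \<bar>s - t\<bar>"
proof (induction m)
  case 0
  have *: "\<bar>max 0 (1 - s\<^sup>2) - max 0 (1 - t\<^sup>2)\<bar> \<le> 2 * \<bar>s - t\<bar>" if le: "\<bar>s\<bar> \<le> \<bar>t\<bar>" for s t :: real
  proof (cases "\<bar>s\<bar> \<le> 1")
    case True
    \<comment> \<open>Clipping |t| at 1 does not change the truncated parabola. Both values are then
      1 minus the square of a number in [0, 1], and the sum of these numbers is at most 2.\<close>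
    define t' where "t' = min 1 \<bar>t\<bar>"
    have t': "\<bar>s\<bar> \<le> t'" "t' \<le> 1" "t' \<le> \<bar>t\<bar>" "0 \<le> t'" using le True by (auto simp: t'_def)
    have "max 0 (1 - t\<^sup>2) = 1 - t'\<^sup>2"
      using abs_le_square_iff[of 1 t] abs_le_square_iff[of t 1] by (auto simp: t'_def min_def max_def)
    moreover have "s\<^sup>2 \<le> 1" using True abs_le_square_iff[of s 1] by simp
    ultimately have "\<bar>max 0 (1 - s\<^sup>2) - max 0 (1 - t\<^sup>2)\<bar> = \<bar>t'\<^sup>2 - \<bar>s\<bar>\<^sup>2\<bar>" by simp
    also have "\<dots> = \<bar>(t' - \<bar>s\<bar>) * (t' + \<bar>s\<bar>)\<bar>" by (simp only: power2_eq_square square_diff_square_factored mult.commute)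
    also have "\<dots> = (t' - \<bar>s\<bar>) * (t' + \<bar>s\<bar>)" using t' by (intro abs_of_nonneg mult_nonneg_nonneg) auto
    also have "\<dots> \<le> (t' - \<bar>s\<bar>) * 2" using t' by (intro mult_left_mono) auto
    also have "\<dots> \<le> 2 * \<bar>s - t\<bar>"
    proof -
      have "t' - \<bar>s\<bar> \<le> \<bar>t\<bar> - \<bar>s\<bar>" using t'(3) by (rule diff_right_mono)
      also have "\<dots> \<le> \<bar>s - t\<bar>" using abs_triangle_ineq2[of t s] by (simp only: abs_minus_commute)
      finally show ?thesis by simp
    qed
    finally show ?thesis .
  next
    case False
    then have "1 \<le> s\<^sup>2" "1 \<le> t\<^sup>2" using le abs_le_square_iff[of 1 s] abs_le_square_iff[of 1 t] by auto
    then show ?thesis by simp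
  qed
  have k: "\<bar>max 0 (1 - s\<^sup>2) - max 0 (1 - t\<^sup>2)\<bar> \<le> 2 * \<bar>s - t\<bar>" for s t :: real
    using *[of s t] *[of t s] by (cases "\<bar>s\<bar> \<le> \<bar>t\<bar>") (auto simp: abs_minus_commute)
  have "\<bar>kern 0 s - kern 0 t\<bar> \<le> 2 * \<bar>s - t\<bar>" for s t
  proof -
    have "\<bar>kern 0 s - kern 0 t\<bar> = 3 / 4 * \<bar>max 0 (1 - s\<^sup>2) - max 0 (1 - t\<^sup>2)\<bar>"
      unfolding kern.simps right_diff_distrib[symmetric] abs_mult by simp
    also have "\<dots> \<le> 1 * \<bar>max 0 (1 - s\<^sup>2) - max 0 (1 - t\<^sup>2)\<bar>" by (intro mult_right_mono) auto
    finally show ?thesis using k[of s t] by simp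
  qed
  then show ?case by (intro exI[of _ 2]) auto
next
  case (Suc m)
  then obtain \<Lambda> where L: "\<Lambda> \<ge> 0" "\<And>s t. \<bar>kern m s - kern m t\<bar> \<le> \<Lambda> * \<bar>s - t\<bar>" by blast
  define D where "D = (4::real) ^ Suc m"
  have "1 * 1 < (4::real) * 4 ^ m" by (rule mult_less_le_imp_less) auto
  then have D: "D > 1" by (simp add: D_def)
  have "\<bar>kern (Suc m) s - kern (Suc m) t\<bar> \<le> ((D * \<Lambda> + \<Lambda>) / (D - 1)) * \<bar>s - t\<bar>" for s t
  proof -
    have "kern (Suc m) s - kern (Suc m) t = (D * (kern m s - kern m t) - (kern m (s/2) - kern m (t/2)) / 2) / (D - 1)"
      by (simp add: D_def[symmetric] diff_divide_distrib[symmetric] algebra_simps del: power_Suc)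
    then have "\<bar>kern (Suc m) s - kern (Suc m) t\<bar>
        = \<bar>D * (kern m s - kern m t) - (kern m (s/2) - kern m (t/2)) / 2\<bar> / (D - 1)" using D by simp
    also have "\<dots> \<le> (D * (\<Lambda> * \<bar>s - t\<bar>) + \<Lambda> * \<bar>s - t\<bar>) / (D - 1)"
    proof (rule divide_right_mono)
      have 1: "\<bar>D * (kern m s - kern m t)\<bar> \<le> D * (\<Lambda> * \<bar>s - t\<bar>)"
        using L(2)[of s t] D by (simp add: abs_mult)
      have "\<bar>kern m (s/2) - kern m (t/2)\<bar> \<le> \<Lambda> * \<bar>s/2 - t/2\<bar>" by (rule L(2))
      also have "\<dots> \<le> \<Lambda> * \<bar>s - t\<bar>" using L(1) by (intro mult_left_mono) auto
      finally have "\<bar>(kern m (s/2) - kern m (t/2)) / 2\<bar> \<le> \<Lambda> * \<bar>s - t\<bar>" by simp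
      then show "\<bar>D * (kern m s - kern m t) - (kern m (s/2) - kern m (t/2)) / 2\<bar> \<le> D * (\<Lambda> * \<bar>s - t\<bar>) + \<Lambda> * \<bar>s - t\<bar>"
        by (rule order_trans[OF abs_triangle_ineq4 add_mono[OF 1]])
    qed (use D in simp)
    also have "\<dots> = ((D * \<Lambda> + \<Lambda>) / (D - 1)) * \<bar>s - t\<bar>" by (simp add: algebra_simps)
    finally show ?thesis .
  qed
  then show ?case using L(1) D by (intro exI[of _ "(D * \<Lambda> + \<Lambda>) / (D - 1)"]) auto
qed

lemma continuous_on_kern: "continuous_on S (kern m)"
proof -
  obtain \<Lambda> where "\<Lambda> \<ge> 0" "\<And>s t. \<bar>kern m s - kern m t\<bar> \<le> \<Lambda> * \<bar>s - t\<bar>" using kern_lipschitz by blast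
  then have "\<Lambda>-lipschitz_on S (kern m)" by (intro lipschitz_onI) (auto simp: dist_real_def)
  then show ?thesis by (rule lipschitz_on_continuous_on)
qed

lemma borel_measurable_kern[measurable]: "kern m \<in> borel_measurable borel"
  by (rule borel_measurable_continuous_onI[OF continuous_on_kern])

lemma kern_bounded: "\<exists>B>0. \<forall>t. \<bar>kern m t\<bar> \<le> B"
proof -
  obtain \<Lambda> where L: "\<Lambda> \<ge> 0" "\<And>s t. \<bar>kern m s - kern m t\<bar> \<le> \<Lambda> * \<bar>s - t\<bar>" using kern_lipschitz by blast
  have "\<bar>kern m t\<bar> \<le> \<Lambda> * (2 * 2 ^ m) + 1" for t
  proof (cases "2 ^ m \<le> \<bar>t\<bar>")
    case True then show ?thesis using L(1) by (simp add: kern_eq_0)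
  next
    case False
    have "kern m (2 ^ m) = 0" by (rule kern_eq_0) simp
    then have "\<bar>kern m t\<bar> \<le> \<Lambda> * \<bar>t - 2 ^ m\<bar>" using L(2)[of t "2 ^ m"] by simp
    also have "\<dots> \<le> \<Lambda> * (2 * 2 ^ m)" using False L(1) by (intro mult_left_mono) auto
    finally show ?thesis by simp
  qed
  moreover have "\<Lambda> * (2 * 2 ^ m) + 1 > 0" using L(1) by (simp add: add_nonneg_pos)
  ultimately show ?thesis by blast
qed

lemma integrable_kern_mult:
  assumes "continuous_on UNIV p"
  shows "integrable lborel (\<lambda>t. p t * kern m t)"
proof -
  have "integrable lborel (\<lambda>t. indicator {- (2 ^ m)..2 ^ m} t *\<^sub>R (p t * kern m t))"
    by (intro borel_integrable_compact continuous_intros continuous_on_kern continuous_on_subset[OF assms]) auto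
  moreover have "(\<lambda>t. indicator {- (2 ^ m)..2 ^ m} t *\<^sub>R (p t * kern m t)) = (\<lambda>t. p t * kern m t)"
  proof
    fix t
    show "indicator {- (2 ^ m)..2 ^ m} t *\<^sub>R (p t * kern m t) = p t * kern m t"
      using kern_eq_0[of m t] by (cases "\<bar>t\<bar> \<le> 2 ^ m") (auto simp: indicator_def abs_if split: if_splits)
  qed
  ultimately show ?thesis by simp
qed

text \<open>Odd moments vanish by symmetry. A step multiplies the j-th moment by (4^(m+1) -
  2^j)/(4^(m+1) - 1), which is 1 for j = 0 and 0 for j = 2m + 2.\<close>

lemma kern_moment:
  assumes "j \<le> 2 * m + 1"
  shows "(\<integral>t. t ^ j * kern m t \<partial>lborel) = (if j = 0 then 1 else 0)"
proof -
  have odd0: "(\<integral>t. t ^ j * kern m t \<partial>lborel) = 0" if "odd j" for j m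
  proof -
    have "(\<integral>t. t ^ j * kern m t \<partial>lborel) = \<bar>-1\<bar> *\<^sub>R (\<integral>t. (0 + -1 * t) ^ j * kern m (0 + -1 * t) \<partial>lborel)"
      by (rule lborel_integral_real_affine) simp
    also have "\<dots> = - (\<integral>t. t ^ j * kern m t \<partial>lborel)" using that by (simp add: kern_minus)
    finally show ?thesis by simp
  qed
  show ?thesis using assms
  proof (induction m arbitrary: j)
    case 0
    then consider "j = 0" | "j = 1" by linarith
    then show ?case
    proof cases
      case 1
      have "has_bochner_integral lborel (\<lambda>t::real. (3 / 4 * (1 - t\<^sup>2)) * indicator {-1..1} t)
        ((3 / 4 * (1 - 1 ^ 3 / 3)) - (3 / 4 * (-1 - (-1) ^ 3 / 3)))"
        by (rule has_bochner_integral_FTC_Icc_real) (auto intro!: derivative_eq_intros continuous_intros simp: power2_eq_square)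
      moreover have "(\<lambda>t. (3 / 4 * (1 - t\<^sup>2)) * indicator {-1..1} t) = kern 0"
      proof
        fix t :: real
        show "(3 / 4 * (1 - t\<^sup>2)) * indicator {-1..1} t = kern 0 t"
          using abs_le_square_iff[of t 1] by (auto simp: indicator_def max_def abs_le_iff)
      qed
      ultimately have "has_bochner_integral lborel (kern 0) ((3 / 4 * (1 - 1 ^ 3 / 3)) - (3 / 4 * (-1 - (-1) ^ 3 / 3)))"
        by (simp only:)
      from has_bochner_integral_integral_eq[OF this] show ?thesis using 1 by (simp del: kern.simps)
    next
      case 2
      then show ?thesis using odd0[of 1 0] by (simp del: kern.simps)
    qed
  next
    case (Suc m)
    define D where "D = (4::real) ^ Suc m"
    have "1 * 1 < (4::real) * 4 ^ m" by (rule mult_less_le_imp_less) auto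
    then have D: "D > 1" by (simp add: D_def)
    have i1: "integrable lborel (\<lambda>t. t ^ j * kern m t)"
      by (rule integrable_kern_mult) (intro continuous_intros)
    have i2': "integrable lborel (\<lambda>s. (0 + 2 * s) ^ j * kern m ((0 + 2 * s) / 2) / 2)"
      using integrable_kern_mult[of "\<lambda>s. (2 * s) ^ j / 2" m] by (simp add: continuous_intros)
    then have i2: "integrable lborel (\<lambda>t. t ^ j * kern m (t / 2) / 2)"
      using lborel_integrable_real_affine_iff[of 2 "\<lambda>t. t ^ j * kern m (t / 2) / 2" 0] by simp
    have "(\<integral>t. t ^ j * kern m (t / 2) / 2 \<partial>lborel) = \<bar>2\<bar> *\<^sub>R (\<integral>t. (0 + 2 * t) ^ j * kern m ((0 + 2 * t) / 2) / 2 \<partial>lborel)"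
      by (rule lborel_integral_real_affine) simp
    also have "\<dots> = 2 ^ j * (\<integral>t. t ^ j * kern m t \<partial>lborel)"
      by (simp add: power_mult_distrib mult.assoc)
    finally have e2: "(\<integral>t. t ^ j * kern m (t / 2) / 2 \<partial>lborel) = 2 ^ j * (\<integral>t. t ^ j * kern m t \<partial>lborel)" .
    have "(\<integral>t. t ^ j * kern (Suc m) t \<partial>lborel)
        = (\<integral>t. (D * (t ^ j * kern m t) - t ^ j * kern m (t / 2) / 2) / (D - 1) \<partial>lborel)"
      by (intro Bochner_Integration.integral_cong) (auto simp: D_def[symmetric] algebra_simps simp del: power_Suc)
    also have "\<dots> = (D * (\<integral>t. t ^ j * kern m t \<partial>lborel) - 2 ^ j * (\<integral>t. t ^ j * kern m t \<partial>lborel)) / (D - 1)"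
      unfolding integral_divide_zero
      by (subst Bochner_Integration.integral_diff[OF integrable_mult_right[OF i1] i2])
        (simp only: integral_mult_right_zero e2)
    also have "\<dots> = (D - 2 ^ j) / (D - 1) * (\<integral>t. t ^ j * kern m t \<partial>lborel)"
      by (simp add: algebra_simps)
    finally have rec: "(\<integral>t. t ^ j * kern (Suc m) t \<partial>lborel) = (D - 2 ^ j) / (D - 1) * (\<integral>t. t ^ j * kern m t \<partial>lborel)" .
    have "j \<le> 2 * m + 1 \<or> j = 2 * m + 2 \<or> j = 2 * m + 3" using Suc.prems by simp linarith
    then consider "j \<le> 2 * m + 1" | "j = 2 * m + 2" | "odd j" by fastforce
    then show ?case
    proof cases
      case 1
      then show ?thesis using rec Suc.IH[OF 1] D by auto
    next
      case 2
      then have "(2::real) ^ j = D" by (simp add: D_def power_add power_mult)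
      then show ?thesis using rec 2 by simp
    next
      case 3
      then have "j \<noteq> 0" by (cases j) auto
      then show ?thesis using odd0[OF 3, of "Suc m"] by simp
    qed
  qed
qed

text \<open>After the substitution t = h s only the constant term of the polynomial survives, by the
  moments of the kernel. The remainder is integrated over the support of half-width A = 2^m h, whose
  length supplies one more power of h.\<close>

lemma kernel_bias:
  fixes g :: "real \<Rightarrow> real"
  assumes h: "0 < h" and \<beta>: "0 < \<beta>" and R: "0 \<le> R" and B: "\<And>t. \<bar>kern m t\<bar> \<le> B"
    and g: "\<And>t. \<bar>t\<bar> \<le> 2 ^ m * h \<Longrightarrow> \<bar>g t - (\<Sum>j\<le>m. a j * t ^ j)\<bar> \<le> R * \<bar>t\<bar> powr \<beta>"
    and int: "integrable lborel (\<lambda>t. kern m (t / h) * g t)"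
  shows "\<bar>(\<integral>t. kern m (t / h) * g t \<partial>lborel) - h * g 0\<bar>
    \<le> 2 * B * R * (2 ^ m) powr (\<beta> + 1) * h powr (\<beta> + 1)"
proof -
  define A where "A = (2::real) ^ m * h"
  have A: "A > 0" using h by (simp add: A_def)
  \<comment> \<open>At t = 0 the right-hand side of the approximation bound is 0, because 0 powr
    \<beta> = 0.\<close>
  have a0: "a 0 = g 0" using g[of 0] h by (simp add: sum.atMost_shift)
  define p where "p t = (\<Sum>j\<le>m. a j * t ^ j)" for t
  have "integrable lborel (\<lambda>s. p (0 + h * s) * kern m s)"
    unfolding p_def by (rule integrable_kern_mult) (intro continuous_intros)
  then have ip: "integrable lborel (\<lambda>t. kern m (t / h) * p t)"
    using lborel_integrable_real_affine_iff[of h "\<lambda>t. kern m (t / h) * p t" 0] h by (simp add: mult.commute)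
  have "(\<integral>t. kern m (t / h) * p t \<partial>lborel) = \<bar>h\<bar> *\<^sub>R (\<integral>t. kern m ((0 + h * t) / h) * p (0 + h * t) \<partial>lborel)"
    by (rule lborel_integral_real_affine) (use h in simp)
  also have "\<dots> = h * (\<integral>t. (\<Sum>j\<le>m. (a j * h ^ j) * (t ^ j * kern m t)) \<partial>lborel)"
    using h by (simp add: p_def sum_distrib_left power_mult_distrib mult_ac)
  also have "(\<integral>t. (\<Sum>j\<le>m. (a j * h ^ j) * (t ^ j * kern m t)) \<partial>lborel)
      = (\<Sum>j\<le>m. (a j * h ^ j) * (\<integral>t. t ^ j * kern m t \<partial>lborel))"
    by (subst Bochner_Integration.integral_sum)
      (auto intro!: integrable_mult_right integrable_kern_mult continuous_intros)
  also have "\<dots> = (\<Sum>j\<le>m. if j = 0 then a 0 else 0)"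
    by (intro sum.cong refl) (use kern_moment in auto)
  also have "\<dots> = a 0" by simp
  finally have main: "(\<integral>t. kern m (t / h) * p t \<partial>lborel) = h * g 0" using a0 by simp
  have "\<bar>(\<integral>t. kern m (t / h) * g t \<partial>lborel) - h * g 0\<bar> = \<bar>\<integral>t. kern m (t / h) * g t - kern m (t / h) * p t \<partial>lborel\<bar>"
    unfolding main[symmetric] using int ip by simp
  also have "\<dots> \<le> (\<integral>t. B * R * A powr \<beta> * indicator {-A..A} t \<partial>lborel)"
  proof (rule order_trans[OF integral_abs_bound integral_mono])
    show "integrable lborel (\<lambda>t. \<bar>kern m (t / h) * g t - kern m (t / h) * p t\<bar>)" using int ip by simp
    show "integrable lborel (\<lambda>t. B * R * A powr \<beta> * indicator {-A..A} t)"
      using A by (intro integrable_mult_right integrable_real_indicator) auto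
    fix t
    show "\<bar>kern m (t / h) * g t - kern m (t / h) * p t\<bar> \<le> B * R * A powr \<beta> * indicator {-A..A} t"
    proof (cases "\<bar>t\<bar> \<le> A")
      case True
      have "\<bar>g t - p t\<bar> \<le> R * \<bar>t\<bar> powr \<beta>" unfolding p_def by (rule g) (use True in \<open>simp add: A_def\<close>)
      also have "\<dots> \<le> R * A powr \<beta>" using True R \<beta> by (intro mult_left_mono powr_mono2) auto
      finally have "\<bar>kern m (t / h)\<bar> * \<bar>g t - p t\<bar> \<le> B * (R * A powr \<beta>)"
        using B[of "t / h"] by (intro mult_mono) auto
      then show ?thesis using True by (simp add: right_diff_distrib[symmetric] abs_mult indicator_def abs_le_iff mult.assoc)
    next
      case False
      then have "kern m (t / h) = 0" using h by (intro kern_eq_0) (simp add: A_def field_simps)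
      then show ?thesis using False by (auto simp: indicator_def)
    qed
  qed
  also have "\<dots> = B * R * A powr \<beta> * (2 * A)" using A by simp
  also have "\<dots> = 2 * B * R * A powr (\<beta> + 1)" using A by (simp add: powr_add)
  also have "A powr (\<beta> + 1) = (2 ^ m) powr (\<beta> + 1) * h powr (\<beta> + 1)" using h by (simp add: A_def powr_mult)
  finally show ?thesis by (simp add: mult.assoc)
qed

section \<open>Exponential moments of centred sums\<close>

lemma exp_le_quadratic:
  fixes x :: real
  assumes "\<bar>x\<bar> \<le> 1"
  shows "exp x \<le> 1 + x + x\<^sup>2"
proof (cases "0 \<le> x")
  case True then show ?thesis using assms by (intro exp_bound) auto
next
  case False
  have "exp x = 1 / exp (- x)" by (simp add: exp_minus field_simps)
  also have "\<dots> \<le> 1 / (1 - x)" using False exp_ge_add_one_self[of "- x"] by (intro divide_left_mono) auto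
  also have "\<dots> \<le> 1 + x + x\<^sup>2"
  proof -
    have "(1 + x + x\<^sup>2) * (1 - x) = 1 - x ^ 3" by (simp add: power2_eq_square power3_eq_cube algebra_simps)
    moreover have "x ^ 3 \<le> 0" using False by (simp add: power3_eq_cube mult_nonneg_nonpos2 mult_nonneg_nonpos mult_nonpos_nonpos)
    ultimately show ?thesis using False by (simp add: divide_le_eq)
  qed
  finally show ?thesis .
qed

text \<open>It lets exponential moments serve for the p-th moment, whatever p is. The source is y
  \<le> exp y at y = x/p, raised to the power p.\<close>

lemma powr_le_exp:
  fixes x :: real
  assumes "0 \<le> x" "0 < p"
  shows "x powr p \<le> p powr p * exp x"
proof -
  have "x / p \<le> exp (x / p)" using exp_ge_add_one_self[of "x / p"] by linarith
  then have "(x / p) powr p \<le> exp (x / p) powr p" using assms by (intro powr_mono2) auto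
  also have "\<dots> = exp x" using assms by (simp add: exp_powr_real)
  finally have "(x / p) powr p \<le> exp x" .
  then show ?thesis using assms by (simp add: powr_divide field_simps)
qed

text \<open>A Bernstein bound: in exp x \<le> 1 + x + x^2 on [-1, 1] centring removes the linear
  term, and independence turns the integral into an n-th power. The sign of l is left free so that
  both tails of the sum are controlled.\<close>

lemma exp_moment_bound:
  fixes \<phi> :: "'a \<Rightarrow> real"
  assumes P: "prob_space P" and \<phi>: "\<phi> \<in> borel_measurable P" "\<And>y. \<bar>\<phi> y\<bar> \<le> B"
    and V: "(\<integral>y. (\<phi> y)\<^sup>2 \<partial>P) \<le> V" and l: "2 * B * \<bar>l\<bar> \<le> 1"
  defines "\<mu> \<equiv> (\<integral>y. \<phi> y \<partial>P)"
  shows "integrable (PiM {..<n} (\<lambda>_. P)) (\<lambda>X. exp (l * (\<Sum>i<n. \<phi> (X i) - \<mu>)))"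
    and "(\<integral>X. exp (l * (\<Sum>i<n. \<phi> (X i) - \<mu>)) \<partial>PiM {..<n} (\<lambda>_. P)) \<le> exp (real n * (l\<^sup>2 * V))"
proof -
  interpret prob_space P by (rule P)
  interpret PP: product_sigma_finite "\<lambda>_::nat. P" by standard
  note [measurable] = \<phi>(1)
  have i: "integrable P \<phi>" using \<phi> by (intro integrable_const_bound[where B = B]) auto
  have B0: "0 \<le> B" using \<phi>(2) abs_ge_zero order_trans by blast
  have "(\<phi> y)\<^sup>2 \<le> B\<^sup>2" for y using \<phi>(2)[of y] B0 abs_le_square_iff[of "\<phi> y" B] by simp
  then have i2: "integrable P (\<lambda>y. (\<phi> y)\<^sup>2)" by (intro integrable_const_bound[where B = "B\<^sup>2"]) auto
  have "\<bar>\<mu>\<bar> \<le> (\<integral>y. \<bar>\<phi> y\<bar> \<partial>P)" unfolding \<mu>_def by (rule integral_abs_bound)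
  also have "\<dots> \<le> (\<integral>y. B \<partial>P)" using i \<phi>(2) by (intro integral_mono) auto
  finally have \<mu>: "\<bar>\<mu>\<bar> \<le> B" by (simp add: prob_space)
  have small: "\<bar>l * (\<phi> y - \<mu>)\<bar> \<le> 1" for y
  proof -
    have "\<bar>\<phi> y - \<mu>\<bar> \<le> 2 * B" using \<phi>(2)[of y] \<mu> by linarith
    then have "\<bar>l\<bar> * \<bar>\<phi> y - \<mu>\<bar> \<le> \<bar>l\<bar> * (2 * B)" by (intro mult_left_mono) auto
    then show ?thesis using l by (simp add: abs_mult mult_ac)
  qed
  define E where "E y = exp (l * (\<phi> y - \<mu>))" for y
  have iE: "integrable P E"
  proof (intro integrable_const_bound[where B = "exp 1"] AE_I2)
    fix y show "norm (E y) \<le> exp 1" using small[of y] by (simp add: E_def)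
    show "E \<in> borel_measurable P" unfolding E_def[abs_def] by measurable
  qed
  have "(\<integral>y. E y \<partial>P) \<le> (\<integral>y. (1 - l * \<mu> + l\<^sup>2 * \<mu>\<^sup>2) + (l - 2 * l\<^sup>2 * \<mu>) * \<phi> y + l\<^sup>2 * (\<phi> y)\<^sup>2 \<partial>P)"
  proof (rule integral_mono[OF iE])
    fix y
    have "E y \<le> 1 + l * (\<phi> y - \<mu>) + (l * (\<phi> y - \<mu>))\<^sup>2" unfolding E_def by (rule exp_le_quadratic[OF small])
    also have "\<dots> = (1 - l * \<mu> + l\<^sup>2 * \<mu>\<^sup>2) + (l - 2 * l\<^sup>2 * \<mu>) * \<phi> y + l\<^sup>2 * (\<phi> y)\<^sup>2"
      by (simp add: power2_eq_square algebra_simps)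
    finally show "E y \<le> (1 - l * \<mu> + l\<^sup>2 * \<mu>\<^sup>2) + (l - 2 * l\<^sup>2 * \<mu>) * \<phi> y + l\<^sup>2 * (\<phi> y)\<^sup>2" .
  qed (use i i2 in auto)
  also have "\<dots> = 1 + l\<^sup>2 * ((\<integral>y. (\<phi> y)\<^sup>2 \<partial>P) - \<mu>\<^sup>2)"
    using i i2 by (simp add: \<mu>_def[symmetric] prob_space power2_eq_square algebra_simps)
  also have "\<dots> \<le> 1 + l\<^sup>2 * V" using V by (intro add_left_mono mult_left_mono) (auto simp: diff_le_eq add_increasing2)
  also have "\<dots> \<le> exp (l\<^sup>2 * V)" by (rule exp_ge_add_one_self)
  finally have one: "(\<integral>y. E y \<partial>P) \<le> exp (l\<^sup>2 * V)" .
  have prod: "exp (l * (\<Sum>i<n. \<phi> (X i) - \<mu>)) = (\<Prod>i<n. E (X i))" for X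
    by (simp add: E_def sum_distrib_left exp_sum)
  show "integrable (PiM {..<n} (\<lambda>_. P)) (\<lambda>X. exp (l * (\<Sum>i<n. \<phi> (X i) - \<mu>)))"
    unfolding prod by (rule PP.product_integrable_prod) (use iE in auto)
  have "(\<integral>X. exp (l * (\<Sum>i<n. \<phi> (X i) - \<mu>)) \<partial>PiM {..<n} (\<lambda>_. P)) = (\<Prod>i<n. \<integral>y. E y \<partial>P)"
    unfolding prod by (rule PP.product_integral_prod) (use iE in auto)
  also have "\<dots> = (\<integral>y. E y \<partial>P) ^ n" by simp
  also have "\<dots> \<le> exp (l\<^sup>2 * V) ^ n"
    by (rule power_mono[OF one]) (auto simp: E_def intro!: integral_nonneg)
  also have "\<dots> = exp (real n * (l\<^sup>2 * V))" by (simp add: exp_of_nat_mult)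
  finally show "(\<integral>X. exp (l * (\<Sum>i<n. \<phi> (X i) - \<mu>)) \<partial>PiM {..<n} (\<lambda>_. P)) \<le> exp (real n * (l\<^sup>2 * V))" .
qed

section \<open>Shortest paths through the sample\<close>

text \<open>A hop longer than \<open>\<epsilon>\<close> is charged \<open>1\<close>, which exceeds every arc length that matters below.\<close>

definition hop :: "real \<Rightarrow> 'a::metric_space \<Rightarrow> 'a \<Rightarrow> real" where
  "hop \<epsilon> y z = (if dist y z \<le> \<epsilon> then dist y z else 1)"

text \<open>The Bellman-Ford recursion for the cheapest path from x to \<open>X i\<close> with k
  intermediate observations. For \<epsilon> \<ge> 0 a hop from a point to itself is free, so paths
  with fewer hops are included. Finite minima keep the value measurable in the sample.\<close>

primrec gdist :: "real \<Rightarrow> 'a::metric_space \<Rightarrow> nat \<Rightarrow> (nat \<Rightarrow> 'a) \<Rightarrow> nat \<Rightarrow> nat \<Rightarrow> real" where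
  "gdist \<epsilon> x n X 0 i = hop \<epsilon> x (X i)"
| "gdist \<epsilon> x n X (Suc k) i = Min ((\<lambda>j. gdist \<epsilon> x n X k j + hop \<epsilon> (X j) (X i)) ` {..<n})"

lemma borel_measurable_hop[measurable (raw)]:
  fixes f g :: "'b \<Rightarrow> 'a::{second_countable_topology, metric_space}"
  assumes [measurable]: "f \<in> borel_measurable N" "g \<in> borel_measurable N"
  shows "(\<lambda>\<omega>. hop \<epsilon> (f \<omega>) (g \<omega>)) \<in> borel_measurable N"
  unfolding hop_def by measurable

lemma borel_measurable_gdist:
  fixes x :: "'a::{second_countable_topology, metric_space}"
  assumes "i < n"
  shows "(\<lambda>X. gdist \<epsilon> x n X k i) \<in> borel_measurable (PiM {..<n} (\<lambda>_. borel))"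
  using assms
proof (induction k arbitrary: i)
  case 0
  have "(\<lambda>X. X i) \<in> measurable (PiM {..<n} (\<lambda>_. borel :: 'a measure)) borel"
    by (rule measurable_component_singleton) (use 0 in auto)
  then show ?case by (simp add: borel_measurable_hop)
next
  case (Suc k)
  have m: "(\<lambda>X. X i) \<in> measurable (PiM {..<n} (\<lambda>_. borel :: 'a measure)) borel" if "i < n" for i
    by (rule measurable_component_singleton) (use that in auto)
  show ?case unfolding gdist.simps
    by (rule borel_measurable_Min) (auto intro!: borel_measurable_add Suc.IH borel_measurable_hop m Suc.prems)
qed

text \<open>A potential argument: if m vanishes at x and grows along each hop by at most \<kappa>
  times the cost of that hop, it bounds \<kappa> times the cost of every path from below. The
  potential used later is the capped distance along the curve.\<close>

lemma gdist_lower: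
  assumes x: "m x = 0" and X: "\<And>i. i < n \<Longrightarrow> X i \<in> M" "x \<in> M"
    and m: "\<And>y z. y \<in> M \<Longrightarrow> z \<in> M \<Longrightarrow> m z \<le> m y + \<kappa> * hop \<epsilon> y z" and i: "i < n" and \<kappa>: "0 \<le> (\<kappa>::real)"
  shows "m (X i) \<le> \<kappa> * gdist \<epsilon> x n X k i"
  using i
proof (induction k arbitrary: i)
  case 0
  then show ?case using m[OF X(2) X(1)[OF 0]] x by simp
next
  case (Suc k)
  let ?S = "(\<lambda>j. gdist \<epsilon> x n X k j + hop \<epsilon> (X j) (X i)) ` {..<n}"
  have "Min ?S \<in> ?S" using Suc.prems by (intro Min_in) auto
  then obtain j where j: "j < n" "Min ?S = gdist \<epsilon> x n X k j + hop \<epsilon> (X j) (X i)" by auto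
  have "m (X i) \<le> m (X j) + \<kappa> * hop \<epsilon> (X j) (X i)" by (rule m) (use X j Suc.prems in auto)
  also have "\<dots> \<le> \<kappa> * gdist \<epsilon> x n X k j + \<kappa> * hop \<epsilon> (X j) (X i)" using Suc.IH[OF j(1)] by simp
  also have "\<dots> = \<kappa> * gdist \<epsilon> x n X (Suc k) i" using j(2) by (simp add: algebra_simps)
  finally show ?case .
qed

text \<open>The path visits one observation per cell of length \<eta>, moving outwards on the side
  s. Its points are in order along one arc, so the hops, being chords, add up to at most |T
  i|.\<close>

lemma gdist_upper:
  fixes T :: "nat \<Rightarrow> real" and s :: real
  assumes c: "c 0 = x" "\<And>s t. dist (c s) (c t) \<le> \<bar>s - t\<bar>" and \<eta>: "0 < \<eta>" "2 * \<eta> \<le> \<epsilon>" and s: "\<bar>s\<bar> = 1"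
    and X: "\<And>i. i < n \<Longrightarrow> \<bar>T i\<bar> < real L * \<eta> \<Longrightarrow> X i = c (T i)"
    and cells: "\<And>l. l < L \<Longrightarrow> \<exists>j<n. real l * \<eta> \<le> s * T j \<and> s * T j < real (Suc l) * \<eta>"
    and i: "i < n" "0 \<le> s * T i" "s * T i < real (Suc k) * \<eta>" "Suc k \<le> L"
  shows "gdist \<epsilon> x n X k i \<le> \<bar>T i\<bar>"
  using i
proof (induction k arbitrary: i)
  case 0
  have "\<bar>T i\<bar> = s * T i" using 0(2) s abs_mult[of s "T i"] by simp
  moreover have "1 * \<eta> \<le> real L * \<eta>" using 0 \<eta> by (intro mult_right_mono) auto
  moreover have "s * T i < 1 * \<eta>" using 0 by simp
  ultimately have "X i = c (T i)" by (intro X[OF 0(1)]) linarith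
  then have "dist x (X i) \<le> \<bar>T i\<bar>" using c(2)[of 0 "T i"] c(1) by simp
  moreover have "\<bar>T i\<bar> \<le> \<epsilon>" using \<open>\<bar>T i\<bar> = s * T i\<close> 0 \<eta> by simp
  ultimately show ?case by (simp add: hop_def)
next
  case (Suc k)
  let ?S = "(\<lambda>j. gdist \<epsilon> x n X k j + hop \<epsilon> (X j) (X i)) ` {..<n}"
  have le: "gdist \<epsilon> x n X (Suc k) i \<le> gdist \<epsilon> x n X k j + hop \<epsilon> (X j) (X i)" if "j < n" for j
    using that by (auto intro!: Min_le)
  have absT: "\<bar>T j\<bar> = s * T j" if "0 \<le> s * T j" for j using that s abs_mult[of s "T j"] by simp
  show ?case
  proof (cases "s * T i < real (Suc k) * \<eta>")
    case True
    then have "gdist \<epsilon> x n X k i \<le> \<bar>T i\<bar>" using Suc by simp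
    moreover have "hop \<epsilon> (X i) (X i) = 0" using \<eta> by (simp add: hop_def)
    ultimately show ?thesis using le[OF Suc.prems(1)] by simp
  next
    case False
    \<comment> \<open>\<open>X i\<close> lies in cell k + 1 and its predecessor is taken in cell k,
      so they are at most 2\<eta> \<le> \<epsilon> apart and the hop is admissible.\<close>
    obtain j where j: "j < n" "real k * \<eta> \<le> s * T j" "s * T j < real (Suc k) * \<eta>"
      using cells[of k] Suc.prems by auto
    have j0: "0 \<le> s * T j" using j(2) \<eta> by (meson mult_nonneg_nonneg of_nat_0_le_iff less_imp_le order_trans)
    have IH: "gdist \<epsilon> x n X k j \<le> \<bar>T j\<bar>" by (rule Suc.IH) (use j j0 Suc.prems in auto)
    have L: "real (Suc (Suc k)) * \<eta> \<le> real L * \<eta>" using Suc.prems \<eta> by (intro mult_right_mono) auto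
    have L': "real (Suc k) * \<eta> \<le> real L * \<eta>" using Suc.prems \<eta> by (intro mult_right_mono) auto
    have Xi: "X i = c (T i)" by (rule X[OF Suc.prems(1)]) (use absT[OF Suc.prems(2)] Suc.prems L in linarith)
    have Xj: "X j = c (T j)" by (rule X[OF j(1)]) (use absT[OF j0] j L' in linarith)
    have "\<bar>s * T j - s * T i\<bar> = \<bar>s\<bar> * \<bar>T j - T i\<bar>" by (simp add: right_diff_distrib[symmetric] abs_mult del: right_diff_distrib)
    then have d: "\<bar>T j - T i\<bar> = s * T i - s * T j" using s j False by simp
    have "s * T i - s * T j \<le> 2 * \<eta>" using Suc.prems(3) j(2) by (simp add: algebra_simps)
    then have "dist (X j) (X i) \<le> s * T i - s * T j" "dist (X j) (X i) \<le> \<epsilon>"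
      using c(2)[of "T j" "T i"] d \<eta> Xi Xj by auto
    then have "hop \<epsilon> (X j) (X i) \<le> s * T i - s * T j" by (simp add: hop_def)
    then show ?thesis using le[OF j(1)] IH absT[OF j0] absT[OF Suc.prems(2)] by linarith
  qed
qed

text \<open>By independence this is (1 - P(A))^n \<le> exp(- n P(A)); it is applied to cells of the
  arc that receive no observation.\<close>

lemma PiM_all_avoid:
  assumes P: "prob_space P" and A: "A \<in> sets P"
  shows "measure (PiM {..<n} (\<lambda>_. P)) {X \<in> space (PiM {..<n} (\<lambda>_. P)). \<forall>i<n. X i \<notin> A}
    \<le> exp (- (real n * measure P A))"
    and "{X \<in> space (PiM {..<n} (\<lambda>_. P)). \<forall>i<n. X i \<notin> A} \<in> sets (PiM {..<n} (\<lambda>_. P))"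
proof -
  interpret prob_space P by (rule P)
  interpret PP: finite_product_prob_space "\<lambda>_::nat. P" "{..<n}" by standard auto
  have eq: "{X \<in> space (PiM {..<n} (\<lambda>_. P)). \<forall>i<n. X i \<notin> A} = PiE {..<n} (\<lambda>_. space P - A)"
    by (auto simp: space_PiM PiE_def Pi_def)
  show "{X \<in> space (PiM {..<n} (\<lambda>_. P)). \<forall>i<n. X i \<notin> A} \<in> sets (PiM {..<n} (\<lambda>_. P))"
    unfolding eq using A by (intro sets_PiM_I_finite) auto
  have "measure (PiM {..<n} (\<lambda>_. P)) (PiE {..<n} (\<lambda>_. space P - A)) = (\<Prod>i<n. measure P (space P - A))"
    by (rule PP.finite_measure_PiM_emb) (use A in auto)
  also have "\<dots> = (1 - measure P A) ^ n" using A by (simp add: prob_compl)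
  also have "\<dots> \<le> exp (- measure P A) ^ n"
    using exp_ge_add_one_self[of "- measure P A"] by (intro power_mono) auto
  also have "\<dots> = exp (- (real n * measure P A))" by (simp add: exp_of_nat_mult[symmetric])
  finally show "measure (PiM {..<n} (\<lambda>_. P)) {X \<in> space (PiM {..<n} (\<lambda>_. P)). \<forall>i<n. X i \<notin> A}
    \<le> exp (- (real n * measure P A))" unfolding eq .
qed

section \<open>Risk of the estimator\<close>

lemma gdist_Suc_le:
  assumes "i < n" "0 \<le> \<epsilon>"
  shows "gdist \<epsilon> x n X (Suc k) i \<le> gdist \<epsilon> x n X k i"
proof -
  have "gdist \<epsilon> x n X (Suc k) i \<le> gdist \<epsilon> x n X k i + hop \<epsilon> (X i) (X i)"
    using assms by (auto intro!: Min_le)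
  then show ?thesis using assms by (simp add: hop_def)
qed

lemma gdist_antimono:
  assumes "i < n" "0 \<le> \<epsilon>" "k \<le> l"
  shows "gdist \<epsilon> x n X l i \<le> gdist \<epsilon> x n X k i"
  using assms(3) by (induction l rule: dec_induct) (use gdist_Suc_le[OF assms(1,2)] order_trans in blast)+

lemma powr_add_le:
  fixes u v :: real
  assumes "0 \<le> u" "0 \<le> v" "0 \<le> p"
  shows "(u + v) powr p \<le> 2 powr p * (u powr p + v powr p)"
proof -
  have "(u + v) powr p \<le> (2 * max u v) powr p" using assms by (intro powr_mono2) auto
  also have "\<dots> = 2 powr p * max u v powr p" using assms by (simp add: powr_mult)
  also have "\<dots> \<le> 2 powr p * (u powr p + v powr p)" by (intro mult_left_mono) (auto simp: max_def)
  finally show ?thesis .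
qed

context closed_curve begin

text \<open>At most 1, the price of an inadmissible hop, so that such a hop never pays; at most
  \<tau>/4, so that a point of the window may move by \<tau>/4 along the curve and still have its
  coordinate below \<tau>/2.\<close>

definition window :: real where "window = min 1 (\<tau> / 4)"

lemma window: "0 < window" "window \<le> 1" "window \<le> \<tau> / 4"
  using tau_pos by (auto simp: window_def)

text \<open>The cap deals with the hops that escape geometric control: a long hop costs at least
  \<open>window\<close>, and from outside the window the potential cannot grow. A short hop from
  inside stays on the arc, where \<open>arc_le_chord\<close> applies.\<close>

lemma capped_coord_hop:
  assumes c: "unit_speed UNIV c" and e: "0 \<le> \<epsilon>" "\<epsilon> < \<tau> / 16" and y: "y \<in> M" and z: "z \<in> M"
  shows "min \<bar>coord c z\<bar> window \<le> min \<bar>coord c y\<bar> window + (1 + 4 * \<epsilon>\<^sup>2 / \<tau>\<^sup>2) * hop \<epsilon> y z"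
proof (cases "dist y z \<le> \<epsilon>")
  case False
  have "1 \<le> 1 + 4 * \<epsilon>\<^sup>2 / \<tau>\<^sup>2" by simp
  then have "1 \<le> (1 + 4 * \<epsilon>\<^sup>2 / \<tau>\<^sup>2) * hop \<epsilon> y z" using False by (simp add: hop_def)
  moreover have "0 \<le> min \<bar>coord c y\<bar> window" "min \<bar>coord c z\<bar> window \<le> 1" using window by auto
  ultimately show ?thesis by linarith
next
  case True
  then have hp: "hop \<epsilon> y z = dist y z" by (simp add: hop_def)
  have \<kappa>: "0 \<le> (1 + 4 * \<epsilon>\<^sup>2 / \<tau>\<^sup>2) * dist y z" by simp
  show ?thesis
  proof (cases "window \<le> \<bar>coord c y\<bar>")
    case 1: True
    have "min \<bar>coord c z\<bar> window \<le> min \<bar>coord c y\<bar> window" using 1 by simp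
    then show ?thesis unfolding hp using \<kappa> by linarith
  next
    case 2: False
    then have "coord c y \<noteq> \<tau>" using window tau_pos by auto
    then obtain t where t: "\<bar>t\<bar> < \<tau> / 2" "y = c t" "coord c y = t"
      by (rule_tac coord_cases[OF c, of y]) blast+
    have tw: "\<bar>t\<bar> < window" using 2 t by simp
    \<comment> \<open>This explains \<epsilon> < \<tau>/16: \<open>arc_covers\<close> is used with r
      = \<tau>/4 and loses a factor 4.\<close>
    have "dist z (c t) < (\<tau> / 4) / 4" using True e t by (simp add: dist_commute)
    then obtain s where s: "\<bar>s - t\<bar> < \<tau> / 4" "z = c s"
      using arc_covers[OF open_UNIV convex_UNIV c, of "\<tau> / 4" t z] tau_pos z by auto
    have "\<bar>s\<bar> < \<tau> / 2" using s tw window by linarith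
    then have cz: "coord c z = s" using coord_arc[OF c] s by simp
    have d: "dist (c s) (c t) = dist y z" using s t by (simp add: dist_commute)
    have "\<bar>s - t\<bar> \<le> (1 + 4 * (dist (c s) (c t))\<^sup>2 / \<tau>\<^sup>2) * dist (c s) (c t)"
      by (rule arc_le_chord[OF open_UNIV convex_UNIV c]) (use s d True e tau_pos in auto)
    also have "\<dots> \<le> (1 + 4 * \<epsilon>\<^sup>2 / \<tau>\<^sup>2) * dist y z"
      unfolding d using True by (intro mult_right_mono add_left_mono divide_right_mono mult_left_mono power_mono) auto
    finally have "\<bar>s\<bar> \<le> \<bar>t\<bar> + (1 + 4 * \<epsilon>\<^sup>2 / \<tau>\<^sup>2) * dist y z" by linarith
    moreover have "min \<bar>t\<bar> window = \<bar>t\<bar>" using tw by simp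
    moreover have "min \<bar>s\<bar> window \<le> \<bar>s\<bar>" by simp
    ultimately show ?thesis unfolding cz t(3) hp by linarith
  qed
qed

text \<open>Beyond the window both kernels vanish, since the path length D is at least
  \<open>window\<close>/\<kappa> and \<kappa> \<le> 2. Inside, D \<le> |T| \<le> \<kappa> D for the
  coordinate T, so the two differ by at most (\<kappa> - 1) \<open>window\<close>, of order
  \<epsilon>^2.\<close>

lemma kern_gdist:
  assumes c: "unit_speed UNIV c" and e: "0 < \<epsilon>" "\<epsilon> < \<tau> / 16" and h: "0 < h" "2 ^ m * h \<le> window / 2"
    and \<Lambda>: "0 \<le> \<Lambda>" "\<And>s t. \<bar>kern m s - kern m t\<bar> \<le> \<Lambda> * \<bar>s - t\<bar>"
    and X: "\<And>i. i < n \<Longrightarrow> X i \<in> M" and \<eta>: "0 < \<eta>" "2 * \<eta> \<le> \<epsilon>" "real L * \<eta> = window" "L \<le> n"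
    and cells: "\<And>s l. \<bar>s\<bar> = 1 \<Longrightarrow> l < L \<Longrightarrow> \<exists>j<n. real l * \<eta> \<le> s * coord c (X j) \<and> s * coord c (X j) < real (Suc l) * \<eta>"
    and i: "i < n"
  shows "\<bar>kern m (gdist \<epsilon> (c 0) n X n i / h) - kern m (coord c (X i) / h)\<bar> \<le> 4 * \<Lambda> * window / \<tau>\<^sup>2 * (\<epsilon>\<^sup>2 / h)"
proof -
  define \<kappa> where "\<kappa> = 1 + 4 * \<epsilon>\<^sup>2 / \<tau>\<^sup>2"
  define D where "D = gdist \<epsilon> (c 0) n X n i"
  define T where "T = coord c (X i)"
  have "\<epsilon>\<^sup>2 \<le> (\<tau> / 16)\<^sup>2" using e by (intro power_mono) auto
  then have "\<epsilon>\<^sup>2 * 256 \<le> \<tau>\<^sup>2" by (simp add: power_divide)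
  then have "4 * \<epsilon>\<^sup>2 \<le> \<tau>\<^sup>2" using zero_le_power2[of \<epsilon>] by linarith
  then have \<kappa>: "1 \<le> \<kappa>" "\<kappa> \<le> 2" using tau_pos by (auto simp: \<kappa>_def)
  have c0: "coord c (c 0) = 0" using coord_arc[OF c, of 0] tau_pos by simp
  have lower: "min \<bar>T\<bar> window \<le> \<kappa> * D"
    unfolding T_def D_def
  proof (rule gdist_lower[where M = M and m = "\<lambda>y. min \<bar>coord c y\<bar> window", OF _ X _ _ i])
    show "min \<bar>coord c z\<bar> window \<le> min \<bar>coord c y\<bar> window + \<kappa> * hop \<epsilon> y z" if "y \<in> M" "z \<in> M" for y z
      unfolding \<kappa>_def by (rule capped_coord_hop[OF c _ _ that]) (use e in auto)
  qed (use c0 window arc_in[OF c] \<kappa> in auto)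
  have D0: "0 \<le> D"
  proof -
    have "0 \<le> min \<bar>T\<bar> window" using window by simp
    then have "0 \<le> \<kappa> * D" using lower by linarith
    then show ?thesis using \<kappa> by (simp add: zero_le_mult_iff)
  qed
  have rhs0: "0 \<le> 4 * \<Lambda> * window / \<tau>\<^sup>2 * (\<epsilon>\<^sup>2 / h)" using \<Lambda>(1) window h by simp
  show ?thesis
  proof (cases "window \<le> \<bar>T\<bar>")
    case True
    have "\<kappa> * D \<le> 2 * D" using \<kappa> D0 by (intro mult_right_mono) auto
    then have "2 ^ m * h \<le> \<bar>D\<bar>" using lower True h(2) by simp
    then have "kern m (D / h) = 0" using h(1) by (intro kern_eq_0) (simp add: field_simps)
    moreover have "2 ^ m * h \<le> \<bar>T\<bar>" using True h(2) window by linarith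
    then have "kern m (T / h) = 0" using h(1) by (intro kern_eq_0) (simp add: field_simps)
    ultimately show ?thesis using rhs0 by (simp add: D_def T_def)
  next
    case False
    define s where "s = (if 0 \<le> T then 1 else - 1 :: real)"
    have s: "\<bar>s\<bar> = 1" "s * T = \<bar>T\<bar>" by (auto simp: s_def)
    have L: "0 < L" using \<eta> window by (cases L) auto
    \<comment> \<open>L cells need up to L hops, which is index L - 1 because index 0 already allows
      one hop; \<open>gdist_antimono\<close> then passes to index n.\<close>
    have "gdist \<epsilon> (c 0) n X (L - 1) i \<le> \<bar>coord c (X i)\<bar>"
    proof (rule gdist_upper[where c = c and \<eta> = \<eta> and s = s and T = "\<lambda>i. coord c (X i)" and L = L])
      show "dist (c s) (c t) \<le> \<bar>s - t\<bar>" for s t by (rule arc_lipschitz[OF open_UNIV convex_UNIV c]) auto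
      show "X i = c (coord c (X i))" if "\<bar>coord c (X i)\<bar> < real L * \<eta>" for i
        using that \<eta>(3) window tau_pos by (cases rule: coord_cases[OF c, of "X i"]) auto
      show "\<exists>j<n. real l * \<eta> \<le> s * coord c (X j) \<and> s * coord c (X j) < real (Suc l) * \<eta>" if "l < L" for l
        by (rule cells[OF s(1) that])
      show "s * coord c (X i) < real (Suc (L - 1)) * \<eta>" using False s L \<eta> by (simp add: T_def)
      show "0 \<le> s * coord c (X i)" using s by (simp add: T_def)
    qed (use \<eta> s i L in auto)
    moreover have "D \<le> gdist \<epsilon> (c 0) n X (L - 1) i"
      unfolding D_def by (rule gdist_antimono[OF i]) (use e \<eta> in auto)
    ultimately have upper: "D \<le> \<bar>T\<bar>" by (simp add: T_def)
    have "\<bar>T\<bar> - D \<le> (\<kappa> - 1) * D" using lower False by (simp add: algebra_simps)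
    also have "\<dots> \<le> (\<kappa> - 1) * window" using upper False \<kappa> by (intro mult_left_mono) auto
    finally have "\<bar>D - \<bar>T\<bar>\<bar> \<le> (\<kappa> - 1) * window" using upper by simp
    then have close: "\<bar>D / h - \<bar>T / h\<bar>\<bar> \<le> (\<kappa> - 1) * window / h"
      using h by (simp add: abs_divide diff_divide_distrib[symmetric] divide_right_mono)
    have "\<bar>kern m (D / h) - kern m (T / h)\<bar> = \<bar>kern m (D / h) - kern m \<bar>T / h\<bar>\<bar>" by (simp only: kern_abs)
    also have "\<dots> \<le> \<Lambda> * \<bar>D / h - \<bar>T / h\<bar>\<bar>" by (rule \<Lambda>(2))
    also have "\<dots> \<le> \<Lambda> * ((\<kappa> - 1) * window / h)" using close \<Lambda>(1) by (rule mult_left_mono)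
    also have "\<dots> = 4 * \<Lambda> * window / \<tau>\<^sup>2 * (\<epsilon>\<^sup>2 / h)" by (simp add: \<kappa>_def)
    finally show ?thesis by (simp add: D_def T_def)
  qed
qed

end

section \<open>A Hoelder density on a curve: integrals, bias and variance\<close>

locale curve_density = closed_curve +
  fixes P :: "'a measure" and f :: "'a \<Rightarrow> real" and \<beta> R fmin fmax :: real and c :: "real \<Rightarrow> 'a"
  assumes P: "prob_space P" "sets P = sets borel" "P = density (volume_measure 1 M) (\<lambda>y. ennreal (f y))"
    and f_borel: "f \<in> borel_measurable borel"
    and f_holder: "f \<in> holder_class M \<beta>" "holder_norm M \<beta> f \<le> ennreal R"
    and f_bounds: "\<And>y. y \<in> M \<Longrightarrow> fmin \<le> f y" "\<And>y. y \<in> M \<Longrightarrow> f y \<le> fmax"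
    and params: "0 < \<beta>" "0 \<le> R" "0 < fmin"
    and c: "unit_speed UNIV c"
begin

sublocale prob_space P by (rule P(1))

lemma coord_measurable[measurable]: "coord c \<in> borel_measurable P"
  using borel_measurable_coord[OF c] P(2) by (simp cong: measurable_cong_sets)

lemma fc_measurable[measurable]: "(\<lambda>t. f (c t)) \<in> borel_measurable borel"
  using measurable_compose[OF borel_measurable_arc[OF c] f_borel] .

lemma fc_bounds: "fmin \<le> f (c t)" "f (c t) \<le> fmax" "0 < f (c t)"
  using f_bounds[OF arc_in[OF c UNIV_I]] params by (auto intro: less_le_trans)

text \<open>A bounded function has a finite integral under the probability P;
  \<open>nn_integral_coord\<close> transfers this to integrability for Lebesgue measure.\<close>

lemma integral_coord_nonneg:
  fixes \<phi> :: "real \<Rightarrow> real"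
  assumes [measurable]: "\<phi> \<in> borel_measurable borel" and \<phi>: "\<And>t. \<tau> / 2 \<le> \<bar>t\<bar> \<Longrightarrow> \<phi> t = 0"
    "\<And>t. 0 \<le> \<phi> t" "\<And>t. \<phi> t \<le> B"
  shows "integrable lborel (\<lambda>t. \<phi> t * f (c t))"
    and "(\<integral>y. \<phi> (coord c y) \<partial>P) = (\<integral>t. \<phi> t * f (c t) \<partial>lborel)"
proof -
  have "(\<integral>\<^sup>+y. ennreal (\<phi> (coord c y)) \<partial>P) = (\<integral>\<^sup>+t. ennreal (\<phi> t) * ennreal (f (c t)) \<partial>lborel)"
    by (rule nn_integral_coord[OF c f_borel P(1,3)]) (use \<phi> in auto)
  also have "\<dots> = (\<integral>\<^sup>+t. ennreal (\<phi> t * f (c t)) \<partial>lborel)"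
    using \<phi> by (simp add: ennreal_mult')
  finally have eq: "(\<integral>\<^sup>+y. ennreal (\<phi> (coord c y)) \<partial>P) = (\<integral>\<^sup>+t. ennreal (\<phi> t * f (c t)) \<partial>lborel)" .
  have pos: "0 \<le> \<phi> t * f (c t)" for t using \<phi>(2)[of t] fc_bounds(3)[of t] by simp
  have "(\<integral>\<^sup>+y. ennreal (\<phi> (coord c y)) \<partial>P) \<le> (\<integral>\<^sup>+y. ennreal B \<partial>P)"
    using \<phi> by (intro nn_integral_mono ennreal_leI)
  also have "\<dots> < \<infinity>" by (simp add: emeasure_space_1)
  finally have "(\<integral>\<^sup>+y. ennreal (\<phi> (coord c y)) \<partial>P) < \<infinity>" .
  then show "integrable lborel (\<lambda>t. \<phi> t * f (c t))"
    unfolding eq using pos by (intro integrableI_nonneg) auto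
  show "(\<integral>y. \<phi> (coord c y) \<partial>P) = (\<integral>t. \<phi> t * f (c t) \<partial>lborel)"
    using pos \<phi>(2) by (subst (1 2) integral_eq_nn_integral) (auto simp: eq)
qed

lemma integral_coord:
  fixes \<phi> :: "real \<Rightarrow> real"
  assumes [measurable]: "\<phi> \<in> borel_measurable borel" and \<phi>: "\<And>t. \<tau> / 2 \<le> \<bar>t\<bar> \<Longrightarrow> \<phi> t = 0" "\<And>t. \<bar>\<phi> t\<bar> \<le> B"
  shows "integrable lborel (\<lambda>t. \<phi> t * f (c t))"
    and "(\<integral>y. \<phi> (coord c y) \<partial>P) = (\<integral>t. \<phi> t * f (c t) \<partial>lborel)"
proof -
  have p: "max 0 (\<phi> t) \<le> B" "max 0 (- \<phi> t) \<le> B" for t using \<phi>(2)[of t] by auto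
  note pos = integral_coord_nonneg[of "\<lambda>t. max 0 (\<phi> t)" B, OF _ _ _ p(1)]
  note neg = integral_coord_nonneg[of "\<lambda>t. max 0 (- \<phi> t)" B, OF _ _ _ p(2)]
  have i: "integrable lborel (\<lambda>t. max 0 (\<phi> t) * f (c t))" "integrable lborel (\<lambda>t. max 0 (- \<phi> t) * f (c t))"
    by (rule pos(1) neg(1); use \<phi>(1) in auto)+
  have e: "(\<integral>y. max 0 (\<phi> (coord c y)) \<partial>P) = (\<integral>t. max 0 (\<phi> t) * f (c t) \<partial>lborel)"
    "(\<integral>y. max 0 (- \<phi> (coord c y)) \<partial>P) = (\<integral>t. max 0 (- \<phi> t) * f (c t) \<partial>lborel)"
    by (rule pos(2) neg(2); use \<phi>(1) in auto)+
  have j: "integrable P (\<lambda>y. max 0 (\<phi> (coord c y)))" "integrable P (\<lambda>y. max 0 (- \<phi> (coord c y)))"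
    by (rule integrable_const_bound[where B = B]; use p in auto)+
  have split: "\<phi> t = max 0 (\<phi> t) - max 0 (- \<phi> t)" for t by auto
  have split': "\<phi> t * f (c t) = max 0 (\<phi> t) * f (c t) - max 0 (- \<phi> t) * f (c t)" for t
    by (subst split) (simp add: algebra_simps)
  show "integrable lborel (\<lambda>t. \<phi> t * f (c t))"
    unfolding split' by (intro Bochner_Integration.integrable_diff i)
  have "(\<integral>y. \<phi> (coord c y) \<partial>P) = (\<integral>y. max 0 (\<phi> (coord c y)) - max 0 (- \<phi> (coord c y)) \<partial>P)"
    using split by (intro Bochner_Integration.integral_cong) auto
  also have "\<dots> = (\<integral>t. max 0 (\<phi> t) * f (c t) - max 0 (- \<phi> t) * f (c t) \<partial>lborel)"
    using i j e by simp
  also have "\<dots> = (\<integral>t. \<phi> t * f (c t) \<partial>lborel)" unfolding split' ..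
  finally show "(\<integral>y. \<phi> (coord c y) \<partial>P) = (\<integral>t. \<phi> t * f (c t) \<partial>lborel)" .
qed

text \<open>On either side of x a cell is a half-open interval in the coordinate, where the density
  is at least \<open>fmin\<close>.\<close>

lemma cell_mass:
  assumes s: "\<bar>s\<bar> = 1" and ab: "0 \<le> a" "a \<le> b" "b < \<tau> / 2"
  shows "fmin * (b - a) \<le> measure P {y \<in> space P. a \<le> s * coord c y \<and> s * coord c y < b}"
    and "{y \<in> space P. a \<le> s * coord c y \<and> s * coord c y < b} \<in> sets P"
proof -
  define J where "J = {t. a \<le> s * t \<and> s * t < b}"
  have J: "J = {a..<b} \<or> J = {-b<..-a}"
    using s by (cases "0 \<le> s") (auto simp: J_def abs_if)
  then have [measurable]: "J \<in> sets borel" by auto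
  have lJ: "emeasure lborel J = ennreal (b - a)" using J ab by auto
  have in0: "indicator J t = (0 :: real)" if "\<tau> / 2 \<le> \<bar>t\<bar>" for t
    using J that ab by (auto simp: indicator_def)
  have "fmin * (b - a) = (\<integral>t. fmin * indicator J t \<partial>lborel)"
    using lJ ab by (simp add: measure_def)
  also have "\<dots> \<le> (\<integral>t. indicator J t * f (c t) \<partial>lborel)"
  proof (rule integral_mono)
    show "integrable lborel (\<lambda>t. fmin * indicator J t)"
      by (intro integrable_mult_right integrable_real_indicator) (auto simp: lJ)
    show "integrable lborel (\<lambda>t. indicator J t * f (c t))"
      by (rule integral_coord_nonneg(1)[where B = 1]) (use in0 in \<open>auto simp: indicator_def\<close>)
    show "fmin * indicator J t \<le> indicator J t * f (c t)" for t
      using fc_bounds(1)[of t] by (simp add: indicator_def)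
  qed
  also have "\<dots> = (\<integral>y. indicator J (coord c y) \<partial>P)"
    by (rule integral_coord_nonneg(2)[where B = 1, symmetric]) (use in0 in \<open>auto simp: indicator_def\<close>)
  also have "\<dots> = (\<integral>y. indicator {y \<in> space P. coord c y \<in> J} y \<partial>P)"
    by (intro Bochner_Integration.integral_cong) (auto simp: indicator_def)
  also have "\<dots> = measure P {y \<in> space P. coord c y \<in> J}" by simp
  finally show "fmin * (b - a) \<le> measure P {y \<in> space P. a \<le> s * coord c y \<and> s * coord c y < b}"
    by (simp add: J_def)
  show "{y \<in> space P. a \<le> s * coord c y \<and> s * coord c y < b} \<in> sets P" by measurable
qed

lemma AE_in_M: "AE y in P. y \<in> M"
proof -
  have sH: "sets (hausdorff_measure 1 :: 'a measure) = sets borel"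
    by (rule sets_hausdorff_measure)
  have "M \<in> sets (hausdorff_measure 1)" using compact_M sH by (simp add: borel_closed compact_imp_closed)
  then show ?thesis
    unfolding P(3) volume_measure_def using f_borel sH
    by (subst AE_density) (auto simp: AE_density indicator_def cong: measurable_cong_sets)
qed

lemma kern_bias:
  fixes h :: real
  defines "m \<equiv> holder_order \<beta>"
  assumes h: "0 < h" "2 ^ m * h \<le> window / 2" and B: "\<And>t. \<bar>kern m t\<bar> \<le> B"
  shows "\<bar>(\<integral>y. kern m (coord c y / h) \<partial>P) - h * f (c 0)\<bar> \<le> 2 * B * R * (2 ^ m) powr (\<beta> + 1) * h powr (\<beta> + 1)"
proof -
  obtain a where a: "\<And>t. \<bar>t\<bar> < \<tau> / 2 \<Longrightarrow> \<bar>f (c t) - (\<Sum>j\<le>m. a j * t ^ j)\<bar> \<le> R * \<bar>t\<bar> powr \<beta>"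
    using holder_taylor[OF c f_holder params(2,1)] unfolding m_def by blast
  have w: "2 ^ m * h < \<tau> / 2" using h window tau_pos by linarith
  have z: "kern m (t / h) = 0" if "\<tau> / 2 \<le> \<bar>t\<bar>" for t
    using that w h by (intro kern_eq_0) (simp add: field_simps)
  have [measurable]: "(\<lambda>t. kern m (t / h)) \<in> borel_measurable borel" by measurable
  note ic = integral_coord[of "\<lambda>t. kern m (t / h)" B, OF _ z B]
  have "(\<integral>y. kern m (coord c y / h) \<partial>P) = (\<integral>t. kern m (t / h) * f (c t) \<partial>lborel)" by (rule ic(2)) auto
  moreover have "\<bar>(\<integral>t. kern m (t / h) * f (c t) \<partial>lborel) - h * f (c 0)\<bar>
    \<le> 2 * B * R * (2 ^ m) powr (\<beta> + 1) * h powr (\<beta> + 1)"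
    by (rule kernel_bias[where a = a, OF h(1) params(1,2) B]) (use a w ic(1) in auto)
  ultimately show ?thesis by simp
qed

text \<open>The squared kernel lives on an interval of length 2 * 2^m h. This factor h is what the
  balance n h l^2 = 1 with l = h^\<beta> later cancels.\<close>

lemma kern_variance:
  assumes h: "0 < h" "2 ^ m * h \<le> window / 2" and B: "\<And>t. \<bar>kern m t\<bar> \<le> B"
  shows "(\<integral>y. (kern m (coord c y / h))\<^sup>2 \<partial>P) \<le> 2 * 2 ^ m * B\<^sup>2 * fmax * h"
proof -
  have w: "2 ^ m * h < \<tau> / 2" using h window tau_pos by linarith
  have z: "(kern m (t / h))\<^sup>2 = 0" if "2 ^ m * h < \<bar>t\<bar>" for t
    using that h kern_eq_0[of m "t / h"] by (simp add: field_simps)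
  have B2: "(kern m t)\<^sup>2 \<le> B\<^sup>2" for t using B[of t] abs_le_square_iff[of "kern m t" B] by simp
  have ic: "(\<integral>y. (kern m (coord c y / h))\<^sup>2 \<partial>P) = (\<integral>t. (kern m (t / h))\<^sup>2 * f (c t) \<partial>lborel)"
    "integrable lborel (\<lambda>t. (kern m (t / h))\<^sup>2 * f (c t))"
    by (rule integral_coord_nonneg[where B = "B\<^sup>2"]; use z w B2 in force)+
  have fm: "0 \<le> fmax" using fc_bounds[of 0] by linarith
  have "(\<integral>t. (kern m (t / h))\<^sup>2 * f (c t) \<partial>lborel) \<le> (\<integral>t. B\<^sup>2 * fmax * indicator {-(2 ^ m * h)..2 ^ m * h} t \<partial>lborel)"
  proof (rule integral_mono[OF ic(2)])
    show "integrable lborel (\<lambda>t. B\<^sup>2 * fmax * indicator {-(2 ^ m * h)..2 ^ m * h} t)"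
      using h by (intro integrable_mult_right integrable_real_indicator) auto
    fix t
    show "(kern m (t / h))\<^sup>2 * f (c t) \<le> B\<^sup>2 * fmax * indicator {-(2 ^ m * h)..2 ^ m * h} t"
    proof (cases "\<bar>t\<bar> \<le> 2 ^ m * h")
      case True
      have "(kern m (t / h))\<^sup>2 * f (c t) \<le> B\<^sup>2 * fmax"
        using fc_bounds(2,3)[of t] B2 by (intro mult_mono) auto
      then show ?thesis using True by (auto simp: indicator_def)
    next
      case False
      then show ?thesis using z[of t] fm by (simp add: indicator_def)
    qed
  qed
  also have "\<dots> = 2 * 2 ^ m * B\<^sup>2 * fmax * h" using h by simp
  finally show ?thesis unfolding ic(1) .
qed

end

section \<open>The estimator and its error\<close>

definition path_kernel_estimator ::
  "nat \<Rightarrow> real \<Rightarrow> real \<Rightarrow> 'a::metric_space \<Rightarrow> nat \<Rightarrow> (nat \<Rightarrow> 'a) \<Rightarrow> real" where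
  "path_kernel_estimator m h \<epsilon> x n X = (\<Sum>i<n. kern m (gdist \<epsilon> x n X n i / h)) / (real n * h)"

lemma borel_measurable_path_kernel_estimator:
  fixes x :: "'a::{second_countable_topology, metric_space}"
  shows "path_kernel_estimator m h \<epsilon> x n \<in> borel_measurable (PiM {..<n} (\<lambda>_. borel))"
proof -
  have "(\<lambda>X. kern m (gdist \<epsilon> x n X n i / h)) \<in> borel_measurable (PiM {..<n} (\<lambda>_. borel))" if "i < n" for i
    by (intro measurable_compose[OF _ borel_measurable_kern] borel_measurable_divide
        borel_measurable_gdist[OF that] borel_measurable_const)
  then show ?thesis
    unfolding path_kernel_estimator_def[abs_def]
    by (intro borel_measurable_divide borel_measurable_sum borel_measurable_const) auto
qed

context curve_density begin

text \<open>Three errors: E from path lengths in place of coordinates, the centred sum S, and the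
  bias. With l = h^\<beta> the balance n h^(2\<beta>+1) = 1 reads 1/(nh) = l^2, so S/(nh) = l (l S),
  where l S has bounded exponential moments. For b = 0 every cell is hit; for b = 1 the error E is
  bounded trivially.\<close>

lemma pointwise_error:
  fixes h \<epsilon> B \<Lambda> \<eta> :: real and n L :: nat
  defines "m \<equiv> holder_order \<beta>"
  defines "\<mu> \<equiv> (\<integral>y. kern m (coord c y / h) \<partial>P)"
  assumes n: "0 < n" and e: "0 < \<epsilon>" "\<epsilon> < \<tau> / 16" and h: "0 < h" "2 ^ m * h \<le> window / 2"
    and \<Lambda>: "0 \<le> \<Lambda>" "\<And>s t. \<bar>kern m s - kern m t\<bar> \<le> \<Lambda> * \<bar>s - t\<bar>"
    and B: "0 < B" "\<And>t. \<bar>kern m t\<bar> \<le> B"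
    and \<eta>: "0 < \<eta>" "2 * \<eta> \<le> \<epsilon>" "real L * \<eta> = window" "L \<le> n"
    and \<epsilon>h: "\<epsilon>\<^sup>2 = h powr (\<beta> + 2)" and nh: "real n * h powr (2 * \<beta> + 1) = 1"
    and X: "\<And>i. i < n \<Longrightarrow> X i \<in> M"
    and a: "a = 4 * \<Lambda> * window / \<tau>\<^sup>2 + 2 * B * R * (2 ^ m) powr (\<beta> + 1)"
    and bad: "b = 0 \<Longrightarrow> (\<forall>s l. \<bar>s\<bar> = 1 \<and> l < L \<longrightarrow>
      (\<exists>j<n. real l * \<eta> \<le> s * coord c (X j) \<and> s * coord c (X j) < real (Suc l) * \<eta>))"
    and b: "b \<in> {0, 1}"
  shows "\<bar>path_kernel_estimator m h \<epsilon> (c 0) n X - f (c 0)\<bar>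
    \<le> h powr \<beta> * (a + \<bar>h powr \<beta> * (\<Sum>i<n. kern m (coord c (X i) / h) - \<mu>)\<bar>) + 2 * B / h * b"
proof -
  define l where "l = h powr \<beta>"
  define S where "S = (\<Sum>i<n. kern m (coord c (X i) / h) - \<mu>)"
  define E where "E = (\<Sum>i<n. kern m (gdist \<epsilon> (c 0) n X n i / h) - kern m (coord c (X i) / h))"
  define a1 where "a1 = 4 * \<Lambda> * window / \<tau>\<^sup>2"
  define a2 where "a2 = 2 * B * R * (2 ^ m) powr (\<beta> + 1)"
  have l0: "0 < l" using h by (simp add: l_def)
  have hb: "h powr (\<beta> + 1) = l * h" using h by (simp add: powr_add l_def)
  have "h powr (2 * \<beta> + 1) = l\<^sup>2 * h"
    using h by (simp add: powr_add l_def power2_eq_square) (simp add: powr_add[symmetric])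
  then have nl: "real n * h * l\<^sup>2 = 1" using nh by (simp add: mult_ac)
  then have nl': "1 / (real n * h) = l\<^sup>2" using n h by (simp add: field_simps)
  \<comment> \<open>The choice of \<epsilon> at work: the error of one kernel value is of order
    \<epsilon>^2/h = l h, and n such errors divided by nh are of order l.\<close>
  have eh: "\<epsilon>\<^sup>2 / h = l * h"
  proof -
    have "h powr (\<beta> + 2) = l * h * h" using h by (simp add: powr_add l_def power2_eq_square)
    then show ?thesis using h by (simp add: \<epsilon>h)
  qed
  have a10: "0 \<le> a1" using \<Lambda>(1) window by (simp add: a1_def)
  have E: "\<bar>E\<bar> / (real n * h) \<le> l * a1 + 2 * B / h * b"
  proof (cases "b = 0")
    case True
    have "\<bar>E\<bar> \<le> (\<Sum>i<n. \<bar>kern m (gdist \<epsilon> (c 0) n X n i / h) - kern m (coord c (X i) / h)\<bar>)"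
      unfolding E_def by (rule sum_abs)
    also have "\<dots> \<le> (\<Sum>i<n. a1 * (\<epsilon>\<^sup>2 / h))"
    proof (rule sum_mono)
      fix i assume i: "i \<in> {..<n}"
      show "\<bar>kern m (gdist \<epsilon> (c 0) n X n i / h) - kern m (coord c (X i) / h)\<bar> \<le> a1 * (\<epsilon>\<^sup>2 / h)"
        unfolding a1_def
        by (rule kern_gdist[OF c e h \<Lambda> X \<eta>]) (use bad[OF True] i in auto)
    qed
    also have "\<dots> = real n * (a1 * (l * h))" by (simp add: eh)
    finally have "\<bar>E\<bar> / (real n * h) \<le> real n * (a1 * (l * h)) / (real n * h)"
      using n h by (intro divide_right_mono) auto
    then show ?thesis using True n h by (simp add: mult_ac)
  next
    case False
    then have b1: "b = 1" using b by simp
    have "\<bar>E\<bar> \<le> (\<Sum>i<n. \<bar>kern m (gdist \<epsilon> (c 0) n X n i / h) - kern m (coord c (X i) / h)\<bar>)"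
      unfolding E_def by (rule sum_abs)
    also have "\<dots> \<le> (\<Sum>i<n. B + B)"
      by (intro sum_mono order_trans[OF abs_triangle_ineq4] add_mono B(2))
    also have "\<dots> = real n * (2 * B)" by simp
    finally have "\<bar>E\<bar> / (real n * h) \<le> real n * (2 * B) / (real n * h)"
      using n h by (intro divide_right_mono) auto
    then have "\<bar>E\<bar> / (real n * h) \<le> 2 * B / h * b" using n h b1 by simp
    moreover have "0 \<le> l * a1" using l0 a10 by simp
    ultimately show ?thesis by linarith
  qed
  have "\<bar>\<mu> - h * f (c 0)\<bar> \<le> a2 * (l * h)"
    using kern_bias[OF h[unfolded m_def] B(2)[unfolded m_def]] by (simp add: \<mu>_def m_def a2_def hb)
  then have "\<bar>\<mu> - h * f (c 0)\<bar> / h \<le> a2 * (l * h) / h" using h by (intro divide_right_mono) auto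
  moreover have "\<bar>\<mu> - h * f (c 0)\<bar> / h = \<bar>\<mu> / h - f (c 0)\<bar>"
    using h by (simp add: abs_divide[symmetric] diff_divide_distrib) (metis abs_divide abs_of_pos diff_divide_distrib nonzero_mult_div_cancel_left order_less_irrefl)
  ultimately have bias: "\<bar>\<mu> / h - f (c 0)\<bar> \<le> l * a2" using h by (simp add: mult_ac)
  have sumeq: "(\<Sum>i<n. kern m (gdist \<epsilon> (c 0) n X n i / h)) = E + S + real n * \<mu>"
    by (simp add: E_def S_def sum_subtractf)
  have "path_kernel_estimator m h \<epsilon> (c 0) n X - f (c 0)
      = E / (real n * h) + S / (real n * h) + (\<mu> / h - f (c 0))"
    unfolding path_kernel_estimator_def sumeq using n h by (simp add: add_divide_distrib)
  then have "\<bar>path_kernel_estimator m h \<epsilon> (c 0) n X - f (c 0)\<bar>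
      \<le> \<bar>E / (real n * h)\<bar> + \<bar>S / (real n * h)\<bar> + \<bar>\<mu> / h - f (c 0)\<bar>"
    by (simp only:) (intro order_trans[OF abs_triangle_ineq add_right_mono] abs_triangle_ineq)
  also have "\<bar>E / (real n * h)\<bar> = \<bar>E\<bar> / (real n * h)" using n h by (simp add: abs_mult)
  also have "\<bar>S / (real n * h)\<bar> = l * \<bar>l * S\<bar>"
  proof -
    have "S / (real n * h) = S * l\<^sup>2" using nl' by (metis mult_1_right times_divide_eq_right)
    then show ?thesis using l0 by (simp add: abs_mult power2_eq_square mult_ac)
  qed
  also have "\<bar>E\<bar> / (real n * h) + l * \<bar>l * S\<bar> + \<bar>\<mu> / h - f (c 0)\<bar>
     \<le> (l * a1 + 2 * B / h * b) + l * \<bar>l * S\<bar> + l * a2"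
    using E bias by (intro add_mono) auto
  also have "\<dots> = l * (a + \<bar>l * S\<bar>) + 2 * B / h * b"
    unfolding a a1_def[symmetric] a2_def[symmetric] by (simp add: algebra_simps)
  finally show ?thesis unfolding l_def S_def .
qed

text \<open>With Z = |h^\<beta> S| the moment is bounded by (a + Z)^p \<le> p^p exp(a + Z), and exp
  Z by the sum of the two one-sided exponentials of \<open>exp_moment_bound\<close>. The event of an
  empty cell enters with the trivial error 2B/h to the power p, times its probability.\<close>

lemma risk_bound:
  fixes h \<epsilon> B \<Lambda> p :: real and n :: nat
  defines "m \<equiv> holder_order \<beta>"
  defines "a \<equiv> 4 * \<Lambda> * window / \<tau>\<^sup>2 + 2 * B * R * (2 ^ m) powr (\<beta> + 1)"
  assumes n: "0 < n" "4 / \<epsilon> \<le> real n" and e: "0 < \<epsilon>" "\<epsilon> < \<tau> / 16" "\<epsilon> \<le> window"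
    and h: "0 < h" "2 ^ m * h \<le> window / 2"
    and \<Lambda>: "0 \<le> \<Lambda>" "\<And>s t. \<bar>kern m s - kern m t\<bar> \<le> \<Lambda> * \<bar>s - t\<bar>"
    and B: "0 < B" "\<And>t. \<bar>kern m t\<bar> \<le> B" "2 * B * h powr \<beta> \<le> 1"
    and \<epsilon>h: "\<epsilon>\<^sup>2 = h powr (\<beta> + 2)" and nh: "real n * h powr (2 * \<beta> + 1) = 1" and p: "1 \<le> p"
  shows "integrable (PiM {..<n} (\<lambda>_. P)) (\<lambda>X. \<bar>path_kernel_estimator m h \<epsilon> (c 0) n X - f (c 0)\<bar> powr p)"
    and "(\<integral>X. \<bar>path_kernel_estimator m h \<epsilon> (c 0) n X - f (c 0)\<bar> powr p \<partial>PiM {..<n} (\<lambda>_. P))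
      \<le> 2 powr p * ((h powr \<beta>) powr p * (p powr p * exp a * (2 * exp (2 * 2 ^ m * B\<^sup>2 * fmax)))
        + (2 * B / h) powr p * (8 / \<epsilon> * exp (- (real n * (fmin * \<epsilon> / 4)))))"
proof -
  define PP where "PP = PiM {..<n} (\<lambda>_. P)"
  interpret PP: prob_space PP unfolding PP_def by (intro prob_space_PiM P(1))
  define est where "est = path_kernel_estimator m h \<epsilon> (c 0) n"
  define \<rho> where "\<rho> = h powr \<beta>"
  have \<rho>: "0 < \<rho>" using h by (simp add: \<rho>_def)
  have [measurable]: "est \<in> borel_measurable PP"
    unfolding est_def PP_def using borel_measurable_path_kernel_estimator[of m h \<epsilon> "c 0" n]
    by (simp add: measurable_cong_sets[OF sets_PiM_cong[OF refl P(2)] refl])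
  have a0: "0 \<le> a" unfolding a_def using \<Lambda>(1) window B(1) params by simp
  have est_bound: "\<bar>est X\<bar> \<le> B / h" for X
  proof -
    have "\<bar>\<Sum>i<n. kern m (gdist \<epsilon> (c 0) n X n i / h)\<bar> \<le> (\<Sum>i<n. B)"
      by (rule order_trans[OF sum_abs sum_mono]) (rule B(2))
    then have "\<bar>\<Sum>i<n. kern m (gdist \<epsilon> (c 0) n X n i / h)\<bar> / (real n * h) \<le> real n * B / (real n * h)"
      using n h by (intro divide_right_mono) auto
    then show ?thesis using n h by (simp add: est_def path_kernel_estimator_def abs_mult)
  qed
  define F where "F X = \<bar>est X - f (c 0)\<bar> powr p" for X
  have iF: "integrable PP F"
  proof (rule PP.integrable_const_bound[where B = "(B / h + \<bar>f (c 0)\<bar>) powr p"])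
    show "AE X in PP. norm (F X) \<le> (B / h + \<bar>f (c 0)\<bar>) powr p"
    proof (rule AE_I2)
      fix X
      have "\<bar>est X - f (c 0)\<bar> \<le> B / h + \<bar>f (c 0)\<bar>"
        by (rule order_trans[OF abs_triangle_ineq4 add_mono[OF est_bound order_refl]])
      then show "norm (F X) \<le> (B / h + \<bar>f (c 0)\<bar>) powr p" unfolding F_def using p by (simp add: powr_mono2)
    qed
    show "F \<in> borel_measurable PP" unfolding F_def[abs_def] by measurable
  qed
  then show "integrable (PiM {..<n} (\<lambda>_. P)) (\<lambda>X. \<bar>path_kernel_estimator m h \<epsilon> (c 0) n X - f (c 0)\<bar> powr p)"
    by (simp add: F_def[abs_def] est_def PP_def)
  \<comment> \<open>With L between q and 2q the cell length \<eta> = \<open>window\<close>/L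
    satisfies \<epsilon>/4 \<le> \<eta> \<le> \<epsilon>/2: short enough for hops between
    neighbouring cells, long enough for a mass of order \<epsilon>. The bound 2 \<le> q absorbs the
    rounding.\<close>
  define q where "q = 2 * window / \<epsilon>"
  have q: "2 \<le> q" using e by (simp add: q_def field_simps)
  define L where "L = nat \<lceil>q\<rceil>"
  have L: "q \<le> real L" "real L \<le> 2 * q" using q unfolding L_def by linarith+
  then have L0: "0 < real L" using q by linarith
  have "2 * q \<le> 4 / \<epsilon>" using window e by (simp add: q_def field_simps)
  then have Ln: "L \<le> n" using L n by linarith
  define \<eta> where "\<eta> = window / real L"
  have L\<eta>: "real L * \<eta> = window" using L0 by (simp add: \<eta>_def)
  have \<eta>0: "0 < \<eta>" using L0 window by (simp add: \<eta>_def)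
  have "q * (2 * \<eta>) \<le> real L * (2 * \<eta>)" using L \<eta>0 by (intro mult_right_mono) auto
  then have "q * (2 * \<eta>) \<le> q * \<epsilon>" using L\<eta> e by (simp add: q_def)
  then have \<eta>1: "2 * \<eta> \<le> \<epsilon>" using q by simp
  have "real L * (4 * \<eta>) \<le> 2 * q * (4 * \<eta>)" using L \<eta>0 by (intro mult_right_mono) auto
  then have "2 * q * \<epsilon> \<le> 2 * q * (4 * \<eta>)" using L\<eta> e by (simp add: q_def mult_ac)
  then have \<eta>2: "\<epsilon> / 4 \<le> \<eta>" using q by simp
  define cell where "cell s l = {y \<in> space P. real l * \<eta> \<le> s * coord c y \<and> s * coord c y < real (Suc l) * \<eta>}" for s :: real and l
  define avoid where "avoid s l = {X \<in> space PP. \<forall>i<n. X i \<notin> cell s l}" for s l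
  have cell_sets: "cell s l \<in> sets P" and avoid: "measure PP (avoid s l) \<le> exp (- (real n * (fmin * \<epsilon> / 4)))"
    if s: "\<bar>s\<bar> = 1" and l: "l < L" for s l
  proof -
    have "real (Suc l) * \<eta> \<le> real L * \<eta>" using l \<eta>0 by (intro mult_right_mono) auto
    then have w: "real (Suc l) * \<eta> < \<tau> / 2" using L\<eta> window tau_pos by linarith
    have le: "0 \<le> real l * \<eta>" "real l * \<eta> \<le> real (Suc l) * \<eta>" using \<eta>0 by (auto intro: mult_right_mono)
    show cs: "cell s l \<in> sets P" unfolding cell_def by (rule cell_mass(2)[OF s le w])
    have "fmin * (\<epsilon> / 4) \<le> fmin * (real (Suc l) * \<eta> - real l * \<eta>)"
      using \<eta>2 params by (intro mult_left_mono) (auto simp: algebra_simps)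
    also have "\<dots> \<le> measure P (cell s l)" unfolding cell_def by (rule cell_mass(1)[OF s le w])
    finally have "real n * (fmin * \<epsilon> / 4) \<le> real n * measure P (cell s l)" by (intro mult_left_mono) auto
    then have "exp (- (real n * measure P (cell s l))) \<le> exp (- (real n * (fmin * \<epsilon> / 4)))" by simp
    with PiM_all_avoid(1)[OF P(1) cs, of n]
    show "measure PP (avoid s l) \<le> exp (- (real n * (fmin * \<epsilon> / 4)))"
      unfolding avoid_def PP_def by (rule order_trans)
  qed
  have avoid_sets: "avoid s l \<in> sets PP" if "\<bar>s\<bar> = 1" "l < L" for s l
    unfolding avoid_def PP_def by (rule PiM_all_avoid(2)[OF P(1) cell_sets[OF that]])
  \<comment> \<open>Both sides of x with L cells each; 2L \<le> 8/\<epsilon> is the factor in the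
    union bound.\<close>
  define J where "J = {1, - 1 :: real} \<times> {..<L}"
  define bad where "bad = (\<Union>(s, l)\<in>J. avoid s l)"
  have bad_sets[measurable]: "bad \<in> sets PP" unfolding bad_def J_def by (intro sets.finite_UN) (auto intro: avoid_sets)
  have "measure PP bad \<le> (\<Sum>(s, l)\<in>J. measure PP (avoid s l))"
    unfolding bad_def
    by (rule order_trans[OF measure_UNION_le]) (auto simp: J_def case_prod_beta intro: avoid_sets)
  also have "\<dots> \<le> (\<Sum>(s, l)\<in>J. exp (- (real n * (fmin * \<epsilon> / 4))))"
    by (rule sum_mono) (use avoid[of 1] avoid[of "- 1"] in \<open>auto simp: J_def\<close>)
  also have "\<dots> = 2 * real L * exp (- (real n * (fmin * \<epsilon> / 4)))" by (simp add: J_def)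
  also have "\<dots> \<le> 8 / \<epsilon> * exp (- (real n * (fmin * \<epsilon> / 4)))"
    using L \<open>2 * q \<le> 4 / \<epsilon>\<close> by (intro mult_right_mono) auto
  finally have mbad: "measure PP bad \<le> 8 / \<epsilon> * exp (- (real n * (fmin * \<epsilon> / 4)))" .
  define \<mu> where "\<mu> = (\<integral>y. kern m (coord c y / h) \<partial>P)"
  define S where "S X = (\<Sum>i<n. kern m (coord c (X i) / h) - \<mu>)" for X
  have km: "(\<lambda>y. kern m (coord c y / h)) \<in> borel_measurable P" by measurable
  have exp_bound: "integrable PP (\<lambda>X. exp (l * S X))" "(\<integral>X. exp (l * S X) \<partial>PP) \<le> exp (2 * 2 ^ m * B\<^sup>2 * fmax)"
    if l: "\<bar>l\<bar> = \<rho>" for l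
  proof -
    have l2: "2 * B * \<bar>l\<bar> \<le> 1" using B(3) l by (simp add: \<rho>_def)
    note emb = exp_moment_bound[OF P(1) km B(2) kern_variance[OF h B(2)] l2, of n]
    show "integrable PP (\<lambda>X. exp (l * S X))" using emb(1) unfolding PP_def S_def \<mu>_def .
    have "h powr (2 * \<beta> + 1) = \<rho>\<^sup>2 * h"
      using h by (simp add: powr_add \<rho>_def power2_eq_square)
        (simp add: powr_add[symmetric])
    then have "real n * \<rho>\<^sup>2 * h = 1" using nh by (simp add: mult_ac)
    moreover have "l\<^sup>2 = \<rho>\<^sup>2" using l by (metis power2_abs)
    ultimately have one: "real n * (l\<^sup>2 * h) = 1" by (simp add: mult.assoc)
    have "real n * (l\<^sup>2 * (2 * 2 ^ m * B\<^sup>2 * fmax * h)) = 2 * 2 ^ m * B\<^sup>2 * fmax * (real n * (l\<^sup>2 * h))"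
      by (simp only: mult_ac)
    then have eq: "real n * (l\<^sup>2 * (2 * 2 ^ m * B\<^sup>2 * fmax * h)) = 2 * 2 ^ m * B\<^sup>2 * fmax"
      by (simp only: one mult_1_right)
    show "(\<integral>X. exp (l * S X) \<partial>PP) \<le> exp (2 * 2 ^ m * B\<^sup>2 * fmax)"
      using emb(2) unfolding PP_def S_def \<mu>_def eq .
  qed
  define G where "G X = 2 powr p * (\<rho> powr p * (p powr p * exp a * (exp (\<rho> * S X) + exp (- \<rho> * S X)))
    + (2 * B / h) powr p * indicator bad X)" for X
  have iG: "integrable PP G"
    unfolding G_def[abs_def] using exp_bound(1)[of \<rho>] exp_bound(1)[of "- \<rho>"] \<rho>
    by (intro integrable_mult_right Bochner_Integration.integrable_add integrable_real_indicator)
      (auto simp: PP.emeasure_eq_measure)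
  \<comment> \<open>The geometric estimates need sample points on M, which holds almost surely;
    hence G dominates F only almost everywhere.\<close>
  have "AE X in PP. \<forall>i\<in>{..<n}. X i \<in> M"
    unfolding PP_def by (intro AE_finite_allI AE_PiM_component P(1) AE_in_M) auto
  then have FG: "AE X in PP. F X \<le> G X"
  proof (rule AE_mp[OF _ AE_I2], intro impI)
    fix X assume XS: "X \<in> space PP" and XM: "\<forall>i\<in>{..<n}. X i \<in> M"
    define Z where "Z = \<bar>\<rho> * S X\<bar>"
    define b where "b = (indicator bad X :: real)"
    have "\<bar>est X - f (c 0)\<bar> \<le> \<rho> * (a + Z) + 2 * B / h * b"
      unfolding est_def \<rho>_def Z_def S_def \<mu>_def m_def
    proof (rule pointwise_error[where \<eta> = \<eta> and L = L and \<Lambda> = \<Lambda>])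
      show "a = 4 * \<Lambda> * window / \<tau>\<^sup>2 + 2 * B * R * (2 ^ holder_order \<beta>) powr (\<beta> + 1)"
        by (simp add: a_def m_def)
      show "b \<in> {0, 1}" by (simp add: b_def indicator_def)
      assume "b = 0"
      then have nb: "X \<notin> bad" by (simp add: b_def indicator_def split: if_splits)
      show "\<forall>s l. \<bar>s\<bar> = 1 \<and> l < L \<longrightarrow>
        (\<exists>j<n. real l * \<eta> \<le> s * coord c (X j) \<and> s * coord c (X j) < real (Suc l) * \<eta>)"
      proof (intro allI impI)
        fix s :: real and l assume sl: "\<bar>s\<bar> = 1 \<and> l < L"
        then have "(s, l) \<in> J" by (auto simp: J_def abs_if split: if_splits)
        then have "X \<notin> avoid s l" using nb by (auto simp: bad_def)
        then obtain j where "j < n" "X j \<in> cell s l" using XS by (auto simp: avoid_def)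
        then show "\<exists>j<n. real l * \<eta> \<le> s * coord c (X j) \<and> s * coord c (X j) < real (Suc l) * \<eta>"
          by (auto simp: cell_def)
      qed
    qed (use n e h \<Lambda> B \<eta>0 \<eta>1 L\<eta> Ln \<epsilon>h nh XM in \<open>auto simp: m_def\<close>)
    then have "F X \<le> (\<rho> * (a + Z) + 2 * B / h * b) powr p"
      unfolding F_def using p by (intro powr_mono2) auto
    also have "\<dots> \<le> 2 powr p * ((\<rho> * (a + Z)) powr p + (2 * B / h * b) powr p)"
      using \<rho> a0 B(1) h p by (intro powr_add_le) (auto simp: Z_def b_def)
    also have "(2 * B / h * b) powr p = (2 * B / h) powr p * b"
      using p by (cases "X \<in> bad") (auto simp: b_def)
    also have "(\<rho> * (a + Z)) powr p = \<rho> powr p * (a + Z) powr p"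
      by (rule powr_mult)
    also have "2 powr p * (\<rho> powr p * (a + Z) powr p + (2 * B / h) powr p * b) \<le> G X"
    proof -
      have "(a + Z) powr p \<le> p powr p * exp (a + Z)" using a0 p by (intro powr_le_exp) (auto simp: Z_def)
      also have "\<dots> = p powr p * exp a * exp Z" by (simp add: exp_add)
      also have "exp Z \<le> exp (\<rho> * S X) + exp (- \<rho> * S X)" by (simp add: Z_def abs_if add_increasing add_increasing2)
      finally have "(a + Z) powr p \<le> p powr p * exp a * (exp (\<rho> * S X) + exp (- \<rho> * S X))"
        by (simp add: mult_left_mono)
      then show ?thesis unfolding G_def b_def by (intro mult_left_mono add_right_mono) auto
    qed
    finally show "F X \<le> G X" .
  qed
  have "(\<integral>X. F X \<partial>PP) \<le> (\<integral>X. G X \<partial>PP)" by (rule integral_mono_AE[OF iF iG FG])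
  also have "\<dots> = 2 powr p * (\<rho> powr p * (p powr p * exp a * ((\<integral>X. exp (\<rho> * S X) \<partial>PP) + (\<integral>X. exp (- \<rho> * S X) \<partial>PP)))
    + (2 * B / h) powr p * measure PP bad)"
  proof (rule has_bochner_integral_integral_eq)
    have e: "has_bochner_integral PP (\<lambda>X. exp (l * S X)) (\<integral>X. exp (l * S X) \<partial>PP)" if "\<bar>l\<bar> = \<rho>" for l
      by (rule has_bochner_integral_integrable[OF exp_bound(1)[OF that]])
    show "has_bochner_integral PP G (2 powr p * (\<rho> powr p * (p powr p * exp a *
       ((\<integral>X. exp (\<rho> * S X) \<partial>PP) + (\<integral>X. exp (- \<rho> * S X) \<partial>PP))) + (2 * B / h) powr p * measure PP bad))"
      unfolding G_def[abs_def] using \<rho>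
      by (intro has_bochner_integral_mult_right has_bochner_integral_add e
          has_bochner_integral_real_indicator bad_sets) (auto simp: PP.emeasure_eq_measure)
  qed
  also have "\<dots> \<le> 2 powr p * (\<rho> powr p * (p powr p * exp a * (exp (2 * 2 ^ m * B\<^sup>2 * fmax) + exp (2 * 2 ^ m * B\<^sup>2 * fmax)))
    + (2 * B / h) powr p * (8 / \<epsilon> * exp (- (real n * (fmin * \<epsilon> / 4)))))"
    using exp_bound(2)[of \<rho>] exp_bound(2)[of "- \<rho>"] \<rho> mbad
    by (intro mult_left_mono add_mono) auto
  finally show "(\<integral>X. \<bar>path_kernel_estimator m h \<epsilon> (c 0) n X - f (c 0)\<bar> powr p \<partial>PiM {..<n} (\<lambda>_. P))
      \<le> 2 powr p * ((h powr \<beta>) powr p * (p powr p * exp a * (2 * exp (2 * 2 ^ m * B\<^sup>2 * fmax)))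
        + (2 * B / h) powr p * (8 / \<epsilon> * exp (- (real n * (fmin * \<epsilon> / 4)))))"
    by (simp add: F_def[abs_def] est_def PP_def \<rho>_def)
qed

end

text \<open>The expected number of observations in a cell is at least of order n\<epsilon> = n^(1 -
  v), and v < 1 because \<beta>/2 + 1 < 2\<beta> + 1. The exponential of minus this power beats all
  powers of n, including those from 1/h and 1/\<epsilon>.\<close>

lemma bandwidth_conditions:
  fixes \<beta> :: real
  assumes "0 < \<beta>" "0 < \<delta>" "0 < fmin" "0 < B" "1 \<le> p"
  defines "h \<equiv> \<lambda>n::nat. real n powr (- (1 / (2 * \<beta> + 1)))"
  defines "\<epsilon> \<equiv> \<lambda>n. h n powr (\<beta> / 2 + 1)"
  shows "\<forall>\<^sub>F n in sequentially. 0 < n \<and> 4 / \<epsilon> n \<le> real n \<and> \<epsilon> n < \<delta> \<and> h n < \<delta> \<and> h n powr \<beta> < \<delta> \<and>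
    (2 * B / h n) powr p * (8 / \<epsilon> n * exp (- (real n * (fmin * \<epsilon> n / 4)))) \<le> (h n powr \<beta>) powr p"
proof -
  define u where "u = 1 / (2 * \<beta> + 1)"
  define v where "v = u * (\<beta> / 2 + 1)"
  have u: "0 < u" "u * (2 * \<beta> + 1) = 1" using assms(1) by (auto simp: u_def)
  have v: "0 < v" "v < 1" using assms(1) by (auto simp: v_def u_def field_simps)
  define w where "w = 1 - v"
  have w: "0 < w" using v by (simp add: w_def)
  define ub where "ub = u * \<beta>"
  have ub: "0 < ub" using u assms(1) by (simp add: ub_def)
  define a where "a = fmin / 4"
  have a: "0 < a" using assms(3) by (simp add: a_def)
  have h: "h n = real n powr (- u)" for n by (simp add: h_def u_def)
  have \<epsilon>: "\<epsilon> n = real n powr (- v)" for n by (simp add: \<epsilon>_def h powr_powr v_def)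
  have hb: "h n powr \<beta> = real n powr (- ub)" for n by (simp add: h powr_powr ub_def)
  have "(\<lambda>n. real n powr (- v)) \<longlonglongrightarrow> 0" "(\<lambda>n. real n powr (- u)) \<longlonglongrightarrow> 0" "(\<lambda>n. real n powr (- ub)) \<longlonglongrightarrow> 0"
    using u(1) v(1) ub by real_asymp+
  then have 1: "\<forall>\<^sub>F n in sequentially. real n powr (- v) < \<delta>" "\<forall>\<^sub>F n in sequentially. real n powr (- u) < \<delta>"
      "\<forall>\<^sub>F n in sequentially. real n powr (- ub) < \<delta>"
    using assms(2) by (auto intro: order_tendstoD(2))
  have 2: "\<forall>\<^sub>F n in sequentially. 4 * real n powr v \<le> real n" using v by real_asymp
  define K where "K = 8 * (2 * B) powr p"
  \<comment> \<open>The powers of n that come from h^(-p), from 1/\<epsilon>, and from dividing by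
    the target h^(\<beta> p).\<close>
  define e where "e = u * p + v + ub * p"
  have "(\<lambda>n. K * (real n powr e * exp (- (a * real n powr w)))) \<longlonglongrightarrow> 0"
    using w a by real_asymp
  then have 3: "\<forall>\<^sub>F n in sequentially. K * (real n powr e * exp (- (a * real n powr w))) < 1"
    by (rule order_tendstoD) simp
  show ?thesis
    using 1 2 3 eventually_gt_at_top[of 0]
  proof eventually_elim
    case (elim n)
    then have n: "0 < real n" by simp
    have "(2 * B / h n) powr p * (8 / \<epsilon> n * exp (- (real n * (fmin * \<epsilon> n / 4))))
        = real n powr (- (ub * p)) * (K * (real n powr e * exp (- (a * real n powr w))))"
    proof -
      have "(2 * B / h n) powr p = (2 * B) powr p * real n powr (u * p)"
        using assms(4) n by (simp add: h powr_minus powr_mult powr_powr field_simps)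
      moreover have "8 / \<epsilon> n = 8 * real n powr v" using n by (simp add: \<epsilon> powr_minus field_simps)
      moreover have "real n * (fmin * \<epsilon> n / 4) = a * real n powr w"
        using n by (simp add: \<epsilon> a_def w_def powr_diff powr_minus field_simps)
      moreover have "real n powr (u * p) * real n powr v = real n powr (- (ub * p)) * real n powr e"
        by (simp add: powr_add[symmetric] e_def)
      ultimately show ?thesis by (simp add: K_def mult_ac)
    qed
    also have "\<dots> \<le> real n powr (- (ub * p)) * 1" using elim by (intro mult_left_mono) auto
    also have "\<dots> = (h n powr \<beta>) powr p" by (simp add: hb powr_powr)
    finally have 4: "(2 * B / h n) powr p * (8 / \<epsilon> n * exp (- (real n * (fmin * \<epsilon> n / 4)))) \<le> (h n powr \<beta>) powr p" .
    have "4 / \<epsilon> n = 4 * real n powr v" using n by (simp add: \<epsilon> powr_minus field_simps)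
    then show ?case using elim 4 unfolding hb by (simp add: h \<epsilon>)
  qed
qed

section \<open>From the model class to a density on a curve\<close>

lemma model_arc:
  fixes P :: "'a::euclidean_space measure"
  assumes "P \<in> model_class 1 x \<alpha> \<beta> \<tau> L fmin fmax R" "f \<in> model_densities 1 \<beta> fmin fmax R P"
    and "0 < \<tau>" "0 < \<beta>" "0 \<le> R" "0 < fmin"
  obtains c where "curve_density (measure_support P) \<tau> P f \<beta> R fmin fmax c" "c 0 = x"
proof -
  define M where "M = measure_support P"
  have P: "sets P = sets borel" "prob_space P" and M: "M \<in> manifold_class 1 x \<tau>"
    using assms(1) by (auto simp: model_class_def holder_manifold_class_def M_def)
  then have M': "compact M" "smooth_submanifold 1 M" "x \<in> M" "ennreal \<tau> \<le> reach M"
    by (auto simp: manifold_class_def)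
  interpret unique_projection M \<tau> by (rule unique_projectionI) (use M' assms(3) in auto)
  interpret closed_curve M \<tau> by standard (rule M'(2))
  obtain c where c: "unit_speed UNIV c" "c 0 = x" by (rule arc_exists_global[OF M'(3)])
  have "curve_density M \<tau> P f \<beta> R fmin fmax c"
  proof (rule curve_density.intro[OF closed_curve_axioms], rule curve_density_axioms.intro)
    show "prob_space P" "sets P = sets borel" by (rule P)+
    show "unit_speed UNIV c" by (rule c(1))
    show "0 < \<beta>" "0 \<le> R" "0 < fmin" by (rule assms)+
    show "P = density (volume_measure 1 M) (\<lambda>y. ennreal (f y))" "f \<in> borel_measurable borel"
      "f \<in> holder_class M \<beta>" "holder_norm M \<beta> f \<le> ennreal R"
      using assms(2) unfolding model_densities_def M_def by blast+
    show "fmin \<le> f y" "f y \<le> fmax" if "y \<in> M" for y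
      using assms(2) that unfolding model_densities_def M_def by blast+
  qed
  then show thesis using that c(2) unfolding M_def by blast
qed

theorem theorem3p3:
  fixes \<tau> L R fmin fmax p \<beta> :: real
  assumes "CARD('n::finite) \<ge> 2"
    and "\<tau> > 0" and "L > 0" and "R > 0" and "0 < fmin" and "fmin < fmax" and "p \<ge> 1" and "\<beta> > 0"
  shows "\<exists>fhat :: real ^ 'n \<Rightarrow> nat \<Rightarrow> (nat \<Rightarrow> real ^ 'n) \<Rightarrow> real.
    (\<forall>x n. fhat x n \<in> borel_measurable (PiM {..<n} (\<lambda>_. borel))) \<and>
    (\<forall>\<alpha>\<ge>0. \<exists>C>0. \<exists>n0. \<forall>x. \<forall>n\<ge>n0.
       (SUP P \<in> model_class 1 x \<alpha> \<beta> \<tau> L fmin fmax R. SUP f \<in> model_densities 1 \<beta> fmin fmax R P.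
          Lp_size p (PiM {..<n} (\<lambda>_. P)) (\<lambda>X. fhat x n X - f x))
       \<le> ennreal (C * real n powr (- \<beta> / (2 * \<beta> + 1))))"
proof -
  define m where "m = holder_order \<beta>"
  define W where "W = min 1 (\<tau> / 4)"
  obtain \<Lambda> where \<Lambda>: "0 \<le> \<Lambda>" "\<And>s t. \<bar>kern m s - kern m t\<bar> \<le> \<Lambda> * \<bar>s - t\<bar>" using kern_lipschitz by blast
  obtain B where B: "0 < B" "\<And>t. \<bar>kern m t\<bar> \<le> B" using kern_bounded by blast
  define h where "h n = real n powr (- (1 / (2 * \<beta> + 1)))" for n
  define \<epsilon> where "\<epsilon> n = h n powr (\<beta> / 2 + 1)" for n
  define fhat where "fhat x n = path_kernel_estimator m (h n) (\<epsilon> n) x n" for x :: "real ^ 'n" and n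
  define K where "K = p powr p * exp (4 * \<Lambda> * W / \<tau>\<^sup>2 + 2 * B * R * (2 ^ m) powr (\<beta> + 1)) * (2 * exp (2 * 2 ^ m * B\<^sup>2 * fmax))"
  have K: "0 \<le> K" by (simp add: K_def)
  \<comment> \<open>K comes from the sample with all cells hit, the summand 1 from the event of an
    empty cell.\<close>
  define C where "C = (2 powr p * (K + 1)) powr (1 / p)"
  \<comment> \<open>The bounds \<tau>/16 and W are for \<epsilon>; W/(2 * 2^m) puts the support of
    the kernel into half the window; 1/(2B) makes h^\<beta> small enough for the exponential
    moment.\<close>
  define \<delta> where "\<delta> = Min {\<tau> / 16, W, W / (2 * 2 ^ m), 1 / (2 * B)}"
  have "0 < W" using assms(2) by (simp add: W_def)
  then have \<delta>: "0 < \<delta>" "\<delta> \<le> \<tau> / 16" "\<delta> \<le> W" "\<delta> \<le> W / (2 * 2 ^ m)" "\<delta> \<le> 1 / (2 * B)"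
    using assms(2) B(1) by (auto simp: \<delta>_def)
  obtain n0 where n0: "\<And>n. n0 \<le> n \<Longrightarrow> 0 < n \<and> 4 / \<epsilon> n \<le> real n \<and> \<epsilon> n < \<delta> \<and> h n < \<delta> \<and> h n powr \<beta> < \<delta> \<and>
    (2 * B / h n) powr p * (8 / \<epsilon> n * exp (- (real n * (fmin * \<epsilon> n / 4)))) \<le> (h n powr \<beta>) powr p"
    using bandwidth_conditions[OF assms(8) \<delta>(1) assms(5) B(1) assms(7)]
    unfolding eventually_sequentially h_def \<epsilon>_def by blast
  have bound: "Lp_size p (PiM {..<n} (\<lambda>_. P)) (\<lambda>X. fhat x n X - f x) \<le> ennreal (C * real n powr (- \<beta> / (2 * \<beta> + 1)))"
    if n: "n0 \<le> n" and P: "P \<in> model_class 1 x \<alpha> \<beta> \<tau> L fmin fmax R" "f \<in> model_densities 1 \<beta> fmin fmax R P"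
    for n x \<alpha> P f
  proof -
    obtain c where cd: "curve_density (measure_support P) \<tau> P f \<beta> R fmin fmax c" "c 0 = x"
      by (rule model_arc[OF P]) (use assms in auto)
    interpret curve_density "measure_support P" \<tau> P f \<beta> R fmin fmax c by (rule cd(1))
    have W: "window = W" by (simp add: window_def W_def)
    note n0 = n0[OF n]
    have hp: "0 < h n" using n0 by (simp add: h_def)
    have ep: "0 < \<epsilon> n" using hp by (simp add: \<epsilon>_def)
    have e2: "(\<epsilon> n)\<^sup>2 = h n powr (\<beta> + 2)"
      by (simp add: \<epsilon>_def power2_eq_square powr_add[symmetric])
    have nh: "real n * h n powr (2 * \<beta> + 1) = 1"
    proof -
      have "- (1 / (2 * \<beta> + 1)) * (2 * \<beta> + 1) = - 1" using assms(8) by simp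
      then have "h n powr (2 * \<beta> + 1) = real n powr (- 1)" by (simp only: h_def powr_powr)
      then show ?thesis using n0 by (simp add: powr_minus)
    qed
    have hw: "2 ^ m * h n \<le> W / 2"
    proof -
      have "2 ^ m * h n \<le> 2 ^ m * (W / (2 * 2 ^ m))" using n0 \<delta>(4) by (intro mult_left_mono) auto
      then show ?thesis by simp
    qed
    have hB: "2 * B * h n powr \<beta> \<le> 1"
    proof -
      have "2 * B * h n powr \<beta> \<le> 2 * B * (1 / (2 * B))" using n0 \<delta>(5) B(1) by (intro mult_left_mono) auto
      then show ?thesis using B(1) by simp
    qed
    have risk: "integrable (PiM {..<n} (\<lambda>_. P)) (\<lambda>X. \<bar>fhat x n X - f x\<bar> powr p)"
      "(\<integral>X. \<bar>fhat x n X - f x\<bar> powr p \<partial>PiM {..<n} (\<lambda>_. P))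
      \<le> 2 powr p * ((h n powr \<beta>) powr p * K
        + (2 * B / h n) powr p * (8 / \<epsilon> n * exp (- (real n * (fmin * \<epsilon> n / 4)))))"
      unfolding fhat_def m_def cd(2)[symmetric] K_def W[symmetric]
      by (rule risk_bound; use n0 ep hp \<delta> hw hB e2 nh assms \<Lambda> B in \<open>auto simp: W m_def\<close>)+
    have "(\<integral>X. \<bar>fhat x n X - f x\<bar> powr p \<partial>PiM {..<n} (\<lambda>_. P))
      \<le> 2 powr p * ((h n powr \<beta>) powr p * K + (h n powr \<beta>) powr p)"
      by (rule order_trans[OF risk(2)]) (use n0 in \<open>intro mult_left_mono add_left_mono; simp\<close>)
    also have "\<dots> = (h n powr \<beta>) powr p * (2 powr p * (K + 1))" by (simp add: algebra_simps)
    finally have "(\<integral>X. \<bar>fhat x n X - f x\<bar> powr p \<partial>PiM {..<n} (\<lambda>_. P)) powr (1 / p)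
      \<le> ((h n powr \<beta>) powr p * (2 powr p * (K + 1))) powr (1 / p)"
      using assms(7) by (intro powr_mono2 integral_nonneg_AE) auto
    also have "\<dots> = h n powr \<beta> * C"
      using K assms(7) by (simp add: powr_mult powr_powr C_def)
    also have "h n powr \<beta> = real n powr (- \<beta> / (2 * \<beta> + 1))" by (simp add: h_def powr_powr)
    finally show ?thesis
      unfolding Lp_size_def using risk(1) by (simp add: ennreal_leI mult.commute)
  qed
  \<comment> \<open>C and \<open>n0\<close> were fixed without reference to \<alpha> or x, so the
    same witnesses serve all of them.\<close>
  have "0 < C" using K by (simp add: C_def)
  then have "\<forall>\<alpha>\<ge>0. \<exists>C>0. \<exists>n0. \<forall>x. \<forall>n\<ge>n0.
       (SUP P \<in> model_class 1 x \<alpha> \<beta> \<tau> L fmin fmax R. SUP f \<in> model_densities 1 \<beta> fmin fmax R P.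
          Lp_size p (PiM {..<n} (\<lambda>_. P)) (\<lambda>X. fhat x n X - f x))
       \<le> ennreal (C * real n powr (- \<beta> / (2 * \<beta> + 1)))"
    by (intro allI impI exI[of _ C] conjI exI[of _ n0] SUP_least bound)
  moreover have "\<forall>x n. fhat x n \<in> borel_measurable (PiM {..<n} (\<lambda>_. borel))"
    unfolding fhat_def using borel_measurable_path_kernel_estimator by blast
  ultimately show ?thesis by blast
qed

end
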